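(* Let $J^B$ be the Jacobian of the generic base-family curve $C_{\rho(m)}\colon y^2=F_{\rho(m)}(u)$ over the rational function field $\mathbb{Q}(m)$, where \[ \rho(m)=\frac{6-2m}{m^2+7}. \] Then $\operatorname{rank}J^B(\mathbb{Q}(m))\geq2$.
   Context: For $\rho$ in a field of characteristic $0$, $F_\rho(u)=Q_\rho(u)S_\rho(u)$ where \[ Q_{\rho}(u)=u^{2}-2(1-\rho)u+\rho^{2}-1, \] \[ S_{\rho}(u)=u^{4}+2(1-\rho)u^{3}+(1-\rho)(3-5\rho)u^{2}-4(1-\rho)^{2}(1+\rho)u-4(1-\rho)^{3}(1+\rho). \] For $\rho=\rho(m)$ the curve $y^2=F_{\rho(m)}(u)$ is a smooth curve of genus $2$ over $\mathbb{Q}(m)$ (meaning its smooth projective model). The rank is the Mordell--Weil rank of the group of $\mathbb{Q}(m)$-rational points of the Jacobian. *)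

theory Defs
  imports
    "HOL-Algebra.Algebraic_Closure_Type"
    "HOL-Algebra.Free_Abelian_Groups"
    "HOL-Library.Extended_Nat"
    "HOL-Computational_Algebra.Computational_Algebra"
begin

section \<open>Points of the smooth projective model\<close>

text \<open>
  Let \<open>F\<close> be a squarefree polynomial of degree 6 over an algebraically closed field \<open>k\<close> of
  characteristic 0. The smooth projective model of \<open>y\<^sup>2 = F(u)\<close> is glued from the affine curve
  \<open>y\<^sup>2 = F(u)\<close> and the affine curve \<open>w\<^sup>2 = s\<^sup>6 F(1/s)\<close> via \<open>s = 1/u\<close>, \<open>w = y/u\<^sup>3\<close>. The points of the
  second chart that are not in the first one have \<open>s = 0\<close>, so that \<open>w\<^sup>2\<close> is the leading coefficient
  of \<open>F\<close>; \<open>AtInf w\<close> is the point \<open>(s, w) = (0, w)\<close>.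
\<close>

datatype 'k point = Affine 'k 'k | AtInf 'k

definition curve_points :: "'k::field poly \<Rightarrow> 'k point set" where
  "curve_points F = {Affine x y | x y. y ^ 2 = poly F x} \<union> {AtInf w | w. w ^ 2 = coeff F 6}"

section \<open>Function field and local rings\<close>

text \<open>
  The function field \<open>k(u)(\<surd>F)\<close> is realised inside an algebraic closure of \<open>k(u)\<close>.
\<close>

type_synonym 'k fun_ext = "'k poly fract alg_closure"

definition fun_const :: "'k::field \<Rightarrow> 'k fun_ext" where
  "fun_const c = to_ac (Fract [:c:] 1)"

definition fun_u :: "'k::field fun_ext" where
  "fun_u = to_ac (Fract [:0, 1:] 1)"

definition fun_y :: "'k::field poly \<Rightarrow> 'k fun_ext" where
  "fun_y F = (SOME y. y ^ 2 = to_ac (Fract F 1))"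

text \<open>
  An element of \<open>'k poly poly\<close> is a bivariate polynomial \<open>G(X, Y)\<close>, the outer variable being \<open>Y\<close>.
\<close>

definition eval2 :: "'k::field poly poly \<Rightarrow> 'k \<times> 'k \<Rightarrow> 'k" where
  "eval2 G p = poly (poly G [:snd p:]) (fst p)"

definition fun_eval2 :: "'k::field poly poly \<Rightarrow> 'k fun_ext \<times> 'k fun_ext \<Rightarrow> 'k fun_ext" where
  "fun_eval2 G f = poly (map_poly (\<lambda>g. poly (map_poly fun_const g) (fst f)) G) (snd f)"

definition function_field :: "'k::field poly \<Rightarrow> 'k fun_ext set" where
  "function_field F =
     {fun_eval2 G (fun_u, fun_y F) / fun_eval2 H (fun_u, fun_y F) | G H.
        fun_eval2 H (fun_u, fun_y F) \<noteq> 0}"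

text \<open>
  The coordinate functions of the chart used at a point, and the coordinates of the point in it.
\<close>

fun chart :: "'k::field poly \<Rightarrow> 'k point \<Rightarrow> 'k fun_ext \<times> 'k fun_ext" where
  "chart F (Affine x y) = (fun_u, fun_y F)"
| "chart F (AtInf w) = (1 / fun_u, fun_y F / fun_u ^ 3)"

fun coords :: "'k::field point \<Rightarrow> 'k \<times> 'k" where
  "coords (Affine x y) = (x, y)"
| "coords (AtInf w) = (0, w)"

definition local_ring :: "'k::field poly \<Rightarrow> 'k point \<Rightarrow> 'k fun_ext set" where
  "local_ring F P =
     {fun_eval2 G (chart F P) / fun_eval2 H (chart F P) | G H. eval2 H (coords P) \<noteq> 0}"

definition local_max_ideal :: "'k::field poly \<Rightarrow> 'k point \<Rightarrow> 'k fun_ext set" where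
  "local_max_ideal F P =
     {fun_eval2 G (chart F P) / fun_eval2 H (chart F P) | G H.
        eval2 G (coords P) = 0 \<and> eval2 H (coords P) \<noteq> 0}"

definition uniformizer :: "'k::field poly \<Rightarrow> 'k point \<Rightarrow> 'k fun_ext \<Rightarrow> bool" where
  "uniformizer F P t \<longleftrightarrow> local_max_ideal F P = {t * g | g. g \<in> local_ring F P}"

text \<open>
  The local rings at the points of the smooth model are discrete valuation rings, hence the order
  below is uniquely determined for each nonzero element of the function field.
\<close>

definition ord_at :: "'k::field poly \<Rightarrow> 'k point \<Rightarrow> 'k fun_ext \<Rightarrow> int" where
  "ord_at F P f =
     (THE n. \<exists>t g. uniformizer F P t \<and> g \<in> local_ring F P - local_max_ideal F P \<and> f = t powi n * g)"

section \<open>Divisors and divisor classes\<close>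

definition divisor_degree :: "('k point \<Rightarrow>\<^sub>0 int) \<Rightarrow> int" where
  "divisor_degree D = (\<Sum>P\<in>Poly_Mapping.keys D. Poly_Mapping.lookup D P)"

definition divisor_group :: "'k::field poly \<Rightarrow> ('k point \<Rightarrow>\<^sub>0 int) monoid" where
  "divisor_group F = free_Abelian_group (curve_points F)"

definition principal_divisors :: "'k::field poly \<Rightarrow> ('k point \<Rightarrow>\<^sub>0 int) set" where
  "principal_divisors F =
     {D \<in> carrier (divisor_group F). \<exists>f \<in> function_field F - {0}.
        \<forall>P \<in> curve_points F. Poly_Mapping.lookup D P = ord_at F P f}"

definition picard_group :: "'k::field poly \<Rightarrow> ('k point \<Rightarrow>\<^sub>0 int) set monoid" where
  "picard_group F = divisor_group F Mod principal_divisors F"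

definition picard_group_0 :: "'k::field poly \<Rightarrow> ('k point \<Rightarrow>\<^sub>0 int) set monoid" where
  "picard_group_0 F = (picard_group F)
     \<lparr>carrier := {c \<in> carrier (picard_group F). \<exists>D \<in> c. divisor_degree D = 0}\<rparr>"

section \<open>Rational points of the Jacobian\<close>

text \<open>
  In characteristic 0 the algebraic closure is a separable closure, and the group of \<open>K\<close>-rational
  points of the Jacobian of a curve over \<open>K\<close> is the group of Galois invariant divisor classes
  of degree 0 on the curve over the algebraic closure of \<open>K\<close>.
\<close>

definition absolute_galois :: "('a::field alg_closure \<Rightarrow> 'a alg_closure) set" where
  "absolute_galois =
     {\<sigma>. bij \<sigma> \<and> (\<forall>x y. \<sigma> (x + y) = \<sigma> x + \<sigma> y) \<and> (\<forall>x y. \<sigma> (x * y) = \<sigma> x * \<sigma> y) \<and>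
         (\<forall>a. \<sigma> (to_ac a) = to_ac a)}"

definition galois_divisor :: "('k \<Rightarrow> 'k) \<Rightarrow> ('k point \<Rightarrow>\<^sub>0 int) \<Rightarrow> ('k point \<Rightarrow>\<^sub>0 int)" where
  "galois_divisor \<sigma> = frag_extend (\<lambda>P. frag_of (map_point \<sigma> P))"

definition jacobian_points ::
    "'a::field_char_0 poly \<Rightarrow> ('a alg_closure point \<Rightarrow>\<^sub>0 int) set monoid" where
  "jacobian_points F =
     (let J = picard_group_0 (map_poly to_ac F)
      in J\<lparr>carrier := {c \<in> carrier J. \<forall>\<sigma> \<in> absolute_galois. galois_divisor \<sigma> ` c = c}\<rparr>)"

section \<open>Rank of an abelian group\<close>

definition int_independent :: "('g, 'b) monoid_scheme \<Rightarrow> 'g set \<Rightarrow> bool" where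
  "int_independent G S \<longleftrightarrow> S \<subseteq> carrier G \<and> finite S \<and>
     (\<forall>c :: 'g \<Rightarrow> int. finprod G (\<lambda>s. s [^]\<^bsub>G\<^esub> c s) S = \<one>\<^bsub>G\<^esub> \<longrightarrow> (\<forall>s\<in>S. c s = 0))"

definition group_rank :: "('g, 'b) monoid_scheme \<Rightarrow> enat" where
  "group_rank G = (SUP S \<in> {S. int_independent G S}. enat (card S))"

section \<open>The base family\<close>

definition Q_poly :: "'a::field_char_0 \<Rightarrow> 'a poly" where
  "Q_poly \<rho> = [: \<rho>^2 - 1, - 2 * (1 - \<rho>), 1 :]"

definition S_poly :: "'a::field_char_0 \<Rightarrow> 'a poly" where
  "S_poly \<rho> = [: - 4 * (1 - \<rho>)^3 * (1 + \<rho>), - 4 * (1 - \<rho>)^2 * (1 + \<rho>),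
                (1 - \<rho>) * (3 - 5 * \<rho>), 2 * (1 - \<rho>), 1 :]"

definition F_poly :: "'a::field_char_0 \<Rightarrow> 'a poly" where
  "F_poly \<rho> = Q_poly \<rho> * S_poly \<rho>"

type_synonym rat_fun = "rat poly fract"

definition var_m :: rat_fun where
  "var_m = Fract [:0, 1:] 1"

definition rho_m :: rat_fun where
  "rho_m = (6 - 2 * var_m) / (var_m^2 + 7)"

end

theory Submission
  imports Defs
begin

text \<open>
  The curve carries the three rational points \<open>P\<^sub>0, P\<^sub>1, P\<^sub>2\<close> with \<open>u\<close>-coordinates \<open>0\<close>,
  \<open>4(m + 1)/(m\<^sup>2 + 7)\<close> and \<open>\<rho> - 1\<close>, and the classes of \<open>P\<^sub>0 - P\<^sub>2\<close> and \<open>P\<^sub>1 - P\<^sub>2\<close> are independent. The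
  reason is a degeneration at a pole of \<open>\<rho>\<close>, the place \<open>m = s\<close> with \<open>s\<^sup>2 = -7\<close>. In the coordinates
  \<open>v = u/\<rho>\<close>, \<open>w = y/\<rho>\<^sup>3\<close> the curve becomes \<open>w\<^sup>2 = h(v)\<^sup>2\<close> with \<open>h = (v + 1)(v\<^sup>2 - v + 2)\<close> there: two rational
  curves \<open>w = \<plusminus>h(v)\<close> that meet in three nodes. All three points specialize to the component \<open>w = h(v)\<close>,
  away from the nodes, namely to \<open>v\<^sub>0 = 0\<close>, \<open>v\<^sub>1 = (s - 1)/2\<close> and \<open>v\<^sub>2 = 1\<close>.

  Suppose that \<open>\<Sum>e\<^sub>iP\<^sub>i\<close>, where \<open>\<Sum>e\<^sub>i = 0\<close>, is the divisor of a function. Suitably normalized, the function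
  restricts to a nonzero constant on the component \<open>w = -h(v)\<close> and to a nonzero constant multiple of
  \<open>\<Prod>(v - v\<^sub>i)\<close> with exponents \<open>e\<^sub>i\<close> on the other one. The two restrictions agree at the nodes, so that
  this product takes the same value at all three nodes (\<open>node_relation\<close>). The squared absolute values
  of the numbers \<open>\<xi> - v\<^sub>i\<close>, for \<open>\<xi>\<close> a node, are powers of 2, and comparing the exponents leaves only
  \<open>e\<^sub>i = 0\<close> (\<open>multiplicative_independence\<close>).

  The function a priori has coefficients in the algebraic closure of \<open>\<rat>(m)\<close>. Clearing its finite poles
  turns it into \<open>A + By\<close> with polynomials \<open>A\<close>, \<open>B\<close> of bounded degree. That such a function vanishes to
  order \<open>n\<close> at a point is expressed by the recursive predicate \<open>vanishes\<close>, a division algorithm that is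
  linear in \<open>A\<close> and \<open>B\<close>, has coefficients in the field of definition of the point, and divides only by
  a monic linear polynomial. Linearity allows one to push \<open>A\<close> and \<open>B\<close> down to \<open>\<rat>(m)\<close> by a
  linear functional (\<open>principal_imp_rational_polynomials\<close>); monic division makes sense over a valuation
  ring and therefore specializes (\<open>vanishes_reduce\<close>). The same predicate computes the order at every
  smooth point (\<open>vanishes_iff\<close>) and is visibly compatible with field automorphisms; this yields that
  the Galois group acts on principal divisors and hence, for divisors supported at rational points,
  reduces the rank of the group of rational points to a statement about divisors (\<open>rank_ge_2\<close>).
\<close>

section \<open>Coefficientwise maps of polynomials\<close>

lemma map_poly_additive:
  fixes h :: "'a::ab_group_add \<Rightarrow> 'b::ab_group_add"
  assumes "\<And>a b. h (a + b) = h a + h b"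
  shows "map_poly h (p + q) = map_poly h p + map_poly h q"
proof -
  have "h 0 = 0" using assms[of 0 0] by simp
  then show ?thesis by (intro poly_eqI) (simp add: coeff_map_poly assms)
qed

lemma map_poly_multiplicative:
  fixes h :: "'a::comm_ring_1 \<Rightarrow> 'b::comm_ring_1"
  assumes add: "\<And>a b. h (a + b) = h a + h b" and mul: "\<And>a b. h (a * b) = h a * h b"
  shows "map_poly h (p * q) = map_poly h p * map_poly h q"
proof -
  have 0: "h 0 = 0" using add[of 0 0] by simp
  have s: "h (sum f A) = (\<Sum>x\<in>A. h (f x))" for f :: "nat \<Rightarrow> 'a" and A
    by (induction A rule: infinite_finite_induct) (auto simp: 0 add)
  show ?thesis by (intro poly_eqI) (simp add: coeff_map_poly 0 coeff_mult s mul)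
qed

lemma degree_map_poly_le: "h 0 = 0 \<Longrightarrow> degree (map_poly h p) \<le> degree p"
  by (intro degree_le) (simp add: coeff_map_poly coeff_eq_0)

lemma fun_const_0 [simp]: "fun_const 0 = 0"
  by (simp add: fun_const_def flip: Zero_fract_def)

lemma fun_const_1 [simp]: "fun_const 1 = 1"
  by (simp add: fun_const_def flip: One_fract_def one_pCons)

lemma fun_const_add [simp]: "fun_const (a + b) = fun_const a + fun_const b"
  by (simp add: fun_const_def flip: to_ac_add)

lemma fun_const_mult [simp]: "fun_const (a * b) = fun_const a * fun_const b"
  by (simp add: fun_const_def mult.commute flip: to_ac_mult)

text \<open>
  Polynomials with constant coefficients are evaluated at an arbitrary function, since the coordinate of
  a chart is \<open>u\<close> near the finite points but \<open>1/u\<close> near the points at infinity.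
\<close>

definition poly_at :: "'k::field poly \<Rightarrow> 'k fun_ext \<Rightarrow> 'k fun_ext" where
  "poly_at A U = poly (map_poly fun_const A) U"

lemma poly_at_0 [simp]: "poly_at 0 U = 0" and poly_at_1 [simp]: "poly_at 1 U = 1"
  and poly_at_pCons: "poly_at (pCons a A) U = fun_const a + U * poly_at A U"
  by (simp_all add: poly_at_def map_poly_pCons)

lemma poly_at_add [simp]: "poly_at (A + B) U = poly_at A U + poly_at B U"
  by (simp add: poly_at_def map_poly_additive)

lemma poly_at_mult [simp]: "poly_at (A * B) U = poly_at A U * poly_at B U"
  by (simp add: poly_at_def map_poly_multiplicative)

lemma poly_at_minus [simp]: "poly_at (- A) U = - poly_at A U"
  using poly_at_add[of A "- A" U] by (simp add: add_eq_0_iff)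

lemma poly_at_power [simp]: "poly_at (A ^ n) U = poly_at A U ^ n"
  by (induction n) simp_all

section \<open>Vanishing along the curve by repeated division\<close>

text \<open>
  Let \<open>y\<^sup>2 = F(x)\<close>. Write \<open>U\<close>, \<open>V\<close> for the coordinate functions on the curve \<open>V\<^sup>2 = F(U)\<close>. The equations say that
  \<open>(A + BV)(V + y) = (U - x)(C + DV)\<close>. The function \<open>(U - x)/(V + y)\<close> is a
  uniformizer at every smooth point \<open>(x, y)\<close>: if \<open>y \<noteq> 0\<close>, then \<open>V + y\<close> is a unit and \<open>U - x\<close> has order 1; if
  \<open>y = 0\<close>, then \<open>V\<close> has order 1 and \<open>U - x\<close> order 2. So every step lowers the order of vanishing by one,
  at ordinary points and at branch points alike.
\<close>

fun vanishes :: "'k::field poly \<Rightarrow> 'k \<Rightarrow> 'k \<Rightarrow> nat \<Rightarrow> 'k poly \<Rightarrow> 'k poly \<Rightarrow> bool" where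
  "vanishes F x y 0 A B = True"
| "vanishes F x y (Suc n) A B =
     (\<exists>C D. smult y A + B * F = [:- x, 1:] * C \<and> A + smult y B = [:- x, 1:] * D \<and>
        vanishes F x y n C D)"

text \<open>
  The predicate is linear in \<open>A\<close> and \<open>B\<close> over any field containing \<open>x\<close>, \<open>y\<close> and the coefficients of \<open>F\<close>.
  Stating this for a semilinear map covers both uses: a field automorphism acting on everything, and a
  linear functional from the algebraic closure to the base field.
\<close>

lemma vanishes_map:
  assumes add: "\<And>a b. T (a + b) = T a + (T b :: 'l::field)"
    and x: "\<And>z. T (x * z) = x' * T z" and y: "\<And>z. T (y * z) = y' * T z"
    and F: "\<And>i z. T (z * coeff F i) = T z * coeff F' i"
    and van: "vanishes F x y n A B"
  shows "vanishes F' x' y' n (map_poly T A) (map_poly T B)"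
  using van
proof (induction n arbitrary: A B)
  case (Suc n)
  have 0: "T 0 = 0" using add[of 0 0] by (metis add_cancel_right_right)
  have minus: "T (- a) = - T a" for a using add[of a "- a"] 0 by (simp add: add_eq_0_iff)
  have diff: "T (a - b) = T a - T b" for a b using add[of a "- b"] minus by simp
  have s: "T (sum f I) = (\<Sum>x\<in>I. T (f x))" for f :: "nat \<Rightarrow> _" and I
    by (induction I rule: infinite_finite_induct) (auto simp: 0 add)
  have mF: "map_poly T (B * F) = map_poly T B * F'" for B
    by (intro poly_eqI) (simp add: coeff_map_poly 0 coeff_mult s F)
  have sy: "map_poly T (smult y A) = smult y' (map_poly T A)" for A
    by (intro poly_eqI) (simp add: coeff_map_poly 0 y)
  have lin: "map_poly T ([:- x, 1:] * C) = [:- x', 1:] * map_poly T C" for C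
  proof (rule poly_eqI)
    fix i show "coeff (map_poly T ([:- x, 1:] * C)) i = coeff ([:- x', 1:] * map_poly T C) i"
      by (cases i) (simp_all add: coeff_map_poly 0 diff minus x)
  qed
  from Suc.prems obtain C D where CD: "smult y A + B * F = [:- x, 1:] * C"
    "A + smult y B = [:- x, 1:] * D" "vanishes F x y n C D" by auto
  have "smult y' (map_poly T A) + map_poly T B * F' = [:- x', 1:] * map_poly T C"
    using arg_cong[OF CD(1), of "map_poly T"] unfolding lin map_poly_additive[of T, OF add] mF sy .
  moreover have "map_poly T A + smult y' (map_poly T B) = [:- x', 1:] * map_poly T D"
    using arg_cong[OF CD(2), of "map_poly T"] unfolding lin map_poly_additive[of T, OF add] mF sy .
  ultimately show ?case using Suc.IH[OF CD(3)] by auto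
qed simp

section \<open>The function field in one chart\<close>

text \<open>
  Two functions \<open>U\<close>, \<open>V\<close> with \<open>V\<^sup>2 = F(U)\<close> that satisfy no further relation. Both charts of the smooth
  model are instances: \<open>(u, y)\<close> with \<open>F\<close>, and \<open>(1/u, y/u\<^sup>3)\<close> with the reversed polynomial.
\<close>

locale hyperelliptic =
  fixes F :: "'k::field poly" and U V :: "'k fun_ext"
  assumes V2: "V\<^sup>2 = poly_at F U"
    and indep: "poly_at A U + poly_at B U * V = 0 \<Longrightarrow> A = 0 \<and> B = 0"
begin

definition elt :: "'k poly \<Rightarrow> 'k poly \<Rightarrow> 'k fun_ext" where
  "elt A B = poly_at A U + poly_at B U * V"

lemma elt_eq_0_iff [simp]: "elt A B = 0 \<longleftrightarrow> A = 0 \<and> B = 0"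
  using indep[of A B] by (auto simp: elt_def)

lemma elt_add: "elt A B + elt C D = elt (A + C) (B + D)"
  by (simp add: elt_def algebra_simps)

lemma elt_minus: "- elt A B = elt (- A) (- B)"
  by (simp add: elt_def algebra_simps)

lemma elt_mult: "elt A B * elt C D = elt (A * C + B * D * F) (A * D + B * C)"
proof -
  have "elt A B * elt C D = poly_at A U * poly_at C U + (poly_at B U * poly_at D U) * V^2 + (poly_at A U * poly_at D U + poly_at B U * poly_at C U) * V"
    by (simp add: elt_def algebra_simps power2_eq_square)
  then show ?thesis by (simp add: V2 elt_def algebra_simps)
qed

lemma elt_inject: "elt A B = elt C D \<longleftrightarrow> A = C \<and> B = D"
  using elt_eq_0_iff[of "A - C" "B - D"] elt_add[of A B "- C" "- D"] elt_minus[of C D]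
  by (metis add_uminus_conv_diff eq_iff_diff_eq_0)

lemma elt_1 [simp]: "elt 1 0 = 1"
  by (simp add: elt_def)

definition ffield :: "'k fun_ext set" where
  "ffield = {elt A B / elt C D | A B C D. elt C D \<noteq> 0}"

lemma ffield_mult: "f \<in> ffield \<Longrightarrow> g \<in> ffield \<Longrightarrow> f * g \<in> ffield"
  unfolding ffield_def
  apply clarsimp
  subgoal for A A' B B' C C' D D'
    apply (rule exI[of _ "A * A' + B * B' * F"], rule exI[of _ "A * B' + B * A'"],
       rule exI[of _ "C * C' + D * D' * F"], rule exI[of _ "C * D' + D * C'"])
    by (metis elt_eq_0_iff elt_mult mult_eq_0_iff times_divide_times_eq)
  done

lemma ffield_inverse:
  assumes "f \<in> ffield"
  shows "inverse f \<in> ffield"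
proof -
  obtain A B C D where f: "f = elt A B / elt C D" "elt C D \<noteq> 0"
    using assms unfolding ffield_def by blast
  show ?thesis
  proof (cases "elt A B = 0")
    case True
    have "f = 0" using f(1) unfolding True by simp
    then show ?thesis using assms by simp
  next
    case False
    then show ?thesis using f(1) unfolding ffield_def by (metis (mono_tags, lifting) CollectI inverse_divide)
  qed
qed

lemma elt_ffield: "elt A B \<in> ffield"
  unfolding ffield_def using elt_1 by (smt (verit) CollectI div_by_1 zero_neq_one)

text \<open>
  Modulo \<open>V\<^sup>2 = F(U)\<close> a bivariate polynomial is linear in \<open>V\<close>, and this reduction does not change its values
  at points of the curve.
\<close>

lemma fun_eval2_elt:
  "\<exists>A B. fun_eval2 G (U, V) = elt A B \<and> (\<forall>x y. y\<^sup>2 = poly F x \<longrightarrow> eval2 G (x, y) = poly A x + poly B x * y)"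
proof (induction G)
  case 0
  show ?case by (rule exI[of _ 0], rule exI[of _ 0]) (simp add: fun_eval2_def eval2_def)
next
  case (pCons g G)
  then obtain A B where AB: "fun_eval2 G (U, V) = elt A B"
     "\<And>x y. y\<^sup>2 = poly F x \<Longrightarrow> eval2 G (x, y) = poly A x + poly B x * y" by blast
  have "fun_eval2 (pCons g G) (U, V) = poly_at g U + V * fun_eval2 G (U, V)"
    by (simp add: fun_eval2_def map_poly_pCons poly_at_def)
  also have "\<dots> = elt (g + B * F) A"
    using AB(1) elt_mult[of 0 1 A B] elt_add[of g 0 "B * F" A] by (simp add: elt_def)
  finally have 1: "fun_eval2 (pCons g G) (U, V) = elt (g + B * F) A" .
  have "eval2 (pCons g G) (x, y) = poly g x + y * eval2 G (x, y)" for x y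
    by (simp add: eval2_def)
  then have "\<forall>x y. y\<^sup>2 = poly F x \<longrightarrow> eval2 (pCons g G) (x, y) = poly (g + B * F) x + poly A x * y"
    using AB(2) by (simp add: algebra_simps power2_eq_square)
  then show ?case using 1 by blast
qed

lemma elt_fun_eval2:
  "fun_eval2 [:A, B:] (U, V) = elt A B" "eval2 [:A, B:] (x, y) = poly A x + poly B x * y"
  by (simp_all add: fun_eval2_def map_poly_pCons elt_def poly_at_def eval2_def algebra_simps)

lemma ffield_eq:
  "{fun_eval2 G (U, V) / fun_eval2 H (U, V) | G H. fun_eval2 H (U, V) \<noteq> 0} = ffield"
  (is "?L = _")
proof
  show "?L \<subseteq> ffield"
  proof safe
    fix G H assume H: "fun_eval2 H (U, V) \<noteq> 0"
    obtain A B C D where "fun_eval2 G (U, V) = elt A B" "fun_eval2 H (U, V) = elt C D"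
      using fun_eval2_elt by meson
    then show "fun_eval2 G (U, V) / fun_eval2 H (U, V) \<in> ffield" using H unfolding ffield_def by auto
  qed
  show "ffield \<subseteq> ?L"
  proof
    fix f assume "f \<in> ffield"
    then obtain A B C D where "f = fun_eval2 [:A, B:] (U, V) / fun_eval2 [:C, D:] (U, V)"
      "fun_eval2 [:C, D:] (U, V) \<noteq> 0" unfolding ffield_def elt_fun_eval2 by blast
    then show "f \<in> ?L" by blast
  qed
qed

end

section \<open>The local ring at a smooth point\<close>

locale hyperelliptic_point = hyperelliptic F U V for F :: "'k::field poly" and U V +
  fixes x y :: 'k
  assumes on_curve: "y\<^sup>2 = poly F x"
    and smooth: "y = 0 \<Longrightarrow> poly (pderiv F) x \<noteq> 0"
    and two: "(2::'k) \<noteq> 0"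
begin

definition residue :: "'k poly \<Rightarrow> 'k poly \<Rightarrow> 'k" where
  "residue A B = poly A x + poly B x * y"

lemma residue_mult: "residue (A * C + B * D * F) (A * D + B * C) = residue A B * residue C D"
  by (simp add: residue_def algebra_simps on_curve[symmetric] power2_eq_square)

lemma residue_0 [simp]: "residue 0 0 = 0" and residue_1 [simp]: "residue 1 0 = 1"
  by (simp_all add: residue_def)

lemma residue_nonzero: "residue C D \<noteq> 0 \<Longrightarrow> elt C D \<noteq> 0"
  by auto

definition loc_units :: "'k fun_ext set" where
  "loc_units = {elt A B / elt C D | A B C D. residue A B \<noteq> 0 \<and> residue C D \<noteq> 0}"
definition loc_ring :: "'k fun_ext set" where
  "loc_ring = {elt A B / elt C D | A B C D. residue C D \<noteq> 0}"
definition loc_max :: "'k fun_ext set" where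
  "loc_max = {elt A B / elt C D | A B C D. residue A B = 0 \<and> residue C D \<noteq> 0}"

lemma loc_units_I: "residue A B \<noteq> 0 \<Longrightarrow> residue C D \<noteq> 0 \<Longrightarrow> elt A B / elt C D \<in> loc_units"
  unfolding loc_units_def by blast

lemma loc_units_elt: "residue A B \<noteq> 0 \<Longrightarrow> elt A B \<in> loc_units"
  using loc_units_I[of A B 1 0] by simp

lemma loc_units_nonzero: "u \<in> loc_units \<Longrightarrow> u \<noteq> 0"
  using residue_nonzero by (auto simp: loc_units_def)

lemma loc_units_mult: "u \<in> loc_units \<Longrightarrow> v \<in> loc_units \<Longrightarrow> u * v \<in> loc_units"
  unfolding loc_units_def
  apply clarsimp
  subgoal for A A' B B' C C' D D'
    apply (rule exI[of _ "A * A' + B * B' * F"], rule exI[of _ "A * B' + B * A'"],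
       rule exI[of _ "C * C' + D * D' * F"], rule exI[of _ "C * D' + D * C'"])
    by (simp add: residue_mult flip: elt_mult)
  done

lemma loc_units_inverse: "u \<in> loc_units \<Longrightarrow> inverse u \<in> loc_units"
  unfolding loc_units_def
  apply clarsimp
  subgoal for A B C D by (rule exI[of _ C], rule exI[of _ D]) auto
  done

lemma loc_units_1 [simp]: "1 \<in> loc_units"
  using loc_units_elt[of 1 0] by simp

lemma loc_units_divide: "u \<in> loc_units \<Longrightarrow> v \<in> loc_units \<Longrightarrow> u / v \<in> loc_units"
  using loc_units_mult[of u "inverse v"] loc_units_inverse by (simp add: divide_inverse)

lemma loc_units_powi: "u \<in> loc_units \<Longrightarrow> u powi n \<in> loc_units"
proof -
  assume u: "u \<in> loc_units"
  have "v ^ n \<in> loc_units" if "v \<in> loc_units" for v n by (induction n) (auto intro: loc_units_mult that)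
  then show ?thesis using loc_units_inverse u by (auto simp: power_int_def)
qed

lemma loc_ring_eq_units_Un_max: "loc_ring = loc_units \<union> loc_max"
  unfolding loc_units_def loc_ring_def loc_max_def by blast

lemma loc_units_disjoint_loc_max: "loc_units \<inter> loc_max = {}"
proof -
  have "False" if "residue A B \<noteq> 0" "residue C D \<noteq> 0" "residue A' B' = 0" "residue C' D' \<noteq> 0"
     "elt A B / elt C D = elt A' B' / elt C' D'" for A B C D A' B' C' D'
  proof -
    have "elt A B * elt C' D' = elt A' B' * elt C D"
      using that residue_nonzero by (simp add: frac_eq_eq)
    then have "residue A B * residue C' D' = residue A' B' * residue C D"
      unfolding elt_mult elt_inject by (metis residue_mult)
    then show False using that by simp
  qed
  then show ?thesis unfolding loc_units_def loc_max_def by blast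
qed

lemma loc_max_ideal: "m \<in> loc_max \<Longrightarrow> r \<in> loc_ring \<Longrightarrow> m * r \<in> loc_max"
  unfolding loc_ring_def loc_max_def
  apply clarsimp
  subgoal for A A' B B' C C' D D'
    apply (rule exI[of _ "A * A' + B * B' * F"], rule exI[of _ "A * B' + B * A'"],
       rule exI[of _ "C * C' + D * D' * F"], rule exI[of _ "C * D' + D * C'"])
    by (simp add: residue_mult flip: elt_mult)
  done

definition tau :: "'k fun_ext" where
  "tau = elt [:- x, 1:] 0 / elt [:y:] 1"

lemma tau_nonzero: "tau \<noteq> 0"
  by (simp add: tau_def)

lemma elt_linear: "elt [:- x, 1:] 0 = tau * elt [:y:] 1"
  by (simp add: tau_def)

lemma residue_y_plus: "residue [:y:] 1 = 2 * y"
  by (simp add: residue_def)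

lemma vanish_step:
  assumes "residue A B = 0"
  obtains C D where "smult y A + B * F = [:- x, 1:] * C" "A + smult y B = [:- x, 1:] * D"
    "elt A B = tau * elt C D"
proof -
  have "poly (smult y A + B * F) x = y * residue A B"
    by (simp add: residue_def on_curve[symmetric] algebra_simps power2_eq_square)
  then have "[:- x, 1:] dvd smult y A + B * F"
    using assms by (simp only: flip: poly_eq_0_iff_dvd) simp
  then obtain C where C: "smult y A + B * F = [:- x, 1:] * C" by (rule dvdE)
  have "poly (A + smult y B) x = residue A B"
    by (simp add: residue_def algebra_simps)
  then have "[:- x, 1:] dvd A + smult y B"
    using assms by (simp only: flip: poly_eq_0_iff_dvd)
  then obtain D where D: "A + smult y B = [:- x, 1:] * D" by (rule dvdE)
  have "elt A B * elt [:y:] 1 = elt [:- x, 1:] 0 * elt C D"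
    unfolding elt_mult elt_inject using C D by (simp add: mult.commute)
  then have "elt A B = tau * elt C D"
    by (simp add: tau_def field_simps)
  then show ?thesis using that C D by blast
qed

lemma vanish_step':
  assumes "smult y A + B * F = [:- x, 1:] * C" "A + smult y B = [:- x, 1:] * D"
  shows "elt A B = tau * elt C D"
proof -
  have "elt A B * elt [:y:] 1 = elt [:- x, 1:] 0 * elt C D"
    unfolding elt_mult elt_inject using assms by (simp add: mult.commute)
  then show "elt A B = tau * elt C D"
    by (simp add: tau_def field_simps)
qed

lemma branch_point_factor: 
  assumes "y = 0" obtains F1 where "F = [:- x, 1:] * F1" "poly F1 x \<noteq> 0"
proof -
  obtain F1 where F1: "F = [:- x, 1:] * F1"
    using on_curve assms by (auto simp: poly_eq_0_iff_dvd elim: dvdE)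
  moreover have "poly (pderiv F) x = poly F1 x"
    unfolding F1 pderiv_mult by (simp add: pderiv_pCons)
  ultimately show ?thesis using that smooth[OF assms] by simp
qed

lemma tau_in_loc_max: "tau \<in> loc_max"
proof (cases "y = 0")
  case False
  then show ?thesis unfolding loc_max_def tau_def using two residue_y_plus by (fastforce simp: residue_def)
next
  case True
  then obtain F1 where F1: "F = [:- x, 1:] * F1" "poly F1 x \<noteq> 0" by (rule branch_point_factor)
  have "elt [:- x, 1:] 0 * elt F1 0 = elt 0 1 * elt [:y:] 1"
    unfolding elt_mult elt_inject using F1 True by simp
  then have "tau = elt 0 1 / elt F1 0"
    unfolding tau_def using F1(2) by (subst frac_eq_eq) auto
  moreover have "residue 0 1 = 0" "residue F1 0 \<noteq> 0" unfolding residue_def using F1(2) True by simp_all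
  ultimately show ?thesis unfolding loc_max_def by blast
qed

lemma tau_power_in_loc_max: "u \<in> loc_units \<Longrightarrow> tau ^ Suc n * u \<in> loc_max"
proof (induction n)
  case 0
  then show ?case using loc_max_ideal[OF tau_in_loc_max, of u] loc_ring_eq_units_Un_max by auto
next
  case (Suc n)
  then show ?case using loc_max_ideal[OF tau_in_loc_max, of "tau ^ Suc n * u"] loc_ring_eq_units_Un_max by (auto simp: mult.assoc)
qed

definition fnorm :: "'k poly \<Rightarrow> 'k poly \<Rightarrow> 'k poly" where
  "fnorm A B = A\<^sup>2 - B\<^sup>2 * F"

lemma fnorm_elt: "elt A B * elt A (- B) = elt (fnorm A B) 0"
  unfolding elt_mult by (simp add: fnorm_def power2_eq_square algebra_simps)

lemma fnorm_nonzero: "elt A B \<noteq> 0 \<Longrightarrow> fnorm A B \<noteq> 0"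
  using fnorm_elt[of A B] by (metis add.inverse_neutral elt_eq_0_iff minus_equation_iff mult_eq_0_iff)

lemma linear_power: "elt ([:- x, 1:] ^ n) 0 = tau ^ n * elt [:y:] 1 ^ n"
proof -
  have "elt ([:- x, 1:] ^ n) 0 = elt [:- x, 1:] 0 ^ n" by (simp add: elt_def)
  then show ?thesis unfolding elt_linear by (simp add: power_mult_distrib)
qed

text \<open>
  This is the existence half of the claim that the local ring is a discrete valuation ring. The
  induction is on the order at \<open>x\<close> of the norm \<open>A\<^sup>2 - B\<^sup>2F\<close>. At a branch point one division step lowers it
  by one. At an ordinary point a step need not lower it; there either \<open>A - BV\<close> is a unit, and then
  \<open>A + BV\<close> is the norm divided by this unit, or \<open>U - x\<close> divides both \<open>A\<close> and \<open>B\<close>.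
\<close>

lemma elt_eq_tau_power_unit:
  assumes "elt A B \<noteq> 0"
  shows "\<exists>n u. u \<in> loc_units \<and> elt A B = tau ^ n * u"
  using assms
proof (induction "Polynomial.order x (fnorm A B)" arbitrary: A B rule: less_induct)
  case less
  have n0: "fnorm A B \<noteq> 0" using fnorm_nonzero less.prems by blast
  show ?case
  proof (cases "residue A B = 0")
    case False
    then show ?thesis using loc_units_elt by (intro exI[of _ 0] exI[of _ "elt A B"]) auto
  next
    case v0: True
    show ?thesis
    proof (cases "y = 0")
      case True
      then obtain F1 where F1: "F = [:- x, 1:] * F1" "poly F1 x \<noteq> 0" by (rule branch_point_factor)
      obtain C D where CD: "smult y A + B * F = [:- x, 1:] * C" "A + smult y B = [:- x, 1:] * D"
        "elt A B = tau * elt C D" using vanish_step[OF v0] .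
      have A: "A = [:- x, 1:] * D" using CD(2) True by simp
      have "[:- x, 1:] * C = [:- x, 1:] * (B * F1)"
        using CD(1) True F1(1) by (metis add_0 mult.left_commute smult_0_left)
      then have C: "C = B * F1" by (subst (asm) mult_left_cancel) auto
      have alg: "(L * D)\<^sup>2 - B\<^sup>2 * (L * G) = L * (L * D\<^sup>2 - B\<^sup>2 * G)"
        "(B * G)\<^sup>2 - D\<^sup>2 * (L * G) = - (G * (L * D\<^sup>2 - B\<^sup>2 * G))" for L G :: "'k poly"
        by (simp_all add: algebra_simps power2_eq_square)
      have "fnorm A B = ([:- x, 1:] * D)\<^sup>2 - B\<^sup>2 * ([:- x, 1:] * F1)"
        by (simp only: fnorm_def A flip: F1(1))
      then have "fnorm A B = [:- x, 1:] * ([:- x, 1:] * D^2 - B^2 * F1)"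
        by (simp only: alg(1))
      moreover have "fnorm C D = (B * F1)\<^sup>2 - D\<^sup>2 * ([:- x, 1:] * F1)"
        by (simp only: fnorm_def C flip: F1(1))
      then have "fnorm C D = - (F1 * ([:- x, 1:] * D^2 - B^2 * F1))"
        by (simp only: alg(2))
      moreover have "Polynomial.order x F1 = 0" using F1(2) by (simp add: order_0I)
      moreover have "Polynomial.order x [:- x, 1:] = 1" using order_power_n_n[of x 1] by simp
      moreover have "[:- x, 1:] * D^2 - B^2 * F1 \<noteq> 0" using n0 calculation(1) by auto
      moreover have "F1 \<noteq> 0" using F1(2) by auto
      ultimately have "Polynomial.order x (fnorm C D) < Polynomial.order x (fnorm A B)"
        by (simp add: order_mult del: mult_pCons_left)
      moreover have "elt C D \<noteq> 0" using CD(3) less.prems by auto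
      ultimately obtain n u where "u \<in> loc_units" "elt C D = tau ^ n * u"
        using less.hyps by blast
      then show ?thesis using CD(3) by (intro exI[of _ "Suc n"] exI[of _ u]) auto
    next
      case y: False
      have uy: "elt [:y:] 1 \<in> loc_units" using loc_units_elt residue_y_plus y two by auto
      show ?thesis
      proof (cases "residue A (- B) = 0")
        case False
        define N where "N = fnorm A B"
        obtain N1 where N1: "N = [:- x, 1:] ^ Polynomial.order x N * N1" "\<not> [:- x, 1:] dvd N1"
          using order_decomp n0 N_def by blast
        define n where "n = Polynomial.order x N"
        have "residue N1 0 \<noteq> 0" using N1(2) by (simp add: residue_def poly_eq_0_iff_dvd)
        then have u1: "elt N1 0 \<in> loc_units" by (rule loc_units_elt)
        have u2: "elt A (- B) \<in> loc_units" using False by (rule loc_units_elt)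
        have "elt A B * elt A (- B) = elt ([:- x, 1:] ^ n) 0 * elt N1 0"
          unfolding fnorm_elt using N1(1) by (simp add: N_def n_def elt_mult)
        then have "elt A B = tau ^ n * (elt [:y:] 1 ^ n * elt N1 0 / elt A (- B))"
          using loc_units_nonzero[OF u2] unfolding linear_power by (simp add: field_simps)
        moreover have "elt [:y:] 1 ^ n * elt N1 0 / elt A (- B) \<in> loc_units"
          using loc_units_powi[OF uy, of "int n"] u1 u2 by (intro loc_units_divide loc_units_mult) auto
        ultimately show ?thesis by blast
      next
        case True
        have "poly A x + poly A x = 0" using v0 True by (simp add: residue_def)
        then have "2 * poly A x = 0" by simp
        then have "poly A x = 0" using two by (metis mult_eq_0_iff)
        moreover from this have "poly B x = 0" using v0 y by (simp add: residue_def)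
        ultimately obtain A1 B1 where AB: "A = [:- x, 1:] * A1" "B = [:- x, 1:] * B1"
          by (auto simp: poly_eq_0_iff_dvd elim!: dvdE)
        have "(L * A1)\<^sup>2 - (L * B1)\<^sup>2 * F = L\<^sup>2 * (A1\<^sup>2 - B1\<^sup>2 * F)" for L
          by (simp add: algebra_simps power2_eq_square)
        then have "fnorm A B = [:- x, 1:] ^ 2 * fnorm A1 B1"
          by (simp only: fnorm_def AB)
        then have "Polynomial.order x (fnorm A1 B1) < Polynomial.order x (fnorm A B)"
          using n0 by (simp add: order_mult order_power_n_n)
        moreover have e: "elt A B = elt [:- x, 1:] 0 * elt A1 B1"
          unfolding elt_mult AB by simp
        moreover from e have "elt A1 B1 \<noteq> 0" using less.prems by auto
        ultimately obtain n u where "u \<in> loc_units" "elt A1 B1 = tau ^ n * u"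
          using less.hyps by blast
        then show ?thesis using e elt_linear uy
          by (intro exI[of _ "Suc n"] exI[of _ "elt [:y:] 1 * u"]) (auto intro: loc_units_mult)
      qed
    qed
  qed
qed

lemma ffield_eq_tau_power_unit:
  assumes "f \<in> ffield" "f \<noteq> 0"
  shows "\<exists>n u. u \<in> loc_units \<and> f = tau powi n * u"
proof -
  obtain A B C D where f: "f = elt A B / elt C D" "elt C D \<noteq> 0"
    using assms unfolding ffield_def by blast
  then have "elt A B \<noteq> 0" using assms by auto
  then obtain n u m v where "u \<in> loc_units" "elt A B = tau ^ n * u" "v \<in> loc_units" "elt C D = tau ^ m * v"
    using elt_eq_tau_power_unit f(2) by metis
  then show ?thesis using f
    by (intro exI[of _ "int n - int m"] exI[of _ "u / v"])
       (auto simp: power_int_diff tau_nonzero loc_units_divide)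
qed

lemma tau_powi_cases:
  assumes "u \<in> loc_units"
  shows "n > 0 \<Longrightarrow> tau powi n * u \<in> loc_max" "n < 0 \<Longrightarrow> tau powi n * u \<notin> loc_ring"
    "n = 0 \<Longrightarrow> tau powi n * u \<in> loc_units"
proof -
  have pos: "tau powi n * u \<in> loc_max" if "n > 0" "u \<in> loc_units" for n u
    using tau_power_in_loc_max[OF that(2), of "nat n - 1"] that(1)
    by (simp add: power_int_def)
  then show "n > 0 \<Longrightarrow> tau powi n * u \<in> loc_max" using assms by blast
  show "n = 0 \<Longrightarrow> tau powi n * u \<in> loc_units" using assms by simp
  show "tau powi n * u \<notin> loc_ring" if n: "n < 0"
  proof
    assume "tau powi n * u \<in> loc_ring"
    then have "(tau powi (- n) * inverse u) * (tau powi n * u) \<in> loc_max"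
      using loc_max_ideal pos[of "- n" "inverse u"] loc_units_inverse assms n by auto
    moreover have "(tau powi (- n) * inverse u) * (tau powi n * u) = 1"
      using loc_units_nonzero[OF assms] tau_nonzero by (simp add: power_int_minus field_simps)
    ultimately have "1 \<in> loc_max" by metis
    then show False using loc_units_1 loc_units_disjoint_loc_max by blast
  qed
qed

lemma tau_powi_unique:
  assumes "u \<in> loc_units" "v \<in> loc_units" "tau powi n * u = tau powi m * v"
  shows "n = m"
proof -
  have "tau powi (n - m) * u = 1 * v"
    using assms(3) tau_nonzero by (simp add: power_int_diff field_simps)
  then have "tau powi (n - m) * u \<in> loc_units" using assms by simp
  then show ?thesis using tau_powi_cases[OF assms(1), of "n - m"] loc_units_disjoint_loc_max loc_ring_eq_units_Un_max
    by (cases "n - m" "0::int" rule: linorder_cases) auto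
qed

definition vord :: "'k fun_ext \<Rightarrow> int" where
  "vord f = (THE n. \<exists>u\<in>loc_units. f = tau powi n * u)"

lemma vord_eqI: "u \<in> loc_units \<Longrightarrow> f = tau powi n * u \<Longrightarrow> vord f = n"
  unfolding vord_def by (rule the_equality) (auto dest: tau_powi_unique)

lemma vord_ex:
  assumes "f \<in> ffield" "f \<noteq> 0"
  obtains n u where "u \<in> loc_units" "f = tau powi n * u" "vord f = n"
  using ffield_eq_tau_power_unit[OF assms] vord_eqI by blast

lemma vord_mult:
  assumes "f \<in> ffield" "g \<in> ffield" "f \<noteq> 0" "g \<noteq> 0"
  shows "vord (f * g) = vord f + vord g"
proof -
  obtain n u where 1: "u \<in> loc_units" "f = tau powi n * u" "vord f = n" using vord_ex assms(1,3) .
  obtain m v where 2: "v \<in> loc_units" "g = tau powi m * v" "vord g = m" using vord_ex assms(2,4) .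
  have "f * g = tau powi (n + m) * (u * v)"
    unfolding 1(2) 2(2) using tau_nonzero by (simp add: power_int_add)
  then show ?thesis using vord_eqI[OF loc_units_mult[OF 1(1) 2(1)]] 1(3) 2(3) by blast
qed

lemma vord_loc_units: "u \<in> loc_units \<Longrightarrow> vord u = 0"
  by (rule vord_eqI) auto

lemma vord_tau: "vord tau = 1"
  by (rule vord_eqI[of 1]) auto

lemma vord_elt_nonneg: "elt A B \<noteq> 0 \<Longrightarrow> vord (elt A B) \<ge> 0"
  using elt_eq_tau_power_unit vord_eqI by (metis of_nat_0_le_iff power_int_of_nat)

lemma vord_elt_pos_iff: "elt A B \<noteq> 0 \<Longrightarrow> vord (elt A B) \<ge> 1 \<longleftrightarrow> residue A B = 0"
proof -
  assume nz: "elt A B \<noteq> 0"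
  show ?thesis
  proof (cases "residue A B = 0")
    case True
    obtain C D where "elt A B = tau * elt C D" using vanish_step[OF True] by metis
    moreover from this have "elt C D \<noteq> 0" using nz by auto
    moreover have "tau \<in> ffield" unfolding tau_def ffield_def by (auto intro!: exI)
    ultimately show ?thesis using vord_mult[of tau "elt C D"] vord_tau vord_elt_nonneg[of C D] tau_nonzero
      elt_ffield True by auto
  next
    case False
    then show ?thesis using vord_loc_units[OF loc_units_elt] by simp
  qed
qed

lemma tau_ffield: "tau \<in> ffield"
  unfolding tau_def ffield_def by (auto intro!: exI)

lemma vanishes_iff: "elt A B \<noteq> 0 \<Longrightarrow> vanishes F x y n A B \<longleftrightarrow> vord (elt A B) \<ge> int n"
proof (induction n arbitrary: A B)
  case 0
  then show ?case using vord_elt_nonneg by simp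
next
  case (Suc n)
  have step: "elt C D \<noteq> 0 \<and> vord (elt A B) = 1 + vord (elt C D)" if "elt A B = tau * elt C D" for C D
  proof -
    have "elt C D \<noteq> 0" using that Suc.prems by auto
    then show ?thesis using vord_mult[OF tau_ffield elt_ffield tau_nonzero, of C D] that vord_tau by simp
  qed
  show ?case
  proof
    assume "vanishes F x y (Suc n) A B"
    then obtain C D where CD: "elt A B = tau * elt C D" "vanishes F x y n C D"
      using vanish_step' by (metis vanishes.simps(2))
    then show "vord (elt A B) \<ge> int (Suc n)" using step[OF CD(1)] Suc.IH by auto
  next
    assume o: "vord (elt A B) \<ge> int (Suc n)"
    then have "residue A B = 0" using vord_elt_pos_iff[OF Suc.prems] by simp
    then obtain C D where CD: "smult y A + B * F = [:- x, 1:] * C" "A + smult y B = [:- x, 1:] * D"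
        "elt A B = tau * elt C D" by (rule vanish_step)
    then have "vanishes F x y n C D" using step[OF CD(3)] Suc.IH o by auto
    then show "vanishes F x y (Suc n) A B" using CD by auto
  qed
qed

lemma loc_max_principal: "loc_max = {tau * g | g. g \<in> loc_ring}"
proof (intro equalityI subsetI)
  fix m assume m: "m \<in> loc_max"
  show "m \<in> {tau * g | g. g \<in> loc_ring}"
  proof (cases "m = 0")
    case True
    have "(0::'k fun_ext) \<in> loc_ring" unfolding loc_ring_def by (intro CollectI exI[of _ 0] exI[of _ 1]) auto
    then show ?thesis using True by (intro CollectI exI[of _ 0]) auto
  next
    case False
    obtain A B C D where f: "m = elt A B / elt C D" "residue A B = 0" "residue C D \<noteq> 0"
      using m unfolding loc_max_def by blast
    obtain A' B' where "elt A B = tau * elt A' B'" using vanish_step[OF f(2)] by metis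
    then have "m = tau * (elt A' B' / elt C D)" using f by simp
    moreover have "elt A' B' / elt C D \<in> loc_ring" using f unfolding loc_ring_def by blast
    ultimately show ?thesis by blast
  qed
next
  fix m assume "m \<in> {tau * g | g. g \<in> loc_ring}"
  then show "m \<in> loc_max" using loc_max_ideal tau_in_loc_max by auto
qed

lemma uniformizer_iff: "loc_max = {t * g | g. g \<in> loc_ring} \<longleftrightarrow> (\<exists>u\<in>loc_units. t = tau * u)"
proof
  assume M: "loc_max = {t * g | g. g \<in> loc_ring}"
  have 1: "1 \<in> loc_ring" using loc_units_1 loc_ring_eq_units_Un_max by auto
  have t: "t \<in> loc_max" using M 1 by force
  then obtain g where g: "t = tau * g" "g \<in> loc_ring" using loc_max_principal by auto
  obtain h where h: "tau = t * h" "h \<in> loc_ring" using tau_in_loc_max M by auto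
  have "g * h = 1" using g h tau_nonzero
    by (metis (no_types, opaque_lifting) mult.assoc mult_cancel_left1)
  then have "g \<notin> loc_max" using loc_max_ideal[of g h] h(2) loc_units_disjoint_loc_max loc_units_1 by (metis disjoint_iff)
  then show "\<exists>u\<in>loc_units. t = tau * u" using g loc_ring_eq_units_Un_max by auto
next
  assume "\<exists>u\<in>loc_units. t = tau * u"
  then obtain u where u: "u \<in> loc_units" "t = tau * u" by auto
  have Uo: "u * g \<in> loc_ring" if "u \<in> loc_units" "g \<in> loc_ring" for u g
    using that loc_units_mult loc_max_ideal loc_ring_eq_units_Un_max by (metis UnE UnI1 UnI2 mult.commute)
  have "{t * g | g. g \<in> loc_ring} = {tau * g | g. g \<in> loc_ring}"
  proof (intro equalityI subsetI; clarify)
    fix g assume "g \<in> loc_ring"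
    then show "\<exists>g'. t * g = tau * g' \<and> g' \<in> loc_ring" using u Uo by (auto simp: mult.assoc)
    then show "\<exists>g'. tau * g = t * g' \<and> g' \<in> loc_ring"
      using Uo[OF loc_units_inverse[OF u(1)] \<open>g \<in> loc_ring\<close>] u loc_units_nonzero[OF u(1)]
      by (intro exI[of _ "inverse u * g"]) auto
  qed
  then show "loc_max = {t * g | g. g \<in> loc_ring}" using loc_max_principal by simp
qed

text \<open>
  Any two uniformizers differ by a unit, so that the order computed with the particular uniformizer
  \<open>tau\<close> satisfies the uniformizer-free definition of the order.
\<close>

lemma vord_independent_of_uniformizer:
  assumes "f \<in> ffield" "f \<noteq> 0"
  shows "(THE n. \<exists>t g. loc_max = {t * g | g. g \<in> loc_ring} \<and> g \<in> loc_ring - loc_max \<and> f = t powi n * g) = vord f"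
proof -
  have Um: "loc_ring - loc_max = loc_units" using loc_ring_eq_units_Un_max loc_units_disjoint_loc_max by auto
  show ?thesis unfolding Um uniformizer_iff
  proof (rule the_equality)
    show "\<exists>t g. (\<exists>u\<in>loc_units. t = tau * u) \<and> g \<in> loc_units \<and> f = t powi vord f * g"
      using vord_ex[OF assms] loc_units_1 by (metis mult.right_neutral)
  next
    fix n assume "\<exists>t g. (\<exists>u\<in>loc_units. t = tau * u) \<and> g \<in> loc_units \<and> f = t powi n * g"
    then obtain u g where "u \<in> loc_units" "g \<in> loc_units" "f = (tau * u) powi n * g" by auto
    then show "n = vord f"
      by (intro vord_eqI[of "u powi n * g", symmetric]) (auto simp: loc_units_mult loc_units_powi power_int_mult_distrib)
  qed
qed

lemma vord_linear: "y \<noteq> 0 \<Longrightarrow> vord (elt [:- x, 1:] 0) = 1"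
  unfolding elt_linear using vord_mult[OF tau_ffield elt_ffield tau_nonzero, of "[:y:]" 1] vord_tau
    vord_loc_units[OF loc_units_elt, of "[:y:]" 1] residue_y_plus two by auto

lemma vord_other_linear: "c \<noteq> x \<Longrightarrow> vord (elt [:- c, 1:] 0) = 0"
  by (rule vord_loc_units[OF loc_units_elt]) (simp add: residue_def)

text \<open>
  At a branch point \<open>U - x\<close> has order 2, and two division steps already show that \<open>A\<close> and \<open>B\<close> vanish at \<open>x\<close>.
\<close>

lemma divisible_at_branch_point:
  assumes y0: "y = 0" and nz: "elt A B \<noteq> 0" and ge: "vord (elt A B) \<ge> vord (elt [:- x, 1:] 0)"
  shows "[:- x, 1:] dvd A" "[:- x, 1:] dvd B"
proof -
  obtain F1 where F1: "F = [:- x, 1:] * F1" "poly F1 x \<noteq> 0" using branch_point_factor[OF y0] .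
  have "vord (elt [:- x, 1:] 0) = 1 + vord (elt [:y:] 1)"
    unfolding elt_linear using vord_mult[OF tau_ffield elt_ffield tau_nonzero, of "[:y:]" 1] vord_tau by simp
  moreover have "vord (elt [:y:] 1) \<ge> 1"
    using vord_elt_pos_iff[of "[:y:]" 1] y0 residue_y_plus by simp
  ultimately have "vanishes F x y (Suc (Suc 0)) A B"
    using vanishes_iff[OF nz, of "Suc (Suc 0)"] ge by simp
  then obtain C D C' where CD: "B * F = [:- x, 1:] * C" "A = [:- x, 1:] * D" "D * F = [:- x, 1:] * C'"
     "C = [:- x, 1:] * C' \<or> (\<exists>D'. C = [:- x, 1:] * D')"
    unfolding vanishes.simps y0 smult_0_left add_0_left add_0_right by blast
  show "[:- x, 1:] dvd A" using CD(2) by (rule dvdI)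
  have "[:- x, 1:] * C = [:- x, 1:] * (B * F1)"
    using CD(1) F1(1) by (metis mult.left_commute)
  then have "C = B * F1" by (subst (asm) mult_left_cancel) auto
  moreover have "poly C x = 0" using CD(4) by auto
  ultimately show "[:- x, 1:] dvd B" using F1(2) by (simp flip: poly_eq_0_iff_dvd)
qed

lemma loc_ring_eval2:
  "{fun_eval2 G (U, V) / fun_eval2 H (U, V) | G H. eval2 H (x, y) \<noteq> 0} = loc_ring" (is "?L = _")
proof
  show "?L \<subseteq> loc_ring"
  proof safe
    fix G H assume H: "eval2 H (x, y) \<noteq> 0"
    obtain A B where 1: "fun_eval2 G (U, V) = elt A B" using fun_eval2_elt by blast
    obtain C D where "fun_eval2 H (U, V) = elt C D" "eval2 H (x, y) = residue C D"
      using fun_eval2_elt on_curve unfolding residue_def by blast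
    then show "fun_eval2 G (U, V) / fun_eval2 H (U, V) \<in> loc_ring" using H 1 unfolding loc_ring_def by auto
  qed
  show "loc_ring \<subseteq> ?L"
  proof
    fix f assume "f \<in> loc_ring"
    then obtain A B C D where "f = fun_eval2 [:A, B:] (U, V) / fun_eval2 [:C, D:] (U, V)"
      "eval2 [:C, D:] (x, y) \<noteq> 0" unfolding loc_ring_def elt_fun_eval2 residue_def by blast
    then show "f \<in> ?L" by blast
  qed
qed

lemma loc_max_eval2:
  "{fun_eval2 G (U, V) / fun_eval2 H (U, V) | G H. eval2 G (x, y) = 0 \<and> eval2 H (x, y) \<noteq> 0} = loc_max" (is "?L = _")
proof
  show "?L \<subseteq> loc_max"
  proof safe
    fix G H assume H: "eval2 H (x, y) \<noteq> 0" "eval2 G (x, y) = 0"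
    obtain A B where 1: "fun_eval2 G (U, V) = elt A B" "eval2 G (x, y) = residue A B"
      using fun_eval2_elt on_curve unfolding residue_def by blast
    obtain C D where "fun_eval2 H (U, V) = elt C D" "eval2 H (x, y) = residue C D"
      using fun_eval2_elt on_curve unfolding residue_def by blast
    then show "fun_eval2 G (U, V) / fun_eval2 H (U, V) \<in> loc_max" using H 1 unfolding loc_max_def by auto
  qed
  show "loc_max \<subseteq> ?L"
  proof
    fix f assume "f \<in> loc_max"
    then obtain A B C D where "f = fun_eval2 [:A, B:] (U, V) / fun_eval2 [:C, D:] (U, V)"
      "eval2 [:A, B:] (x, y) = 0" "eval2 [:C, D:] (x, y) \<noteq> 0"
      unfolding loc_max_def elt_fun_eval2 residue_def by blast
    then show "f \<in> ?L" by blast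
  qed
qed

end

section \<open>The smooth model as two charts\<close>

text \<open>
  This is \<open>X\<^sup>d A(1/X)\<close> if \<open>d\<close> is at least the degree of \<open>A\<close>. The bound \<open>d\<close> is a parameter, because \<open>A\<close> and \<open>B\<close> in \<open>A + By\<close> have to be
  reversed with respect to the degrees \<open>d\<close> and \<open>d - 3\<close>; this also makes reversal commute with all
  coefficientwise maps.
\<close>

definition reversal :: "nat \<Rightarrow> 'k::field poly \<Rightarrow> 'k poly" where
  "reversal d A = (\<Sum>i\<le>d. monom (coeff A i) (d - i))"

lemma coeff_reversal: "coeff (reversal d A) i = (if i \<le> d then coeff A (d - i) else 0)"
proof -
  have "coeff (reversal d A) i = (\<Sum>j\<le>d. if d - i = j \<and> i \<le> d then coeff A j else 0)"
    unfolding reversal_def coeff_sum by (intro sum.cong) (auto simp: coeff_monom)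
  then show ?thesis by (cases "i \<le> d") simp_all
qed

lemma poly_reversal_0: "poly (reversal d A) 0 = coeff A d"
  by (simp add: poly_0_coeff_0 coeff_reversal)

lemma reversal_eq_0_iff: "degree A \<le> d \<Longrightarrow> reversal d A = 0 \<longleftrightarrow> A = 0"
proof
  assume d: "degree A \<le> d" and r: "reversal d A = 0"
  have "coeff A i = 0" for i
  proof (cases "i \<le> d")
    case True
    have "coeff (reversal d A) (d - i) = 0" using r by simp
    then show ?thesis using True by (simp add: coeff_reversal)
  next
    case False then show ?thesis using d by (intro coeff_eq_0) simp
  qed
  then show "A = 0" by (intro poly_eqI) simp
qed (simp add: reversal_def)

lemma map_poly_reversal: "h 0 = 0 \<Longrightarrow> map_poly h (reversal d A) = reversal d (map_poly h A)"
  by (rule poly_eqI) (simp add: coeff_map_poly coeff_reversal)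

lemma poly_at_sum: "poly_at (\<Sum>i\<in>I. f i) U = (\<Sum>i\<in>I. poly_at (f i) U)"
  by (induction I rule: infinite_finite_induct) simp_all

lemma poly_at_monom: "poly_at (monom c n) U = fun_const c * U ^ n"
  by (simp add: poly_at_def map_poly_monom poly_monom)

lemma poly_at_altdef:
  assumes "degree A \<le> d"
  shows "poly_at A U = (\<Sum>i\<le>d. fun_const (coeff A i) * U ^ i)"
proof -
  have "A = (\<Sum>i\<le>d. monom (coeff A i) i)" using assms by (metis poly_as_sum_of_monoms')
  then have "poly_at A U = poly_at (\<Sum>i\<le>d. monom (coeff A i) i) U" by simp
  then show ?thesis by (simp add: poly_at_sum poly_at_monom)
qed

lemma poly_at_reversal:
  assumes "degree A \<le> d" "U \<noteq> 0"
  shows "poly_at (reversal d A) U = U ^ d * poly_at A (1 / U)"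
proof -
  have "poly_at (reversal d A) U = (\<Sum>i\<le>d. fun_const (coeff A i) * U ^ (d - i))"
    by (simp add: reversal_def poly_at_sum poly_at_monom)
  also have "\<dots> = (\<Sum>i\<le>d. U ^ d * (fun_const (coeff A i) * (1 / U) ^ i))"
    using assms(2) by (intro sum.cong) (auto simp: power_diff power_one_over field_simps)
  also have "\<dots> = U ^ d * poly_at A (1 / U)"
    by (simp add: poly_at_altdef[OF assms(1)] sum_distrib_left)
  finally show ?thesis .
qed

lemma poly_at_reversal_inverse:
  assumes "degree A \<le> d" "U \<noteq> 0"
  shows "U ^ d * poly_at (reversal d A) (1 / U) = poly_at A U"
  using poly_at_reversal[OF assms(1), of "1 / U"] assms(2) by (simp add: power_one_over)

lemma poly_at_fun_u: "poly_at A fun_u = to_ac (Fract A 1)"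
proof (induction A)
  case 0
  show ?case by (simp flip: Zero_fract_def)
next
  case (pCons a A)
  have "Fract (pCons a A) 1 = Fract [:a:] 1 + Fract [:0, 1:] 1 * Fract A 1" by simp
  then show ?case
    by (simp only: poly_at_pCons pCons.IH fun_const_def to_ac_add to_ac_mult) (simp only: fun_u_def)
qed

lemma fun_u_nonzero [simp]: "fun_u \<noteq> 0"
proof -
  have "fun_u = poly_at [:0, 1:] (fun_u :: 'a fun_ext)" by (simp add: poly_at_pCons)
  also have "\<dots> \<noteq> 0" unfolding poly_at_fun_u by (simp add: Zero_fract_def eq_fract)
  finally show ?thesis .
qed

lemma fun_y_squared: "(fun_y F)\<^sup>2 = poly_at F fun_u"
proof -
  obtain y where "y ^ 2 = (to_ac (Fract F 1) :: 'a fun_ext)"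
    using nth_root_exists[of 2] by auto
  then show ?thesis unfolding fun_y_def poly_at_fun_u by (rule someI)
qed

lemma order_simple_root:
  fixes F :: "'k::field poly"
  assumes "poly F r = 0" "poly (pderiv F) r \<noteq> 0"
  shows "Polynomial.order r F = 1"
proof -
  obtain F1 where F1: "F = [:- r, 1:] * F1" using assms(1) by (auto simp only: poly_eq_0_iff_dvd elim: dvdE)
  have "poly (pderiv F) r = poly F1 r" unfolding F1 pderiv_mult by (simp add: pderiv_pCons)
  then have "poly F1 r \<noteq> 0" using assms by simp
  moreover have "F \<noteq> 0" using assms(2) by auto
  moreover have "Polynomial.order r [:- r, 1:] = 1" using order_power_n_n[of r 1] by simp
  ultimately show ?thesis unfolding F1 by (subst order_mult) (auto simp: order_0I)
qed

text \<open>
  At a simple root of \<open>F\<close> the left-hand side has even order and the right-hand side odd order.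
\<close>

lemma square_eq_simple_root:
  fixes A B F :: "'k::field poly"
  assumes "poly F r = 0" "poly (pderiv F) r \<noteq> 0" "A\<^sup>2 = B\<^sup>2 * F"
  shows "A = 0 \<and> B = 0"
proof (cases "B = 0")
  case False
  have "F \<noteq> 0" using assms(2) by auto
  then have "A \<noteq> 0" using assms(3) False by auto
  have "2 * Polynomial.order r A = Polynomial.order r (A\<^sup>2)"
    using \<open>A \<noteq> 0\<close> by (simp add: power2_eq_square order_mult)
  also have "\<dots> = 2 * Polynomial.order r B + 1"
    unfolding assms(3) using False \<open>F \<noteq> 0\<close> order_simple_root[OF assms(1,2)]
    by (simp add: power2_eq_square order_mult)
  finally show ?thesis by presburger
qed (use assms in auto)

locale hyp_curve =
  fixes F :: "'k::{alg_closed_field,field_char_0} poly"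
  assumes deg6: "degree F = 6"
    and separable: "\<And>r. poly F r = 0 \<Longrightarrow> poly (pderiv F) r \<noteq> 0"
begin

lemma indep_affine:
  assumes "poly_at A fun_u + poly_at B fun_u * fun_y F = 0"
  shows "A = 0 \<and> B = 0"
proof -
  have "poly_at A fun_u = - (poly_at B fun_u * fun_y F)" using assms by (simp add: add_eq_0_iff2)
  then have "(poly_at A fun_u)\<^sup>2 = (poly_at B fun_u)\<^sup>2 * (fun_y F)\<^sup>2" by (simp add: power_mult_distrib)
  then have "poly_at (A\<^sup>2) fun_u = poly_at (B\<^sup>2 * F) fun_u" by (simp add: fun_y_squared)
  then have e: "A\<^sup>2 = B\<^sup>2 * F" by (simp add: poly_at_fun_u eq_fract)
  obtain r where "poly F r = 0" using alg_closed_imp_poly_has_root[of F] deg6 by auto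
  then show ?thesis using square_eq_simple_root separable e by blast
qed

sublocale aff: hyperelliptic F fun_u "fun_y F"
  by unfold_locales (fact fun_y_squared, fact indep_affine)

lemma elt_reversal:
  assumes "degree A \<le> d" "degree B + 3 \<le> d"
  shows "aff.elt A B = fun_u ^ d * (poly_at (reversal d A) (1 / fun_u) + poly_at (reversal (d - 3) B) (1 / fun_u) * (fun_y F / fun_u ^ 3))"
proof -
  have "fun_u ^ d = fun_u ^ (d - 3) * (fun_u :: 'k fun_ext) ^ 3"
    using assms by (simp flip: power_add)
  then have "fun_u ^ d * (poly_at (reversal (d - 3) B) (1 / fun_u) * (fun_y F / fun_u ^ 3)) =
      fun_u ^ (d - 3) * poly_at (reversal (d - 3) B) (1 / fun_u) * fun_y F"
    by simp
  also have "\<dots> = poly_at B fun_u * fun_y F"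
    using assms by (subst poly_at_reversal_inverse) auto
  finally show ?thesis
    using poly_at_reversal_inverse[OF assms(1) fun_u_nonzero] by (simp only: aff.elt_def distrib_left)
qed

lemma infinity_chart_equation: "(fun_y F / fun_u ^ 3)\<^sup>2 = poly_at (reversal 6 F) (1 / fun_u)"
proof -
  have "fun_u ^ 6 * poly_at (reversal 6 F) (1 / fun_u) = poly_at F fun_u"
    using deg6 by (intro poly_at_reversal_inverse) auto
  then show ?thesis by (simp add: power_divide fun_y_squared nonzero_divide_eq_eq mult.commute flip: power_mult)
qed

lemma reversal_reversal: "degree A \<le> d \<Longrightarrow> reversal d (reversal d A) = A"
  by (rule poly_eqI) (auto simp: coeff_reversal intro!: coeff_eq_0)

lemma degree_reversal: "degree (reversal d A) \<le> d"
  by (intro degree_le) (simp add: coeff_reversal)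

lemma indep_infinity:
  assumes "poly_at A (1 / fun_u) + poly_at B (1 / fun_u) * (fun_y F / fun_u ^ 3) = 0"
  shows "A = 0 \<and> B = 0"
proof -
  define e where "e = max (degree A) (degree B)"
  have d: "degree A \<le> e + 3" "degree B \<le> e" by (auto simp: e_def)
  have "degree (reversal (e + 3) A) \<le> e + 3" "degree (reversal e B) + 3 \<le> e + 3"
    using degree_reversal by (auto simp: )
  then have "aff.elt (reversal (e + 3) A) (reversal e B) = 0"
    by (subst elt_reversal[where d = "e + 3"]) (use assms d in \<open>auto simp: reversal_reversal\<close>)
  then show ?thesis using d by (simp add: reversal_eq_0_iff)
qed

sublocale inf: hyperelliptic "reversal 6 F" "1 / fun_u" "fun_y F / fun_u ^ 3"
  by unfold_locales (fact infinity_chart_equation, fact indep_infinity)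

lemma elt_inf:
  assumes "degree A \<le> d" "degree B + 3 \<le> d"
  shows "aff.elt A B = fun_u ^ d * inf.elt (reversal d A) (reversal (d - 3) B)"
  unfolding elt_reversal[OF assms] inf.elt_def ..

lemma affine_point: "Affine x y \<in> curve_points F \<Longrightarrow> hyperelliptic_point F fun_u (fun_y F) x y"
  using separable by unfold_locales (auto simp: curve_points_def)

lemma inf_point:
  "AtInf w \<in> curve_points F \<Longrightarrow> hyperelliptic_point (reversal 6 F) (1 / fun_u) (fun_y F / fun_u ^ 3) 0 w"
  and inf_w_nonzero: "AtInf w \<in> curve_points F \<Longrightarrow> w \<noteq> 0"
proof -
  assume "AtInf w \<in> curve_points F"
  then have w: "w\<^sup>2 = coeff F 6" by (auto simp: curve_points_def)
  moreover have "coeff F 6 \<noteq> 0" using deg6 by (metis degree_0 leading_coeff_0_iff zero_neq_numeral)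
  ultimately show "w \<noteq> 0" by auto
  then show "hyperelliptic_point (reversal 6 F) (1 / fun_u) (fun_y F / fun_u ^ 3) 0 w"
    using w by unfold_locales (auto simp: poly_reversal_0)
qed

lemma function_field_eq: "function_field F = aff.ffield"
  unfolding function_field_def aff.ffield_eq ..

lemma ffield_subset_inf: "aff.ffield \<subseteq> inf.ffield"
proof
  fix f assume "f \<in> aff.ffield"
  then obtain A B C D where f: "f = aff.elt A B / aff.elt C D" "aff.elt C D \<noteq> 0"
    unfolding aff.ffield_def by blast
  define d where "d = Max {degree A, degree B + 3, degree C, degree D + 3}"
  have "degree A \<le> d" "degree B + 3 \<le> d" "degree C \<le> d" "degree D + 3 \<le> d"
    by (auto simp: d_def)
  then have AB: "aff.elt A B = fun_u ^ d * inf.elt (reversal d A) (reversal (d - 3) B)"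
    and CD: "aff.elt C D = fun_u ^ d * inf.elt (reversal d C) (reversal (d - 3) D)"
    by (simp_all only: elt_inf)
  then have "inf.elt (reversal d C) (reversal (d - 3) D) \<noteq> 0"
    using f(2) by (metis mult_zero_right)
  moreover have "f = inf.elt (reversal d A) (reversal (d - 3) B) / inf.elt (reversal d C) (reversal (d - 3) D)"
    unfolding f(1) AB CD by simp
  ultimately show "f \<in> inf.ffield" unfolding inf.ffield_def by blast
qed

lemma ord_affine:
  assumes P: "Affine x y \<in> curve_points F" and f: "f \<in> aff.ffield" "f \<noteq> 0"
  shows "ord_at F (Affine x y) f = hyperelliptic_point.vord fun_u (fun_y F) x y f"
proof -
  interpret p: hyperelliptic_point F fun_u "fun_y F" x y using P by (rule affine_point)
  show ?thesis using p.vord_independent_of_uniformizer[OF f]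
    by (simp add: ord_at_def uniformizer_def local_ring_def local_max_ideal_def p.loc_ring_eval2 p.loc_max_eval2)
qed

lemma ord_inf:
  assumes P: "AtInf w \<in> curve_points F" and f: "f \<in> aff.ffield" "f \<noteq> 0"
  shows "ord_at F (AtInf w) f =
    hyperelliptic_point.vord (1 / fun_u) (fun_y F / fun_u ^ 3) 0 w f"
proof -
  interpret p: hyperelliptic_point "reversal 6 F" "1 / fun_u" "fun_y F / fun_u ^ 3" 0 w
    using P by (rule inf_point)
  show ?thesis using p.vord_independent_of_uniformizer[of f] f ffield_subset_inf
    by (auto simp add: ord_at_def uniformizer_def local_ring_def local_max_ideal_def p.loc_ring_eval2 p.loc_max_eval2)
qed

lemma ord_mult:
  assumes P: "P \<in> curve_points F" and f: "f \<in> aff.ffield" "g \<in> aff.ffield" "f \<noteq> 0" "g \<noteq> 0"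
  shows "ord_at F P (f * g) = ord_at F P f + ord_at F P g"
proof -
  show ?thesis
  proof (cases P)
    case (Affine x y)
    interpret p: hyperelliptic_point F fun_u "fun_y F" x y using P Affine by (auto intro: affine_point)
    show ?thesis using p.vord_mult[OF f] ord_affine P f aff.ffield_mult[OF f(1,2)] by (simp add: Affine)
  next
    case (AtInf w)
    interpret p: hyperelliptic_point "reversal 6 F" "1 / fun_u" "fun_y F / fun_u ^ 3" 0 w
      using P AtInf by (auto intro: inf_point)
    show ?thesis using p.vord_mult[of f g] ord_inf P f ffield_subset_inf aff.ffield_mult[OF f(1,2)]
      by (auto simp: AtInf subset_iff)
  qed
qed

lemma ord_inverse:
  assumes P: "P \<in> curve_points F" and f: "f \<in> aff.ffield" "f \<noteq> 0"
  shows "ord_at F P (inverse f) = - ord_at F P f"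
proof -
  have 1: "1 \<in> aff.ffield" using aff.elt_ffield[of 1 0] by simp
  have "ord_at F P 1 = 0" using ord_mult[OF P 1 1] by simp
  then show ?thesis using ord_mult[OF P f(1) aff.ffield_inverse[OF f(1)]] f by simp
qed

lemma ord_affine_elt:
  assumes "Affine x y \<in> curve_points F" "aff.elt A B \<noteq> 0"
  shows "vanishes F x y n A B \<longleftrightarrow> ord_at F (Affine x y) (aff.elt A B) \<ge> int n"
proof -
  interpret p: hyperelliptic_point F fun_u "fun_y F" x y using assms(1) by (rule affine_point)
  show ?thesis using p.vanishes_iff[OF assms(2)] ord_affine[OF assms(1) aff.elt_ffield assms(2)] by simp
qed

lemma ord_inf_elt:
  assumes P: "AtInf w \<in> curve_points F" and nz: "aff.elt A B \<noteq> 0"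
    and d: "degree A \<le> d" "degree B + 3 \<le> d"
  shows "vanishes (reversal 6 F) 0 w n (reversal d A) (reversal (d - 3) B) \<longleftrightarrow>
    ord_at F (AtInf w) (aff.elt A B) \<ge> int n - int d"
proof -
  interpret p: hyperelliptic_point "reversal 6 F" "1 / fun_u" "fun_y F / fun_u ^ 3" 0 w
    using P by (rule inf_point)
  define f where "f = inf.elt (reversal d A) (reversal (d - 3) B)"
  have f: "f \<noteq> 0" using nz elt_inf[OF d] by (auto simp: f_def simp del: inf.elt_eq_0_iff)
  have u: "1 / fun_u = inf.elt [:- 0, 1:] 0" by (simp add: inf.elt_def poly_at_pCons)
  then have uf: "1 / fun_u \<in> inf.ffield" using inf.elt_ffield by metis
  have "p.vord ((1 / fun_u) ^ m) = int m \<and> (1 / fun_u) ^ m \<in> inf.ffield" for m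
  proof (induction m)
    case 0
    then show ?case using p.vord_loc_units[OF p.loc_units_1] inf.elt_ffield[of 1 0] by simp
  next
    case (Suc m)
    have "p.vord (1 / fun_u * (1 / fun_u) ^ m) = p.vord (1 / fun_u) + p.vord ((1 / fun_u) ^ m)"
      using Suc uf by (intro p.vord_mult) simp_all
    moreover have "p.vord (1 / fun_u) = 1" using p.vord_linear[OF inf_w_nonzero[OF P]] by (simp only: u[symmetric])
    moreover have "1 / fun_u * (1 / fun_u) ^ m \<in> inf.ffield"
      using Suc uf by (intro inf.ffield_mult) simp_all
    ultimately show ?case using Suc by simp
  qed
  then have m: "p.vord ((1 / fun_u) ^ d) = int d" "(1 / fun_u) ^ d \<in> inf.ffield" by auto
  have ff: "aff.elt A B \<in> inf.ffield" using aff.elt_ffield ffield_subset_inf by blast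
  have "f = (1 / fun_u) ^ d * aff.elt A B"
    unfolding elt_inf[OF d] f_def by (simp add: power_one_over)
  then have "p.vord f = int d + p.vord (aff.elt A B)"
    using p.vord_mult[OF m(2) ff _ nz] m(1) by simp
  moreover have "vanishes (reversal 6 F) 0 w n (reversal d A) (reversal (d - 3) B) \<longleftrightarrow> p.vord f \<ge> int n"
    using p.vanishes_iff f unfolding f_def by blast
  ultimately show ?thesis using ord_inf[OF P aff.elt_ffield nz] by auto
qed

lemma ord_affine_nonneg:
  "Affine x y \<in> curve_points F \<Longrightarrow> aff.elt A B \<noteq> 0 \<Longrightarrow> ord_at F (Affine x y) (aff.elt A B) \<ge> 0"
  using ord_affine_elt[of x y A B 0] by simp

lemma ord_linear:
  assumes "Affine x y \<in> curve_points F"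
  shows "y \<noteq> 0 \<Longrightarrow> ord_at F (Affine x y) (aff.elt [:- x, 1:] 0) = 1"
    and "c \<noteq> x \<Longrightarrow> ord_at F (Affine x y) (aff.elt [:- c, 1:] 0) = 0"
proof -
  interpret p: hyperelliptic_point F fun_u "fun_y F" x y using assms(1) by (rule affine_point)
  have "aff.elt [:- c, 1:] 0 \<noteq> 0" for c by simp
  then have e: "ord_at F (Affine x y) (aff.elt [:- c, 1:] 0) = p.vord (aff.elt [:- c, 1:] 0)" for c
    by (rule ord_affine[OF assms(1) aff.elt_ffield])
  show "y \<noteq> 0 \<Longrightarrow> ord_at F (Affine x y) (aff.elt [:- x, 1:] 0) = 1"
    unfolding e by (rule p.vord_linear)
  show "c \<noteq> x \<Longrightarrow> ord_at F (Affine x y) (aff.elt [:- c, 1:] 0) = 0"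
    unfolding e by (rule p.vord_other_linear)
qed

text \<open>
  At an ordinary point \<open>(x, y)\<close> the assumption at both \<open>(x, y)\<close> and \<open>(x, -y)\<close> gives \<open>A(x) \<plusminus> B(x)y = 0\<close>.
\<close>

lemma divisible_by_linear:
  assumes nz: "aff.elt A B \<noteq> 0"
    and ge: "\<And>y. Affine x y \<in> curve_points F \<Longrightarrow>
      ord_at F (Affine x y) (aff.elt A B) \<ge> ord_at F (Affine x y) (aff.elt [:- x, 1:] 0)"
  shows "[:- x, 1:] dvd A \<and> [:- x, 1:] dvd B"
proof -
  obtain y where y: "y ^ 2 = poly F x" using nth_root_exists[of 2 "poly F x"] by auto
  then have P: "Affine x y \<in> curve_points F" and P': "Affine x (- y) \<in> curve_points F"
    by (auto simp: curve_points_def)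
  have L: "aff.elt [:- x, 1:] 0 \<noteq> 0" by simp
  show ?thesis
  proof (cases "y = 0")
    case True
    interpret p: hyperelliptic_point F fun_u "fun_y F" x y using P by (rule affine_point)
    have "p.vord (aff.elt A B) \<ge> p.vord (aff.elt [:- x, 1:] 0)"
      using ge[OF P] unfolding ord_affine[OF P aff.elt_ffield nz] ord_affine[OF P aff.elt_ffield L] .
    then show ?thesis using p.divisible_at_branch_point[OF True nz] by blast
  next
    case False
    have z: "poly A x + poly B x * z = 0" if "Affine x z \<in> curve_points F" "z \<noteq> 0" for z
    proof -
      interpret p: hyperelliptic_point F fun_u "fun_y F" x z using that(1) by (rule affine_point)
      have "p.vord (aff.elt A B) \<ge> 1"
        using ge[OF that(1)] ord_linear(1)[OF that] ord_affine[OF that(1) aff.elt_ffield nz] by simp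
      then show ?thesis using p.vord_elt_pos_iff[OF nz] by (simp add: p.residue_def)
    qed
    have "2 * poly A x = 0" "2 * (poly B x * y) = 0" using z[OF P] z[OF P'] False
      by (auto simp: algebra_simps)
    then have "poly A x = 0" "poly B x = 0" using False by auto
    then show ?thesis by (simp add: poly_eq_0_iff_dvd)
  qed
qed

text \<open>
  The roots of the denominator are cancelled one by one. This is the integral closedness of \<open>k[u, y]\<close>.
\<close>

lemma regular_quotient:
  assumes "C \<noteq> 0" "aff.elt A B \<noteq> 0"
    and "\<And>x y. Affine x y \<in> curve_points F \<Longrightarrow>
      ord_at F (Affine x y) (aff.elt A B) \<ge> ord_at F (Affine x y) (aff.elt C 0)"
  shows "\<exists>A' B'. aff.elt A B = aff.elt C 0 * aff.elt A' B'"
  using assms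
proof (induction "degree C" arbitrary: A B C rule: less_induct)
  case less
  show ?case
  proof (cases "degree C = 0")
    case True
    then obtain c where c: "C = [:c:]" "c \<noteq> 0" using less.prems(1) by (metis degree_eq_zeroE pCons_0_0)
    have "aff.elt A B = aff.elt C 0 * aff.elt (smult (1 / c) A) (smult (1 / c) B)"
      unfolding aff.elt_mult c(1) using c(2) by simp
    then show ?thesis by blast
  next
    case False
    then obtain r where "poly C r = 0" using alg_closed_imp_poly_has_root[of C] by auto
    then obtain C1 where C1: "C = [:- r, 1:] * C1" by (auto simp only: poly_eq_0_iff_dvd elim: dvdE)
    then have C10: "C1 \<noteq> 0" using less.prems(1) by auto
    have nz: "aff.elt [:- r, 1:] 0 \<noteq> 0" "aff.elt C1 0 \<noteq> 0" using C10 by auto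
    have CL: "aff.elt C 0 = aff.elt [:- r, 1:] 0 * aff.elt C1 0" unfolding aff.elt_mult C1 by simp
    have oC: "ord_at F P (aff.elt C 0) = ord_at F P (aff.elt [:- r, 1:] 0) + ord_at F P (aff.elt C1 0)"
      if "P \<in> curve_points F" for P
      unfolding CL using ord_mult[OF that aff.elt_ffield aff.elt_ffield nz] .
    have "[:- r, 1:] dvd A \<and> [:- r, 1:] dvd B"
    proof (rule divisible_by_linear[OF less.prems(2)])
      fix y assume P: "Affine r y \<in> curve_points F"
      show "ord_at F (Affine r y) (aff.elt A B) \<ge> ord_at F (Affine r y) (aff.elt [:- r, 1:] 0)"
        using less.prems(3)[OF P] oC[OF P] ord_affine_nonneg[OF P nz(2)] by simp
    qed
    then obtain A1 B1 where AB: "A = [:- r, 1:] * A1" "B = [:- r, 1:] * B1" by (auto elim!: dvdE)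
    have e: "aff.elt A B = aff.elt [:- r, 1:] 0 * aff.elt A1 B1"
      unfolding aff.elt_mult AB by simp
    then have nz1: "aff.elt A1 B1 \<noteq> 0" using less.prems(2) by auto
    have "degree C1 < degree C" unfolding C1 using C10 by (subst degree_mult_eq) auto
    moreover have "ord_at F (Affine x y) (aff.elt A1 B1) \<ge> ord_at F (Affine x y) (aff.elt C1 0)"
      if "Affine x y \<in> curve_points F" for x y
      using less.prems(3)[OF that] oC[OF that] ord_mult[OF that aff.elt_ffield aff.elt_ffield nz(1) nz1]
      unfolding e by simp
    ultimately obtain A' B' where "aff.elt A1 B1 = aff.elt C1 0 * aff.elt A' B'"
      using less.hyps[OF _ C10 nz1] by blast
    then show ?thesis unfolding e CL by (auto simp: mult.assoc)
  qed
qed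

lemma ffield_polynomial_denominator:
  assumes "f \<in> aff.ffield"
  obtains A B C where "C \<noteq> 0" "f = aff.elt A B / aff.elt C 0"
proof -
  obtain A B C D where f: "f = aff.elt A B / aff.elt C D" "aff.elt C D \<noteq> 0"
    using assms unfolding aff.ffield_def by blast
  have c: "aff.elt C (- D) \<noteq> 0" using f(2) by auto
  have "aff.elt C D * aff.elt C (- D) = aff.elt (C\<^sup>2 - D\<^sup>2 * F) 0"
    unfolding aff.elt_mult by (simp add: power2_eq_square algebra_simps)
  moreover obtain A' B' where "aff.elt A B * aff.elt C (- D) = aff.elt A' B'"
    unfolding aff.elt_mult by blast
  ultimately have "f = aff.elt A' B' / aff.elt (C\<^sup>2 - D\<^sup>2 * F) 0" "C\<^sup>2 - D\<^sup>2 * F \<noteq> 0"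
    using f c by (metis mult_divide_mult_cancel_right, metis aff.elt_eq_0_iff mult_eq_0_iff)
  then show ?thesis using that by blast
qed

lemma regular_imp_polynomial:
  assumes "f \<in> aff.ffield" "f \<noteq> 0"
    and "\<And>x y. Affine x y \<in> curve_points F \<Longrightarrow> ord_at F (Affine x y) f \<ge> 0"
  obtains A B where "f = aff.elt A B"
proof -
  obtain A B C where f: "C \<noteq> 0" "f = aff.elt A B / aff.elt C 0"
    using ffield_polynomial_denominator[OF assms(1)] .
  then have nz: "aff.elt A B \<noteq> 0" "aff.elt C 0 \<noteq> 0" using assms(2) by auto
  have AB: "aff.elt A B = f * aff.elt C 0" unfolding f(2) using nz(2) by simp
  have "ord_at F (Affine x y) (aff.elt A B) \<ge> ord_at F (Affine x y) (aff.elt C 0)"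
    if "Affine x y \<in> curve_points F" for x y
    using assms(3)[OF that] ord_mult[OF that assms(1) aff.elt_ffield assms(2) nz(2)]
    unfolding AB by simp
  then obtain A' B' where "aff.elt A B = aff.elt C 0 * aff.elt A' B'"
    using regular_quotient[OF f(1) nz(1)] by blast
  then have "f = aff.elt A' B'" unfolding f(2) using nz(2) by simp
  then show ?thesis using that by blast
qed

text \<open>
  Order at least \<open>-N\<close> at both points \<open>(0, \<plusminus>w)\<close> at infinity forces the top coefficients \<open>a \<plusminus> bw\<close>, and hence
  \<open>a\<close> and \<open>b\<close>, to vanish as long as the common degree bound \<open>d\<close> exceeds \<open>N\<close>. As the chart at infinity
  requires \<open>d \<ge> 3\<close> even if \<open>B = 0\<close>, the argument controls the degree of \<open>A\<close> for \<open>N \<ge> 3\<close>.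
\<close>

lemma degree_bound:
  assumes nz: "aff.elt A B \<noteq> 0" and N: "N \<ge> 3"
    and ge: "\<And>w. AtInf w \<in> curve_points F \<Longrightarrow> ord_at F (AtInf w) (aff.elt A B) \<ge> - int N"
  shows "degree A \<le> N" "B = 0 \<or> degree B + 3 \<le> N"
proof -
  obtain w where "w ^ 2 = coeff F 6" using nth_root_exists[of 2 "coeff F 6"] by auto
  then have P: "AtInf w \<in> curve_points F" and P': "AtInf (- w) \<in> curve_points F"
    by (auto simp: curve_points_def)
  have w: "w \<noteq> 0" by (rule inf_w_nonzero[OF P])
  define d where "d = max (degree A) (degree B + 3)"
  have d: "degree A \<le> d" "degree B + 3 \<le> d" by (auto simp: d_def)
  have "degree A \<le> N \<and> (B = 0 \<or> degree B + 3 \<le> N)"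
  proof (rule ccontr)
    assume n: "\<not> (degree A \<le> N \<and> (B = 0 \<or> degree B + 3 \<le> N))"
    then have dN: "d > N" by (auto simp: d_def)
    have z: "coeff A d + coeff B (d - 3) * z = 0" if "AtInf z \<in> curve_points F" for z
    proof -
      interpret p: hyperelliptic_point "reversal 6 F" "1 / fun_u" "fun_y F / fun_u ^ 3" 0 z
        using that by (rule inf_point)
      have e: "inf.elt (reversal d A) (reversal (d - 3) B) \<noteq> 0"
        using nz elt_inf[OF d] by (auto simp del: inf.elt_eq_0_iff)
      have "vanishes (reversal 6 F) 0 z 1 (reversal d A) (reversal (d - 3) B)"
        using ord_inf_elt[OF that nz d, of 1] ge[OF that] dN by simp
      then have "p.residue (reversal d A) (reversal (d - 3) B) = 0"
        using p.vanishes_iff[OF e, of 1] p.vord_elt_pos_iff[OF e] by simp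
      then show ?thesis by (simp add: p.residue_def poly_reversal_0)
    qed
    have "2 * coeff A d = 0" "2 * (coeff B (d - 3) * w) = 0" using z[OF P] z[OF P']
      by (auto simp: algebra_simps)
    then have c: "coeff A d = 0" "coeff B (d - 3) = 0" using w by auto
    show False
    proof (cases "B = 0")
      case True
      then have "d = degree A" "A \<noteq> 0" using n N nz by (auto simp: d_def)
      then show ?thesis using c(1) by simp
    next
      case False
      show ?thesis
      proof (cases "degree A \<le> degree B + 3")
        case True
        then have "d = degree B + 3" by (simp add: d_def)
        then show ?thesis using c(2) False by simp
      next
        case False
        then have "d = degree A" "A \<noteq> 0" by (auto simp: d_def)
        then show ?thesis using c(1) by simp
      qed
    qed
  qed
  then show "degree A \<le> N" "B = 0 \<or> degree B + 3 \<le> N" by auto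
qed

end

section \<open>Principal divisors and the Galois action\<close>

context hyp_curve
begin

lemma carrier_divisor_group: "D \<in> carrier (divisor_group F) \<longleftrightarrow> Poly_Mapping.keys D \<subseteq> curve_points F"
  by (simp add: divisor_group_def)

lemma principal_divisorsI:
  assumes "Poly_Mapping.keys D \<subseteq> curve_points F" "f \<in> aff.ffield" "f \<noteq> 0"
    "\<And>P. P \<in> curve_points F \<Longrightarrow> Poly_Mapping.lookup D P = ord_at F P f"
  shows "D \<in> principal_divisors F"
  using assms unfolding principal_divisors_def function_field_eq carrier_divisor_group by auto

lemma principal_divisorsE:
  assumes "D \<in> principal_divisors F"
  obtains f where "Poly_Mapping.keys D \<subseteq> curve_points F" "f \<in> aff.ffield" "f \<noteq> 0"
    "\<And>P. P \<in> curve_points F \<Longrightarrow> Poly_Mapping.lookup D P = ord_at F P f"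
  using assms unfolding principal_divisors_def function_field_eq carrier_divisor_group by auto

lemma comm_group_divisor_group: "comm_group (divisor_group F)"
  unfolding divisor_group_def by (rule abelian_free_Abelian_group)

lemma subgroup_principal_divisors: "subgroup (principal_divisors F) (divisor_group F)"
proof -
  interpret G: comm_group "divisor_group F" by (rule comm_group_divisor_group)
  have 1: "1 \<in> aff.ffield" using aff.elt_ffield[of 1 0] by simp
  have one: "ord_at F P 1 = 0" if "P \<in> curve_points F" for P
    using ord_mult[OF that 1 1] by simp
  show ?thesis
  proof (rule G.subgroupI)
    show "principal_divisors F \<subseteq> carrier (divisor_group F)" by (auto simp: principal_divisors_def)
    have "0 \<in> principal_divisors F" by (rule principal_divisorsI[OF _ 1]) (simp_all add: one)
    then show "principal_divisors F \<noteq> {}" by blast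
  next
    fix D assume "D \<in> principal_divisors F"
    then obtain f where f: "Poly_Mapping.keys D \<subseteq> curve_points F" "f \<in> aff.ffield" "f \<noteq> 0"
      "\<And>P. P \<in> curve_points F \<Longrightarrow> Poly_Mapping.lookup D P = ord_at F P f" by (rule principal_divisorsE) blast
    have "- D \<in> principal_divisors F"
      using f aff.ffield_inverse[OF f(2)]
      by (intro principal_divisorsI[where f = "inverse f"]) (auto simp: keys_minus ord_inverse)
    then show "inv\<^bsub>divisor_group F\<^esub> D \<in> principal_divisors F"
      using f(1) by (simp add: divisor_group_def)
  next
    fix D E assume "D \<in> principal_divisors F" "E \<in> principal_divisors F"
    then obtain f g where f: "Poly_Mapping.keys D \<subseteq> curve_points F" "f \<in> aff.ffield" "f \<noteq> 0"
      "\<And>P. P \<in> curve_points F \<Longrightarrow> Poly_Mapping.lookup D P = ord_at F P f"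
      and g: "Poly_Mapping.keys E \<subseteq> curve_points F" "g \<in> aff.ffield" "g \<noteq> 0"
      "\<And>P. P \<in> curve_points F \<Longrightarrow> Poly_Mapping.lookup E P = ord_at F P g"
      by (metis principal_divisorsE)
    have "D + E \<in> principal_divisors F"
      using f g aff.ffield_mult[OF f(2) g(2)] Poly_Mapping.keys_add[of D E]
      by (intro principal_divisorsI[where f = "f * g"]) (auto simp: lookup_add ord_mult)
    then show "D \<otimes>\<^bsub>divisor_group F\<^esub> E \<in> principal_divisors F"
      by (simp add: divisor_group_def)
  qed
qed

end

lemma divisor_degree_superset:
  "finite S \<Longrightarrow> Poly_Mapping.keys D \<subseteq> S \<Longrightarrow> divisor_degree D = (\<Sum>P\<in>S. Poly_Mapping.lookup D P)"
  unfolding divisor_degree_def by (intro sum.mono_neutral_left) (auto simp: in_keys_iff)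

lemma divisor_degree_add: "divisor_degree (D + E) = divisor_degree D + divisor_degree E"
proof -
  let ?S = "Poly_Mapping.keys D \<union> Poly_Mapping.keys E"
  have "divisor_degree (D + E) = (\<Sum>P\<in>?S. Poly_Mapping.lookup (D + E) P)"
    using Poly_Mapping.keys_add[of D E] by (intro divisor_degree_superset) auto
  also have "\<dots> = (\<Sum>P\<in>?S. Poly_Mapping.lookup D P) + (\<Sum>P\<in>?S. Poly_Mapping.lookup E P)"
    by (simp add: lookup_add sum.distrib)
  also have "\<dots> = divisor_degree D + divisor_degree E"
    by (subst (1 2) divisor_degree_superset[symmetric]) auto
  finally show ?thesis .
qed

lemma divisor_degree_minus: "divisor_degree (- D) = - divisor_degree D"
  using divisor_degree_add[of D "- D"] by (simp add: divisor_degree_def)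

lemma lookup_galois_divisor:
  assumes "bij \<sigma>"
  shows "Poly_Mapping.lookup (galois_divisor \<sigma> D) (map_point \<sigma> P) = Poly_Mapping.lookup D P"
proof -
  have "inj (map_point \<sigma>)" using assms by (intro point.inj_map) (rule bij_is_inj)
  then have "map_point \<sigma> P = map_point \<sigma> Q \<longleftrightarrow> P = Q" for Q by (auto dest: injD)
  then show ?thesis
    by (auto simp: galois_divisor_def frag_extend_def lookup_sum sum.delta in_keys_iff if_distrib cong: if_cong)
qed

lemma galois_divisor_add: "galois_divisor \<sigma> (D + E) = galois_divisor \<sigma> D + galois_divisor \<sigma> E"
  by (simp add: galois_divisor_def frag_extend_add)

lemma galois_divisor_minus: "galois_divisor \<sigma> (- D) = - galois_divisor \<sigma> D"
  by (simp add: galois_divisor_def frag_extend_minus)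

lemma keys_galois_divisor: "Poly_Mapping.keys (galois_divisor \<sigma> D) \<subseteq> map_point \<sigma> ` Poly_Mapping.keys D"
  unfolding galois_divisor_def using keys_frag_extend[of "\<lambda>P. frag_of (map_point \<sigma> P)" D] by auto

lemma galois_divisor_inv:
  assumes "bij \<sigma>"
  shows "galois_divisor \<sigma> (galois_divisor (inv_into UNIV \<sigma>) D) = D"
proof (rule poly_mapping_eqI)
  fix P
  have \<sigma>: "bij (inv_into UNIV \<sigma>)" "\<And>z. \<sigma> (inv_into UNIV \<sigma> z) = z" using assms by (auto simp: bij_imp_bij_inv bij_is_surj surj_f_inv_f)
  have "P = map_point \<sigma> (map_point (inv_into UNIV \<sigma>) P)" by (cases P) (simp_all add: \<sigma>)
  then have "Poly_Mapping.lookup (galois_divisor \<sigma> (galois_divisor (inv_into UNIV \<sigma>) D)) P =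
     Poly_Mapping.lookup (galois_divisor (inv_into UNIV \<sigma>) D) (map_point (inv_into UNIV \<sigma>) P)"
    by (metis lookup_galois_divisor[OF assms])
  also have "\<dots> = Poly_Mapping.lookup D P" by (rule lookup_galois_divisor[OF \<sigma>(1)])
  finally show "Poly_Mapping.lookup (galois_divisor \<sigma> (galois_divisor (inv_into UNIV \<sigma>) D)) P = Poly_Mapping.lookup D P" .
qed

lemma absolute_galois_inv:
  assumes "\<sigma> \<in> absolute_galois"
  shows "inv_into UNIV \<sigma> \<in> absolute_galois"
proof -
  have \<sigma>: "bij \<sigma>" "\<And>x y. \<sigma> (x + y) = \<sigma> x + \<sigma> y" "\<And>x y. \<sigma> (x * y) = \<sigma> x * \<sigma> y" "\<And>a. \<sigma> (to_ac a) = to_ac a"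
    using assms by (auto simp: absolute_galois_def)
  have i: "inv_into UNIV \<sigma> z = w \<longleftrightarrow> z = \<sigma> w" for z w using \<sigma>(1) by (metis bij_inv_eq_iff)
  have s: "\<sigma> (inv_into UNIV \<sigma> z) = z" for z using \<sigma>(1) by (metis bij_inv_eq_iff)
  show ?thesis unfolding absolute_galois_def
    by (auto simp: i \<sigma> s bij_imp_bij_inv)
qed

locale hyp_curve_over = hyp_curve "map_poly to_ac F0" for F0 :: "'a::field_char_0 poly"
begin

abbreviation Fb where "Fb \<equiv> map_poly to_ac F0"

context
  fixes \<sigma> :: "'a alg_closure \<Rightarrow> 'a alg_closure"
  assumes gal: "\<sigma> \<in> absolute_galois"
begin

lemma bij_gal: "bij \<sigma>" and gal_add: "\<And>x y. \<sigma> (x + y) = \<sigma> x + \<sigma> y"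
  and gal_mult: "\<And>x y. \<sigma> (x * y) = \<sigma> x * \<sigma> y" and gal_base: "\<And>a. \<sigma> (to_ac a) = to_ac a"
  using gal by (auto simp: absolute_galois_def)

lemma gal_0: "\<sigma> 0 = 0" using gal_base[of 0] by simp

lemma gal_eq_0: "\<sigma> z = 0 \<longleftrightarrow> z = 0"
  using gal_0 bij_gal by (metis bij_pointE)

lemma gal_coeff: "\<sigma> (coeff Fb i) = coeff Fb i"
  by (simp add: coeff_map_poly gal_base)

lemma gal_Fb: "map_poly \<sigma> Fb = Fb"
  by (rule poly_eqI) (simp only: coeff_map_poly gal_0 gal_coeff)

lemma gal_poly: "\<sigma> (poly p z) = poly (map_poly \<sigma> p) (\<sigma> z)"
  by (induction p) (simp_all add: gal_0 map_poly_pCons gal_add gal_mult)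

lemma gal_power2: "\<sigma> (z ^ 2) = \<sigma> z ^ 2"
  by (simp add: power2_eq_square gal_mult)

lemma gal_curve_points: "P \<in> curve_points Fb \<Longrightarrow> map_point \<sigma> P \<in> curve_points Fb"
proof (cases P)
  case (Affine x y)
  assume "P \<in> curve_points Fb"
  then have "y ^ 2 = poly Fb x" using Affine by (auto simp: curve_points_def)
  then have "\<sigma> y ^ 2 = poly Fb (\<sigma> x)" using gal_poly[of Fb x] gal_Fb gal_power2[of y] by simp
  then show ?thesis using Affine by (simp add: curve_points_def)
next
  case (AtInf w)
  assume "P \<in> curve_points Fb"
  then have "w ^ 2 = coeff Fb 6" using AtInf by (auto simp: curve_points_def)
  then have "\<sigma> w ^ 2 = coeff Fb 6" using gal_coeff[of 6] gal_power2[of w] by simp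
  then show ?thesis using AtInf by (simp add: curve_points_def)
qed

lemma map_gal_eq_0: "map_poly \<sigma> A = 0 \<longleftrightarrow> A = 0"
  by (auto simp: poly_eq_iff coeff_map_poly gal_0 gal_eq_0)

text \<open>
  Automorphisms transport the vanishing predicate, in the chart at infinity applied to the reversed
  polynomials. The opposite inequality follows by applying this one to the inverse automorphism.
\<close>

lemma gal_ord_mono:
  assumes P: "P \<in> curve_points Fb" and nz: "aff.elt A B \<noteq> 0"
  shows "ord_at Fb P (aff.elt A B) \<le> ord_at Fb (map_point \<sigma> P) (aff.elt (map_poly \<sigma> A) (map_poly \<sigma> B))"
proof -
  have nz': "aff.elt (map_poly \<sigma> A) (map_poly \<sigma> B) \<noteq> 0" using nz by (simp add: map_gal_eq_0)
  have van: "vanishes G (\<sigma> x) (\<sigma> y) n (map_poly \<sigma> A) (map_poly \<sigma> B)"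
    if "vanishes G x y n A B" "\<And>i. \<sigma> (coeff G i) = coeff G i" for G x y n A B
    by (rule vanishes_map[OF _ _ _ _ that(1)]) (simp_all add: gal_add gal_mult that(2))
  show ?thesis
  proof (cases P)
    case (Affine x y)
    have P1: "Affine x y \<in> curve_points Fb" and P2: "Affine (\<sigma> x) (\<sigma> y) \<in> curve_points Fb"
      using P gal_curve_points[OF P] Affine by auto
    define n where "n = nat (ord_at Fb P (aff.elt A B))"
    have n: "int n = ord_at Fb P (aff.elt A B)" using ord_affine_nonneg[OF P1 nz] Affine by (simp add: n_def)
    then have "vanishes Fb x y n A B" using ord_affine_elt[OF P1 nz] Affine by simp
    then have "vanishes Fb (\<sigma> x) (\<sigma> y) n (map_poly \<sigma> A) (map_poly \<sigma> B)" by (rule van) (rule gal_coeff)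
    then show ?thesis using ord_affine_elt[OF P2 nz'] n Affine by simp
  next
    case (AtInf w)
    have P1: "AtInf w \<in> curve_points Fb" and P2: "AtInf (\<sigma> w) \<in> curve_points Fb"
      using P gal_curve_points[OF P] AtInf by auto
    define d where "d = max (degree A) (degree B + 3)"
    have d: "degree A \<le> d" "degree B + 3 \<le> d" by (auto simp: d_def)
    have d': "degree (map_poly \<sigma> A) \<le> d" "degree (map_poly \<sigma> B) + 3 \<le> d"
      using degree_map_poly_le[of \<sigma> A, OF gal_0] degree_map_poly_le[of \<sigma> B, OF gal_0] d by auto
    define n where "n = nat (ord_at Fb P (aff.elt A B) + int d)"
    have "ord_at Fb P (aff.elt A B) \<ge> - int d" using ord_inf_elt[OF P1 nz d, of 0] AtInf by simp
    then have n: "int n - int d = ord_at Fb P (aff.elt A B)" by (simp add: n_def)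
    then have "vanishes (reversal 6 Fb) 0 w n (reversal d A) (reversal (d - 3) B)" using ord_inf_elt[OF P1 nz d] AtInf by simp
    then have "vanishes (reversal 6 Fb) (\<sigma> 0) (\<sigma> w) n (map_poly \<sigma> (reversal d A)) (map_poly \<sigma> (reversal (d - 3) B))"
      by (rule van) (simp add: coeff_reversal gal_coeff gal_0)
    then show ?thesis using ord_inf_elt[OF P2 nz' d'] n AtInf by (simp add: map_poly_reversal gal_0)
  qed
qed

end

lemma gal_ord_eq:
  assumes \<sigma>: "\<sigma> \<in> absolute_galois" and P: "P \<in> curve_points Fb" and nz: "aff.elt A B \<noteq> 0"
  shows "ord_at Fb (map_point \<sigma> P) (aff.elt (map_poly \<sigma> A) (map_poly \<sigma> B)) = ord_at Fb P (aff.elt A B)"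
proof (rule antisym)
  have b: "bij \<sigma>" by (rule bij_gal[OF \<sigma>])
  then have i: "inv_into UNIV \<sigma> (\<sigma> z) = z" for z by (metis bij_inv_eq_iff)
  have m: "map_poly (inv_into UNIV \<sigma>) (map_poly \<sigma> A) = A" for A
    by (subst map_poly_map_poly) (simp_all add: gal_0[OF \<sigma>] gal_0[OF absolute_galois_inv[OF \<sigma>]] i o_def)
  have p: "map_point (inv_into UNIV \<sigma>) (map_point \<sigma> P) = P" by (cases P) (simp_all add: i)
  have "aff.elt (map_poly \<sigma> A) (map_poly \<sigma> B) \<noteq> 0" using nz by (simp add: map_gal_eq_0[OF \<sigma>])
  from gal_ord_mono[OF absolute_galois_inv[OF \<sigma>] gal_curve_points[OF \<sigma> P] this]
  show "ord_at Fb (map_point \<sigma> P) (aff.elt (map_poly \<sigma> A) (map_poly \<sigma> B)) \<le> ord_at Fb P (aff.elt A B)"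
    by (simp add: m p)
qed (rule gal_ord_mono[OF \<sigma> P nz])

lemma galois_principal:
  assumes \<sigma>: "\<sigma> \<in> absolute_galois" and D: "D \<in> principal_divisors Fb"
  shows "galois_divisor \<sigma> D \<in> principal_divisors Fb"
proof -
  obtain f where f: "Poly_Mapping.keys D \<subseteq> curve_points Fb" "f \<in> aff.ffield" "f \<noteq> 0"
    "\<And>P. P \<in> curve_points Fb \<Longrightarrow> Poly_Mapping.lookup D P = ord_at Fb P f"
    using D by (rule principal_divisorsE) blast
  obtain A B C E where fe: "f = aff.elt A B / aff.elt C E" "aff.elt C E \<noteq> 0"
    using f(2) unfolding aff.ffield_def by blast
  then have nz: "aff.elt A B \<noteq> 0" using f(3) by auto
  define g where "g = aff.elt (map_poly \<sigma> A) (map_poly \<sigma> B)"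
  define h where "h = aff.elt (map_poly \<sigma> C) (map_poly \<sigma> E)"
  have gh: "g \<noteq> 0" "h \<noteq> 0" using nz fe(2) by (simp_all add: g_def h_def map_gal_eq_0[OF \<sigma>])
  have ghf: "g \<in> aff.ffield" "h \<in> aff.ffield" unfolding g_def h_def by (rule aff.elt_ffield)+
  note b = bij_gal[OF \<sigma>]
  show ?thesis
  proof (rule principal_divisorsI[where f = "g * inverse h"])
    show "Poly_Mapping.keys (galois_divisor \<sigma> D) \<subseteq> curve_points Fb"
      using keys_galois_divisor[of \<sigma> D] f(1) gal_curve_points[OF \<sigma>] by blast
    show "g * inverse h \<in> aff.ffield" using ghf by (intro aff.ffield_mult aff.ffield_inverse)
    show "g * inverse h \<noteq> 0" using gh by simp
    fix Q assume Q: "Q \<in> curve_points Fb"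
    define P where "P = map_point (inv_into UNIV \<sigma>) Q"
    have P: "P \<in> curve_points Fb" unfolding P_def by (rule gal_curve_points[OF absolute_galois_inv[OF \<sigma>] Q])
    have Q': "Q = map_point \<sigma> P" unfolding P_def using b
      by (cases Q) (simp_all add: bij_is_surj surj_f_inv_f)
    have "Poly_Mapping.lookup (galois_divisor \<sigma> D) Q = ord_at Fb P f"
      unfolding Q' lookup_galois_divisor[OF b] using f(4)[OF P] .
    also have "f = aff.elt A B * inverse (aff.elt C E)" using fe(1) by (simp add: divide_inverse)
    also have "ord_at Fb P \<dots> = ord_at Fb P (aff.elt A B) - ord_at Fb P (aff.elt C E)"
      using ord_mult[OF P aff.elt_ffield aff.ffield_inverse[OF aff.elt_ffield] nz] fe(2)
        ord_inverse[OF P aff.elt_ffield fe(2)] by simp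
    also have "\<dots> = ord_at Fb Q g - ord_at Fb Q h"
      unfolding g_def h_def Q' using gal_ord_eq[OF \<sigma> P] nz fe(2) by simp
    also have "\<dots> = ord_at Fb Q (g * inverse h)"
      using ord_mult[OF Q ghf(1) aff.ffield_inverse[OF ghf(2)] gh(1)] gh(2) ord_inverse[OF Q ghf(2) gh(2)] by simp
    finally show "Poly_Mapping.lookup (galois_divisor \<sigma> D) Q = ord_at Fb Q (g * inverse h)" .
  qed
qed

lemma galois_image_principal:
  assumes \<sigma>: "\<sigma> \<in> absolute_galois"
  shows "galois_divisor \<sigma> ` principal_divisors Fb = principal_divisors Fb"
proof (intro equalityI subsetI)
  fix D assume "D \<in> principal_divisors Fb"
  then have "galois_divisor (inv_into UNIV \<sigma>) D \<in> principal_divisors Fb"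
    by (rule galois_principal[OF absolute_galois_inv[OF \<sigma>]])
  then show "D \<in> galois_divisor \<sigma> ` principal_divisors Fb"
    using galois_divisor_inv[OF bij_gal[OF \<sigma>], of D] by (metis imageI)
qed (use galois_principal[OF \<sigma>] in auto)

section \<open>The group of rational points of the Jacobian\<close>

text \<open>
  A class of degree 0 is Galois invariant exactly when some representative of degree 0 changes by
  principal divisors only. Working with representatives turns the group of rational points of the
  Jacobian into the image of a subgroup of the free abelian group of divisors.
\<close>

definition invariant_divisors :: "('a alg_closure point \<Rightarrow>\<^sub>0 int) set" where
  "invariant_divisors = {D. Poly_Mapping.keys D \<subseteq> curve_points Fb \<and> divisor_degree D = 0 \<and>
     (\<forall>\<sigma>\<in>absolute_galois. galois_divisor \<sigma> D - D \<in> principal_divisors Fb)}"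

abbreviation cls where "cls D \<equiv> principal_divisors Fb #>\<^bsub>divisor_group Fb\<^esub> D"

lemma cls_eq: "cls D = (\<lambda>E. E + D) ` principal_divisors Fb"
  by (auto simp: r_coset_def divisor_group_def)

lemma galois_cls:
  assumes \<sigma>: "\<sigma> \<in> absolute_galois"
  shows "galois_divisor \<sigma> ` cls D = cls (galois_divisor \<sigma> D)"
  unfolding cls_eq image_image galois_divisor_add
  using galois_image_principal[OF \<sigma>] by (metis (no_types, lifting) image_cong image_image)

lemma zero_principal: "0 \<in> principal_divisors Fb"
  using subgroup.one_closed[OF subgroup_principal_divisors] by (simp add: divisor_group_def)

lemma cls_eq_iff: 
  assumes D: "Poly_Mapping.keys D \<subseteq> curve_points Fb" and E: "Poly_Mapping.keys E \<subseteq> curve_points Fb"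
  shows "cls D = cls E \<longleftrightarrow> D - E \<in> principal_divisors Fb"
proof
  assume "cls D = cls E"
  moreover have "D \<in> cls D" unfolding cls_eq using zero_principal by force
  ultimately show "D - E \<in> principal_divisors Fb" by (auto simp: cls_eq)
next
  interpret G: comm_group "divisor_group Fb" by (rule comm_group_divisor_group)
  assume "D - E \<in> principal_divisors Fb"
  then have "D \<in> cls E" unfolding cls_eq by (metis add.commute diff_add_cancel image_eqI)
  then show "cls D = cls E"
    using G.repr_independence[OF _ _ subgroup_principal_divisors, of D E] E carrier_divisor_group by auto
qed

lemma carrier_jacobian_points: "carrier (jacobian_points F0) = cls ` invariant_divisors"
proof -
  have m1: "c \<in> carrier (jacobian_points F0) \<longleftrightarrow>
     (\<exists>D. Poly_Mapping.keys D \<subseteq> curve_points Fb \<and> c = cls D) \<and> (\<exists>E\<in>c. divisor_degree E = 0) \<and>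
     (\<forall>\<sigma>\<in>absolute_galois. galois_divisor \<sigma> ` c = c)" for c
    by (auto simp: jacobian_points_def Let_def picard_group_0_def picard_group_def carrier_FactGroup
       carrier_divisor_group image_iff) blast+
  have m2: "(\<exists>D. Poly_Mapping.keys D \<subseteq> curve_points Fb \<and> c = cls D) \<and> (\<exists>E\<in>c. divisor_degree E = 0) \<and>
     (\<forall>\<sigma>\<in>absolute_galois. galois_divisor \<sigma> ` c = c) \<longleftrightarrow> c \<in> cls ` invariant_divisors" for c
  proof
    assume c: "(\<exists>D. Poly_Mapping.keys D \<subseteq> curve_points Fb \<and> c = cls D) \<and> (\<exists>E\<in>c. divisor_degree E = 0) \<and>
     (\<forall>\<sigma>\<in>absolute_galois. galois_divisor \<sigma> ` c = c)"
    then obtain D E where D: "Poly_Mapping.keys D \<subseteq> curve_points Fb" "c = cls D" "E \<in> c" "divisor_degree E = 0"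
      by blast
    have "E - D \<in> principal_divisors Fb" using D by (auto simp: cls_eq)
    then have "Poly_Mapping.keys (E - D) \<subseteq> curve_points Fb" by (auto elim: principal_divisorsE)
    then have E: "Poly_Mapping.keys E \<subseteq> curve_points Fb"
      using Poly_Mapping.keys_add[of "E - D" D] D(1) by auto
    have cE: "c = cls E" using cls_eq_iff[OF E D(1)] \<open>E - D \<in> _\<close> D(2) by simp
    have "galois_divisor \<sigma> E - E \<in> principal_divisors Fb" if \<sigma>: "\<sigma> \<in> absolute_galois" for \<sigma>
    proof -
      have "Poly_Mapping.keys (galois_divisor \<sigma> E) \<subseteq> curve_points Fb"
        using keys_galois_divisor[of \<sigma> E] E gal_curve_points[OF \<sigma>] by blast
      then show ?thesis using c \<sigma> galois_cls[OF \<sigma>, of E] cE cls_eq_iff[OF _ E] by metis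
    qed
    then have "E \<in> invariant_divisors" using E D(4) by (simp add: invariant_divisors_def)
    then show "c \<in> cls ` invariant_divisors" using cE by blast
  next
    assume "c \<in> cls ` invariant_divisors"
    then obtain E where E: "c = cls E" "Poly_Mapping.keys E \<subseteq> curve_points Fb" "divisor_degree E = 0"
      "\<And>\<sigma>. \<sigma> \<in> absolute_galois \<Longrightarrow> galois_divisor \<sigma> E - E \<in> principal_divisors Fb"
      by (auto simp: invariant_divisors_def)
    have "E \<in> c" unfolding E(1) cls_eq using zero_principal by force
    moreover have "galois_divisor \<sigma> ` c = c" if \<sigma>: "\<sigma> \<in> absolute_galois" for \<sigma>
    proof -
      have "Poly_Mapping.keys (galois_divisor \<sigma> E) \<subseteq> curve_points Fb"
        using keys_galois_divisor[of \<sigma> E] E gal_curve_points[OF \<sigma>] by blast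
      then show ?thesis using galois_cls[OF \<sigma>, of E] E(1,2) E(4)[OF \<sigma>] cls_eq_iff by metis
    qed
    ultimately show "(\<exists>D. Poly_Mapping.keys D \<subseteq> curve_points Fb \<and> c = cls D) \<and> (\<exists>E\<in>c. divisor_degree E = 0) \<and>
     (\<forall>\<sigma>\<in>absolute_galois. galois_divisor \<sigma> ` c = c)" using E by blast
  qed
  show ?thesis by (rule Set.set_eqI) (simp only: m1 m2)
qed

lemma jacobian_points_eq:
  "jacobian_points F0 = (divisor_group Fb Mod principal_divisors Fb) \<lparr>carrier := cls ` invariant_divisors\<rparr>"
  using carrier_jacobian_points
  by (simp add: jacobian_points_def Let_def picard_group_0_def picard_group_def)

lemma subgroup_invariant_divisors: "subgroup invariant_divisors (divisor_group Fb)"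
proof -
  interpret G: comm_group "divisor_group Fb" by (rule comm_group_divisor_group)
  interpret N: subgroup "principal_divisors Fb" "divisor_group Fb" by (rule subgroup_principal_divisors)
  show ?thesis
  proof (rule G.subgroupI)
    show "invariant_divisors \<subseteq> carrier (divisor_group Fb)"
      by (auto simp: invariant_divisors_def carrier_divisor_group)
    have "0 \<in> invariant_divisors" using zero_principal
      by (simp add: invariant_divisors_def divisor_degree_def galois_divisor_def)
    then show "invariant_divisors \<noteq> {}" by blast
  next
    fix D assume D: "D \<in> invariant_divisors"
    have neg: "- E \<in> principal_divisors Fb" if "E \<in> principal_divisors Fb" for E
      using N.m_inv_closed[OF that] N.subset that
      by (simp add: divisor_group_def subset_iff)
    have "galois_divisor \<sigma> (- D) - (- D) = - (galois_divisor \<sigma> D - D)" for \<sigma>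
      by (simp add: galois_divisor_minus)
    then have "- D \<in> invariant_divisors" using D neg
      unfolding invariant_divisors_def by (auto simp only: mem_Collect_eq keys_minus divisor_degree_minus)
    then show "inv\<^bsub>divisor_group Fb\<^esub> D \<in> invariant_divisors"
      using D by (simp add: divisor_group_def invariant_divisors_def)
  next
    fix D E assume DE: "D \<in> invariant_divisors" "E \<in> invariant_divisors"
    have add: "A + B \<in> principal_divisors Fb" if "A \<in> principal_divisors Fb" "B \<in> principal_divisors Fb" for A B
      using N.m_closed[OF that] by (simp add: divisor_group_def)
    have "galois_divisor \<sigma> (D + E) - (D + E) = (galois_divisor \<sigma> D - D) + (galois_divisor \<sigma> E - E)" for \<sigma>
      by (simp add: galois_divisor_add)
    then have "galois_divisor \<sigma> (D + E) - (D + E) \<in> principal_divisors Fb" if "\<sigma> \<in> absolute_galois" for \<sigma>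
      using add DE that by (simp only: invariant_divisors_def mem_Collect_eq)
    then have "D + E \<in> invariant_divisors" using DE add Poly_Mapping.keys_add[of D E]
      by (auto simp: invariant_divisors_def divisor_degree_add)
    then show "D \<otimes>\<^bsub>divisor_group Fb\<^esub> E \<in> invariant_divisors"
      by (simp add: divisor_group_def)
  qed
qed

text \<open>
  Passing from divisors to classes, a relation between the classes of \<open>D1\<close> and \<open>D2\<close> says that an integral
  combination of \<open>D1\<close> and \<open>D2\<close> is principal.
\<close>

theorem rank_ge_2:
  assumes D: "D1 \<in> invariant_divisors" "D2 \<in> invariant_divisors"
    and indep: "\<And>a b. frag_cmul a D1 + frag_cmul b D2 \<in> principal_divisors Fb \<Longrightarrow> a = 0 \<and> b = 0"
  shows "group_rank (jacobian_points F0) \<ge> 2"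
proof -
  let ?G = "divisor_group Fb" and ?N = "principal_divisors Fb"
  let ?J = "jacobian_points F0"
  interpret G: comm_group ?G by (rule comm_group_divisor_group)
  have sub: "subgroup ?N ?G" by (rule subgroup_principal_divisors)
  interpret N: normal ?N ?G using G.normal_iff_subgroup sub by blast
  interpret P: comm_group "?G Mod ?N" by (rule G.abelian_FactGroup[OF sub])
  interpret h: group_hom ?G "?G Mod ?N" cls
    by (simp add: group_hom_def group_hom_axioms_def N.r_coset_hom_Mod G.is_group P.is_group)
  have sJ: "subgroup (cls ` invariant_divisors) (?G Mod ?N)"
    by (rule h.subgroup_img_is_subgroup[OF subgroup_invariant_divisors])
  have gJ: "group ?J"
    unfolding jacobian_points_eq by (rule subgroup.subgroup_is_group[OF sJ P.is_group])
  interpret J: comm_group ?J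
  proof (rule group.group_comm_groupI[OF gJ])
    fix c e assume "c \<in> carrier ?J" "e \<in> carrier ?J"
    then show "c \<otimes>\<^bsub>?J\<^esub> e = e \<otimes>\<^bsub>?J\<^esub> c"
      using P.m_comm[of c e] subgroup.subset[OF sJ] unfolding jacobian_points_eq by auto
  qed
  have DG: "D1 \<in> carrier ?G" "D2 \<in> carrier ?G"
    using D by (auto simp: invariant_divisors_def carrier_divisor_group)
  then have keys: "Poly_Mapping.keys D1 \<subseteq> curve_points Fb" "Poly_Mapping.keys D2 \<subseteq> curve_points Fb"
    by (simp_all add: carrier_divisor_group)
  have cJ: "cls D1 \<in> carrier ?J" "cls D2 \<in> carrier ?J"
    unfolding carrier_jacobian_points using D by auto
  have pow: "cls E [^]\<^bsub>?J\<^esub> (n::int) = cls (frag_cmul n E)" if "E \<in> invariant_divisors" for E n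
  proof -
    have E: "E \<in> carrier ?G" using that by (auto simp: invariant_divisors_def carrier_divisor_group)
    have "cls E [^]\<^bsub>?J\<^esub> n = cls E [^]\<^bsub>?G Mod ?N\<^esub> n"
      unfolding jacobian_points_eq by (rule P.int_pow_consistent[symmetric, OF sJ]) (use that in blast)
    also have "\<dots> = cls (E [^]\<^bsub>?G\<^esub> n)" using h.hom_int_pow[OF E] by simp
    also have "E [^]\<^bsub>?G\<^esub> n = frag_cmul n E"
      using E by (simp add: divisor_group_def)
    finally show ?thesis .
  qed
  have ne: "cls D1 \<noteq> cls D2"
  proof
    assume "cls D1 = cls D2"
    then have "frag_cmul 1 D1 + frag_cmul (- 1) D2 \<in> ?N" using cls_eq_iff[OF keys] by simp
    then show False using indep[of 1 "- 1"] by simp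
  qed
  have "int_independent ?J {cls D1, cls D2}"
    unfolding int_independent_def
  proof (intro conjI allI impI)
    show "{cls D1, cls D2} \<subseteq> carrier ?J" using cJ by simp
    show "finite {cls D1, cls D2}" by simp
    fix c :: "_ \<Rightarrow> int"
    assume f: "finprod ?J (\<lambda>s. s [^]\<^bsub>?J\<^esub> c s) {cls D1, cls D2} = \<one>\<^bsub>?J\<^esub>"
    define a where "a = c (cls D1)"
    define b where "b = c (cls D2)"
    have "finprod ?J (\<lambda>s. s [^]\<^bsub>?J\<^esub> c s) {cls D1, cls D2} = cls D1 [^]\<^bsub>?J\<^esub> a \<otimes>\<^bsub>?J\<^esub> cls D2 [^]\<^bsub>?J\<^esub> b"
      using ne cJ by (simp add: a_def b_def)
    also have "\<dots> = cls (frag_cmul a D1) \<otimes>\<^bsub>?J\<^esub> cls (frag_cmul b D2)"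
      using pow D by simp
    also have "\<dots> = cls (frag_cmul a D1 + frag_cmul b D2)"
      using h.hom_mult[of "frag_cmul a D1" "frag_cmul b D2"] keys keys_cmul[of a D1] keys_cmul[of b D2]
      unfolding jacobian_points_eq by (simp add: divisor_group_def)
    finally have "cls (frag_cmul a D1 + frag_cmul b D2) = \<one>\<^bsub>?J\<^esub>" using f by simp
    moreover have "\<one>\<^bsub>?J\<^esub> = cls 0"
      unfolding jacobian_points_eq using h.hom_one by (simp add: divisor_group_def)
    moreover have "Poly_Mapping.keys (frag_cmul a D1 + frag_cmul b D2) \<subseteq> curve_points Fb"
      using Poly_Mapping.keys_add[of "frag_cmul a D1" "frag_cmul b D2"] keys_cmul[of a D1] keys_cmul[of b D2] keys
      by blast
    ultimately have "frag_cmul a D1 + frag_cmul b D2 \<in> ?N"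
      using cls_eq_iff[of "frag_cmul a D1 + frag_cmul b D2" 0] by simp
    then have "a = 0 \<and> b = 0" by (rule indep)
    then show "\<forall>s\<in>{cls D1, cls D2}. c s = 0" by (simp add: a_def b_def)
  qed
  then have "enat (card {cls D1, cls D2}) \<le> group_rank ?J"
    unfolding group_rank_def by (intro SUP_upper) simp
  then show ?thesis using ne by (simp add: numeral_eq_enat eval_nat_numeral)
qed

end

section \<open>From a principal divisor to polynomials over the base field\<close>

text \<open>
  A functional that does not kill a prescribed coefficient replaces Galois descent: it maps a nonzero
  solution of linear equations over the base field to a nonzero solution in the base field.
\<close>

lemma linear_functional_ac:
  fixes e :: "'a::field alg_closure"
  assumes "e \<noteq> 0"
  obtains T :: "'a alg_closure \<Rightarrow> 'a" where "\<And>x y. T (x + y) = T x + T y"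
    "\<And>c z. T (to_ac c * z) = c * T z" "T e = 1"
proof -
  interpret vs: vector_space_pair "\<lambda>(c::'a) z. to_ac c * z" "(*) :: 'a \<Rightarrow> 'a \<Rightarrow> 'a"
    by unfold_locales (simp_all add: algebra_simps)
  have "\<not> vs.vs1.dependent {e}" using assms by (simp add: vs.vs1.dependent_single)
  then obtain T where T: "Vector_Spaces.linear (\<lambda>(c::'a) z. to_ac c * z) (*) T" "\<forall>x\<in>{e}. T x = 1"
    using vs.linear_independent_extend[of "{e}" "\<lambda>_. 1"] by blast
  interpret T: Vector_Spaces.linear "\<lambda>(c::'a) z. to_ac c * z" "(*) :: 'a \<Rightarrow> 'a \<Rightarrow> 'a" T by (rule T(1))
  show ?thesis using that[of T] T.add T.scale T(2) by simp
qed

context hyp_curve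
begin

lemma ord_elt_prod:
  assumes P: "P \<in> curve_points F" and I: "finite I"
  shows "ord_at F P (aff.elt (\<Prod>i\<in>I. [:- u i, 1:] ^ k i) 0) =
    (\<Sum>i\<in>I. int (k i) * ord_at F P (aff.elt [:- u i, 1:] 0))"
proof -
  have mult: "ord_at F P (aff.elt (A * B) 0) = ord_at F P (aff.elt A 0) + ord_at F P (aff.elt B 0)"
    if "A \<noteq> 0" "B \<noteq> 0" for A B
  proof -
    have "aff.elt (A * B) 0 = aff.elt A 0 * aff.elt B 0" unfolding aff.elt_mult by simp
    then show ?thesis using ord_mult[OF P aff.elt_ffield aff.elt_ffield] that by simp
  qed
  have 1: "ord_at F P (aff.elt 1 0) = 0" using mult[of 1 1] by simp
  have pow: "ord_at F P (aff.elt ([:- c, 1:] ^ n) 0) = int n * ord_at F P (aff.elt [:- c, 1:] 0)" for c n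
  proof (induction n)
    case (Suc n)
    then show ?case using mult[of "[:- c, 1:]" "[:- c, 1:] ^ n"]
      by (simp add: algebra_simps del: mult_pCons_left)
  qed (simp only: power_0 1 of_nat_0 mult_zero_left)
  show ?thesis using I
  proof (induction I rule: finite_induct)
    case (insert i I)
    have "(\<Prod>i\<in>I. [:- u i, 1:] ^ k i) \<noteq> 0" using insert(1) by (simp add: prod_zero_iff)
    then show ?case using insert mult[of "[:- u i, 1:] ^ k i" "\<Prod>i\<in>I. [:- u i, 1:] ^ k i"] pow by simp
  qed (simp only: prod.empty sum.empty 1)
qed

text \<open>
  If \<open>f\<close> has divisor \<open>\<Sum>e\<^sub>iP\<^sub>i\<close>, then \<open>f \<Prod>(u - u\<^sub>i)\<close>, with exponents \<open>k\<^sub>i \<ge> -e\<^sub>i\<close>, has no finite poles and is of the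
  form \<open>A + By\<close>. It vanishes to order \<open>e\<^sub>i + k\<^sub>i\<close> at \<open>P\<^sub>i\<close> and to order \<open>k\<^sub>i\<close> at the conjugate point, and its
  pole order at infinity is \<open>\<Sum>k\<^sub>i\<close>. For \<open>\<Sum>e\<^sub>i = 0\<close> both components of a split degeneration thus receive as
  many prescribed zeros as the degree bound allows.
\<close>

lemma principal_imp_polynomials:
  fixes u y :: "'i \<Rightarrow> 'k" and e :: "'i \<Rightarrow> int" and k :: "'i \<Rightarrow> nat"
  assumes I: "finite I" and inj: "inj_on u I" and y: "\<And>i. i \<in> I \<Longrightarrow> y i \<noteq> 0"
    and yF: "\<And>i. i \<in> I \<Longrightarrow> (y i)\<^sup>2 = poly F (u i)"
    and k: "\<And>i. i \<in> I \<Longrightarrow> e i + int (k i) \<ge> 0"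
    and N: "(\<Sum>i\<in>I. k i) \<ge> 3"
    and D: "(\<Sum>i\<in>I. frag_cmul (e i) (frag_of (Affine (u i) (y i)))) \<in> principal_divisors F"
  obtains A B where "A \<noteq> 0 \<or> B \<noteq> 0" "degree A \<le> (\<Sum>i\<in>I. k i)" "B = 0 \<or> degree B + 3 \<le> (\<Sum>i\<in>I. k i)"
    "\<And>i. i \<in> I \<Longrightarrow> vanishes F (u i) (y i) (nat (e i + int (k i))) A B"
    "\<And>i. i \<in> I \<Longrightarrow> vanishes F (u i) (- y i) (k i) A B"
proof -
  let ?D = "\<Sum>i\<in>I. frag_cmul (e i) (frag_of (Affine (u i) (y i)))"
  obtain f where f: "f \<in> aff.ffield" "f \<noteq> 0"
    "\<And>P. P \<in> curve_points F \<Longrightarrow> Poly_Mapping.lookup ?D P = ord_at F P f"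
    using D by (rule principal_divisorsE) blast
  have lookup: "Poly_Mapping.lookup ?D P = (\<Sum>i\<in>I. if P = Affine (u i) (y i) then e i else 0)" for P
    by (auto simp: lookup_sum intro!: sum.cong)
  have L1: "Poly_Mapping.lookup ?D (Affine (u j) z) = (if z = y j then e j else 0)" if "j \<in> I" for j z
  proof -
    have "Poly_Mapping.lookup ?D (Affine (u j) z) = (\<Sum>i\<in>I. if i = j then (if z = y j then e j else 0) else 0)"
      unfolding lookup using inj that by (intro sum.cong) (auto dest: inj_onD)
    then show ?thesis using that I by simp
  qed
  have L2: "Poly_Mapping.lookup ?D (Affine x z) = 0" if "x \<notin> u ` I" for x z
    unfolding lookup using that by (intro sum.neutral) auto
  have L3: "Poly_Mapping.lookup ?D (AtInf w) = 0" for w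
    unfolding lookup by (intro sum.neutral) auto
  define L where "L = (\<Prod>i\<in>I. [:- u i, 1:] ^ k i)"
  define N where "N = (\<Sum>i\<in>I. k i)"
  have L0: "L \<noteq> 0" using I by (simp add: L_def prod_zero_iff)
  have "degree L = (\<Sum>i\<in>I. degree ([:- u i, 1:] ^ k i))"
    unfolding L_def by (rule degree_prod_eq_sum_degree) simp
  then have degL: "degree L = N" by (simp add: N_def degree_linear_power)
  define g where "g = f * aff.elt L 0"
  have Lnz: "aff.elt L 0 \<noteq> 0" using L0 by simp
  have g: "g \<in> aff.ffield" "g \<noteq> 0" using f Lnz aff.elt_ffield by (auto simp: g_def intro: aff.ffield_mult)
  have og: "ord_at F P g = Poly_Mapping.lookup ?D P + ord_at F P (aff.elt L 0)" if "P \<in> curve_points F" for P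
    unfolding g_def using ord_mult[OF that f(1) aff.elt_ffield f(2) Lnz] f(3)[OF that] by simp
  have oL1: "ord_at F (Affine (u j) z) (aff.elt L 0) = int (k j)"
    if j: "j \<in> I" and P: "Affine (u j) z \<in> curve_points F" for j z
  proof -
    have "z\<^sup>2 = (y j)\<^sup>2" using P yF[OF j] by (auto simp: curve_points_def)
    then have "z \<noteq> 0" using y[OF j] by auto
    then have "ord_at F (Affine (u j) z) (aff.elt [:- u i, 1:] 0) = (if i = j then 1 else 0)" if "i \<in> I" for i
      using ord_linear[OF P] inj that j by (auto dest: inj_onD)
    then have "ord_at F (Affine (u j) z) (aff.elt L 0) = (\<Sum>i\<in>I. if i = j then int (k j) else 0)"
      unfolding L_def ord_elt_prod[OF P I] by (intro sum.cong) auto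
    then show ?thesis using j I by simp
  qed
  have og1: "ord_at F (Affine (u j) z) g = (if z = y j then e j else 0) + int (k j)"
    if "j \<in> I" "Affine (u j) z \<in> curve_points F" for j z
    unfolding og[OF that(2)] oL1[OF that] L1[OF that(1)] ..
  have reg: "ord_at F (Affine x z) g \<ge> 0" if P: "Affine x z \<in> curve_points F" for x z
  proof (cases "x \<in> u ` I")
    case True
    then obtain j where "j \<in> I" "x = u j" by auto
    then show ?thesis using og1[of j z] P k[of j] by auto
  next
    case False
    then show ?thesis using og[OF P] L2 ord_affine_nonneg[OF P Lnz] by simp
  qed
  obtain A B where AB: "g = aff.elt A B" using regular_imp_polynomial[OF g reg] .
  have nz: "aff.elt A B \<noteq> 0" using AB g(2) by simp
  have "ord_at F (AtInf w) (aff.elt A B) \<ge> - int N" if P: "AtInf w \<in> curve_points F" for w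
  proof -
    have "ord_at F (AtInf w) (aff.elt L 0) \<ge> - int N"
      using ord_inf_elt[OF P Lnz, of N 0] degL N by (simp add: N_def)
    then show ?thesis using og[OF P] L3 AB by simp
  qed
  note deg = degree_bound[OF nz _ this]
  have "vanishes F (u i) (y i) (nat (e i + int (k i))) A B \<and> vanishes F (u i) (- y i) (k i) A B" if i: "i \<in> I" for i
  proof -
    have P: "Affine (u i) (y i) \<in> curve_points F" "Affine (u i) (- y i) \<in> curve_points F"
      using yF[OF i] by (auto simp: curve_points_def)
    have "- y i \<noteq> y i" using y[OF i] by (metis add_eq_0_iff mult_2 mult_eq_0_iff zero_neq_numeral)
    then show ?thesis using og1[OF i P(1)] og1[OF i P(2)] ord_affine_elt[OF P(1) nz] ord_affine_elt[OF P(2) nz]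
      k[OF i] by (simp add: AB)
  qed
  then show ?thesis using that[of A B] nz deg N by (auto simp: N_def)
qed

end

context hyp_curve_over
begin

lemma principal_imp_rational_polynomials:
  fixes u y :: "'i \<Rightarrow> 'a" and e :: "'i \<Rightarrow> int" and k :: "'i \<Rightarrow> nat"
  assumes I: "finite I" and inj: "inj_on u I" and y: "\<And>i. i \<in> I \<Longrightarrow> y i \<noteq> 0"
    and yF: "\<And>i. i \<in> I \<Longrightarrow> (y i)\<^sup>2 = poly F0 (u i)"
    and k: "\<And>i. i \<in> I \<Longrightarrow> e i + int (k i) \<ge> 0"
    and N: "(\<Sum>i\<in>I. k i) \<ge> 3"
    and D: "(\<Sum>i\<in>I. frag_cmul (e i) (frag_of (Affine (to_ac (u i)) (to_ac (y i))))) \<in> principal_divisors Fb"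
  obtains A B where "A \<noteq> 0 \<or> B \<noteq> 0" "degree A \<le> (\<Sum>i\<in>I. k i)" "B = 0 \<or> degree B + 3 \<le> (\<Sum>i\<in>I. k i)"
    "\<And>i. i \<in> I \<Longrightarrow> vanishes F0 (u i) (y i) (nat (e i + int (k i))) A B"
    "\<And>i. i \<in> I \<Longrightarrow> vanishes F0 (u i) (- y i) (k i) A B"
proof -
  have Fu: "poly Fb (to_ac z) = to_ac (poly F0 z)" for z
    by (induction F0) (simp_all add: map_poly_pCons)
  have "(to_ac (y i))\<^sup>2 = poly Fb (to_ac (u i))" if "i \<in> I" for i
    using yF[OF that] Fu by (metis to_ac_power)
  moreover have "inj_on (\<lambda>i. to_ac (u i)) I" using inj by (simp add: inj_on_def)
  ultimately obtain A B where AB: "A \<noteq> 0 \<or> B \<noteq> 0" "degree A \<le> (\<Sum>i\<in>I. k i)"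
    "B = 0 \<or> degree B + 3 \<le> (\<Sum>i\<in>I. k i)"
    "\<And>i. i \<in> I \<Longrightarrow> vanishes Fb (to_ac (u i)) (to_ac (y i)) (nat (e i + int (k i))) A B"
    "\<And>i. i \<in> I \<Longrightarrow> vanishes Fb (to_ac (u i)) (- to_ac (y i)) (k i) A B"
    using principal_imp_polynomials[OF I, of "\<lambda>i. to_ac (u i)" "\<lambda>i. to_ac (y i)" e k] y k N D by auto
  obtain c where c: "c \<noteq> 0" "(\<exists>n. c = coeff A n) \<or> (\<exists>n. c = coeff B n)"
    using AB(1) by (metis leading_coeff_0_iff)
  obtain T :: "'a alg_closure \<Rightarrow> 'a" where T: "\<And>x y. T (x + y) = T x + T y"
    "\<And>c z. T (to_ac c * z) = c * T z" "T c = 1" using linear_functional_ac[OF c(1)] by blast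
  have T0: "T 0 = 0" using T(1)[of 0 0] by (metis add_cancel_right_right)
  have van: "vanishes F0 x' y' n (map_poly T A) (map_poly T B)"
    if "vanishes Fb (to_ac x') (to_ac y') n A B" for x' y' n
    by (rule vanishes_map[OF T(1) T(2) T(2) _ that]) (simp add: coeff_map_poly T(2) mult.commute[of _ "to_ac _"])
  show ?thesis
  proof (rule that)
    show "map_poly T A \<noteq> 0 \<or> map_poly T B \<noteq> 0"
      using c(2) T(3) T0 by (metis coeff_0 coeff_map_poly one_neq_zero)
    show "degree (map_poly T A) \<le> (\<Sum>i\<in>I. k i)"
      using AB(2) degree_map_poly_le[of T A, OF T0] by simp
    show "map_poly T B = 0 \<or> degree (map_poly T B) + 3 \<le> (\<Sum>i\<in>I. k i)"
      using AB(3) degree_map_poly_le[of T B, OF T0] by auto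
    fix i assume i: "i \<in> I"
    show "vanishes F0 (u i) (y i) (nat (e i + int (k i))) (map_poly T A) (map_poly T B)"
      by (rule van[OF AB(4)[OF i]])
    show "vanishes F0 (u i) (- y i) (k i) (map_poly T A) (map_poly T B)"
      using AB(5)[OF i] by (intro van) simp
  qed
qed

lemma rational_divisor_invariant:
  fixes u y :: "'i \<Rightarrow> 'a" and e :: "'i \<Rightarrow> int"
  assumes I: "finite I" and yF: "\<And>i. i \<in> I \<Longrightarrow> (y i)\<^sup>2 = poly F0 (u i)" and e: "(\<Sum>i\<in>I. e i) = 0"
  shows "(\<Sum>i\<in>I. frag_cmul (e i) (frag_of (Affine (to_ac (u i)) (to_ac (y i))))) \<in> invariant_divisors"
    (is "?D \<in> _")
proof -
  have Fu: "poly Fb (to_ac z) = to_ac (poly F0 z)" for z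
    by (induction F0) (simp_all add: map_poly_pCons)
  have P: "Affine (to_ac (u i)) (to_ac (y i)) \<in> curve_points Fb" if "i \<in> I" for i
    using yF[OF that] Fu by (auto simp: curve_points_def) (metis to_ac_power)
  have "Poly_Mapping.keys ?D \<subseteq> (\<Union>i\<in>I. Poly_Mapping.keys (frag_cmul (e i) (frag_of (Affine (to_ac (u i)) (to_ac (y i))))))"
    by (rule keys_sum)
  also have "\<dots> \<subseteq> curve_points Fb" using P by (auto simp: keys_frag_of dest!: subsetD[OF keys_cmul])
  finally have keys: "Poly_Mapping.keys ?D \<subseteq> curve_points Fb" .
  have deg1: "divisor_degree (frag_cmul n (frag_of Q)) = n" for n and Q :: "'a alg_closure point"
    using divisor_degree_superset[of "{Q}" "frag_cmul n (frag_of Q)"] keys_cmul[of n "frag_of Q"]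
    by (simp add: keys_frag_of)
  have deg0: "divisor_degree 0 = 0" by (simp add: divisor_degree_def)
  have "divisor_degree ?D = (\<Sum>i\<in>I. e i)"
    using I by (induction I rule: finite_induct) (simp_all add: deg0 divisor_degree_add deg1)
  moreover have "galois_divisor \<sigma> ?D = ?D" if \<sigma>: "\<sigma> \<in> absolute_galois" for \<sigma>
    using I by (induction I rule: finite_induct)
      (simp_all add: galois_divisor_def frag_extend_add frag_extend_cmul gal_base[OF \<sigma>])
  ultimately show ?thesis using keys e zero_principal by (simp add: invariant_divisors_def)
qed

end

section \<open>Degeneration at a place of the base field\<close>

lemma vanishes_smult:
  assumes "vanishes F x y n A B"
  shows "vanishes F x y n (smult c A) (smult c B)"
  unfolding smult_conv_map_poly
  by (rule vanishes_map[OF _ _ _ _ assms]) (simp_all add: algebra_simps)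

text \<open>
  The substitution \<open>u = rv\<close>, \<open>y = r\<^sup>3w\<close> turns \<open>y\<^sup>2 = F(u)\<close> into \<open>w\<^sup>2 = F(rv)/r\<^sup>6\<close>. It is used with \<open>r = \<rho>\<close>, which
  has a pole at the place of degeneration.
\<close>

lemma vanishes_rescale:
  fixes r :: "'k::field"
  assumes r: "r \<noteq> 0" and van: "vanishes F x y n A B"
  shows "vanishes (smult (1 / r ^ 6) (F \<circ>\<^sub>p [:0, r:])) (x / r) (y / r ^ 3) n
    (A \<circ>\<^sub>p [:0, r:]) (smult (r ^ 3) (B \<circ>\<^sub>p [:0, r:]))"
  using van
proof (induction n arbitrary: A B)
  case (Suc n)
  let ?s = "\<lambda>A. A \<circ>\<^sub>p [:0, r:]"
  from Suc.prems obtain C D where CD: "smult y A + B * F = [:- x, 1:] * C"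
    "A + smult y B = [:- x, 1:] * D" "vanishes F x y n C D" by auto
  have lin: "?s ([:- x, 1:] * C) = smult r ([:- (x / r), 1:] * ?s C)" for C
  proof -
    have "?s [:- x, 1:] = smult r [:- (x / r), 1:]" using r by (simp add: pcompose_pCons)
    then show ?thesis by (simp only: pcompose_mult mult_smult_left)
  qed
  have C: "smult y (?s A) + ?s B * ?s F = smult r ([:- (x / r), 1:] * ?s C)"
    using arg_cong[OF CD(1), of ?s] unfolding lin by (simp only: pcompose_add pcompose_smult pcompose_mult)
  have D: "?s A + smult y (?s B) = smult r ([:- (x / r), 1:] * ?s D)"
    using arg_cong[OF CD(2), of ?s] unfolding lin by (simp only: pcompose_add pcompose_smult)
  have "smult (y / r ^ 3) (?s A) + smult (r ^ 3) (?s B) * smult (1 / r ^ 6) (?s F) =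
      smult (1 / r ^ 3) (smult y (?s A) + ?s B * ?s F)"
    using r by (simp add: smult_add_right power3_eq_cube divide_simps eval_nat_numeral)
  also have "\<dots> = [:- (x / r), 1:] * smult (1 / r\<^sup>2) (?s C)"
    unfolding C using r by (simp add: mult_smult_right power3_eq_cube power2_eq_square del: mult_pCons_left)
  finally have 1: "smult (y / r ^ 3) (?s A) + smult (r ^ 3) (?s B) * smult (1 / r ^ 6) (?s F) =
      [:- (x / r), 1:] * smult (1 / r\<^sup>2) (?s C)" .
  have "?s A + smult (y / r ^ 3) (smult (r ^ 3) (?s B)) = ?s A + smult y (?s B)"
    using r by simp
  also have "\<dots> = [:- (x / r), 1:] * smult (1 / r\<^sup>2) (smult (r ^ 3) (?s D))"
    unfolding D using r by (simp add: mult_smult_right power3_eq_cube power2_eq_square del: mult_pCons_left)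
  finally have 2: "?s A + smult (y / r ^ 3) (smult (r ^ 3) (?s B)) =
      [:- (x / r), 1:] * smult (1 / r\<^sup>2) (smult (r ^ 3) (?s D))" .
  show ?case using 1 2 vanishes_smult[OF Suc.IH[OF CD(3)], of "1 / r\<^sup>2"] by (simp only: vanishes.simps) blast
qed simp

lemma linear_power_dvd_cancel:
  fixes p q :: "'b::field poly"
  assumes "[:- a, 1:] ^ n dvd p * q" "poly q a \<noteq> 0"
  shows "[:- a, 1:] ^ n dvd p"
proof (cases "p = 0")
  case False
  have "q \<noteq> 0" using assms(2) by auto
  then have "Polynomial.order a (p * q) = Polynomial.order a p"
    using False assms(2) by (simp add: order_mult order_0I)
  then show ?thesis using assms(1) False \<open>q \<noteq> 0\<close> by (simp add: order_divides)
qed simp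

lemma linear_powers_prod_dvd:
  fixes p :: "'b::field poly"
  assumes "finite I" "inj_on v I" "\<And>i. i \<in> I \<Longrightarrow> [:- v i, 1:] ^ n i dvd p"
  shows "(\<Prod>i\<in>I. [:- v i, 1:] ^ n i) dvd p"
  using assms
proof (induction I rule: finite_induct)
  case (insert j I)
  have "inj_on v I" "\<And>i. i \<in> I \<Longrightarrow> [:- v i, 1:] ^ n i dvd p" using insert.prems by auto
  then have "(\<Prod>i\<in>I. [:- v i, 1:] ^ n i) dvd p" by (rule insert.IH)
  then obtain q where q: "p = (\<Prod>i\<in>I. [:- v i, 1:] ^ n i) * q" by (rule dvdE)
  have "poly (\<Prod>i\<in>I. [:- v i, 1:] ^ n i) (v j) \<noteq> 0"
    using insert(1,2,4) by (auto simp: poly_prod inj_on_def)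
  moreover have "[:- v j, 1:] ^ n j dvd q * (\<Prod>i\<in>I. [:- v i, 1:] ^ n i)"
    using insert.prems(2)[of j] q by (simp add: mult.commute)
  ultimately have "[:- v j, 1:] ^ n j dvd q" using linear_power_dvd_cancel by blast
  then have "[:- v j, 1:] ^ n j * (\<Prod>i\<in>I. [:- v i, 1:] ^ n i) dvd q * (\<Prod>i\<in>I. [:- v i, 1:] ^ n i)"
    by (intro mult_dvd_mono dvd_refl)
  moreover have pq: "p = q * (\<Prod>i\<in>I. [:- v i, 1:] ^ n i)" by (subst mult.commute) (rule q)
  ultimately show ?case unfolding prod.insert[OF insert(1,2)] by simp
qed simp

text \<open>
  A valuation ring together with a homomorphism to a residue field. That of any two nonzero elements one
  divides the other is all that is needed to make polynomials primitive.
\<close>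

locale place =
  fixes vring :: "'a::field set" and sp :: "'a \<Rightarrow> 'b::field"
  assumes vring_1: "1 \<in> vring"
    and vring_add: "a \<in> vring \<Longrightarrow> b \<in> vring \<Longrightarrow> a + b \<in> vring"
    and vring_mult: "a \<in> vring \<Longrightarrow> b \<in> vring \<Longrightarrow> a * b \<in> vring"
    and vring_minus: "a \<in> vring \<Longrightarrow> - a \<in> vring"
    and sp_1: "sp 1 = 1"
    and sp_add: "a \<in> vring \<Longrightarrow> b \<in> vring \<Longrightarrow> sp (a + b) = sp a + sp b"
    and sp_mult: "a \<in> vring \<Longrightarrow> b \<in> vring \<Longrightarrow> sp (a * b) = sp a * sp b"
    and vring_inverse: "a \<notin> vring \<Longrightarrow> inverse a \<in> vring"
begin

lemma vring_0: "0 \<in> vring"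
  using vring_add[OF vring_1 vring_minus[OF vring_1]] by simp

lemma sp_0: "sp 0 = 0"
  using sp_add[OF vring_0 vring_0] by (metis add_cancel_right_right)

lemma sp_minus: "a \<in> vring \<Longrightarrow> sp (- a) = - sp a"
  using sp_add[of a "- a"] vring_minus[of a] sp_0 by (simp add: add_eq_0_iff)

lemma vring_sum: "(\<And>i. i \<in> I \<Longrightarrow> f i \<in> vring) \<Longrightarrow> sum f I \<in> vring \<and> sp (sum f I) = (\<Sum>i\<in>I. sp (f i))"
  by (induction I rule: infinite_finite_induct) (auto simp: vring_0 sp_0 vring_add sp_add)

definition integral :: "'a poly \<Rightarrow> bool" where
  "integral A \<longleftrightarrow> (\<forall>i. coeff A i \<in> vring)"

abbreviation red :: "'a poly \<Rightarrow> 'b poly" where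
  "red \<equiv> map_poly sp"

lemma integral_mult: "integral A \<Longrightarrow> integral B \<Longrightarrow> integral (A * B) \<and> red (A * B) = red A * red B"
proof -
  assume "integral A" "integral B"
  then have AB: "coeff A i \<in> vring" "coeff B i \<in> vring" for i by (auto simp: integral_def)
  then have "coeff (A * B) n \<in> vring \<and> sp (coeff (A * B) n) = coeff (red A * red B) n" for n
    using vring_sum[of "{..n}" "\<lambda>i. coeff A i * coeff B (n - i)"] vring_mult
    by (simp add: coeff_mult coeff_map_poly sp_0 sp_mult)
  then show ?thesis by (auto simp: integral_def poly_eq_iff coeff_map_poly sp_0)
qed

lemma integral_add: "integral A \<Longrightarrow> integral B \<Longrightarrow> integral (A + B) \<and> red (A + B) = red A + red B"
  using vring_add sp_add by (auto simp: integral_def poly_eq_iff coeff_map_poly sp_0)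

lemma integral_smult: "c \<in> vring \<Longrightarrow> integral B \<Longrightarrow> integral (smult c B) \<and> red (smult c B) = smult (sp c) (red B)"
  using vring_mult sp_mult by (auto simp: integral_def poly_eq_iff coeff_map_poly sp_0)

lemma integral_0: "integral 0"
  by (simp add: integral_def vring_0)

lemma integral_pCons: "integral (pCons a A) \<longleftrightarrow> a \<in> vring \<and> integral A"
proof
  assume "integral (pCons a A)"
  then show "a \<in> vring \<and> integral A" unfolding integral_def by (metis coeff_pCons_0 coeff_pCons_Suc)
qed (auto simp: integral_def coeff_pCons split: nat.split)

lemma integral_poly: "integral A \<Longrightarrow> x \<in> vring \<Longrightarrow> poly A x \<in> vring"
  by (induction A) (auto simp: vring_0 integral_pCons vring_add vring_mult)

text \<open>
  Division by a monic linear polynomial is synthetic division and needs no denominators.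
\<close>

lemma integral_division:
  assumes "[:- x, 1:] * C = A" "integral A" "x \<in> vring"
  shows "integral C"
proof -
  have "A + smult x C = pCons 0 C" using assms(1) by (simp add: algebra_simps)
  then have "C = synthetic_div A x" using synthetic_div_unique by blast
  moreover have "integral (synthetic_div A x)" using assms(2,3)
    by (induction A) (auto simp: integral_pCons integral_poly integral_0)
  ultimately show ?thesis by simp
qed

lemma primitive_multiple:
  assumes "A \<noteq> 0 \<or> B \<noteq> 0"
  obtains c where "c \<noteq> 0" "integral (smult c A)" "integral (smult c B)"
    "red (smult c A) \<noteq> 0 \<or> red (smult c B) \<noteq> 0"
proof -
  have dom: "\<exists>s\<in>S. \<forall>t\<in>S. t / s \<in> vring" if "finite S" "S \<noteq> {}" "0 \<notin> S" for S
    using that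
  proof (induction S rule: finite_ne_induct)
    case (singleton s)
    then show ?case using vring_1 by simp
  next
    case (insert a S)
    then obtain s where s: "s \<in> S" "\<And>t. t \<in> S \<Longrightarrow> t / s \<in> vring" by auto
    have nz: "a \<noteq> 0" "s \<noteq> 0" using insert.prems s(1) by auto
    show ?case
    proof (cases "a / s \<in> vring")
      case True
      then show ?thesis using s by auto
    next
      case False
      then have "s / a \<in> vring" using vring_inverse by fastforce
      then have "t / a \<in> vring" if "t \<in> S" for t
        using vring_mult[OF s(2)[OF that], of "s / a"] nz by simp
      then show ?thesis using nz vring_1 by auto
    qed
  qed
  define S where "S = {c. c \<noteq> 0 \<and> (c \<in> range (coeff A) \<or> c \<in> range (coeff B))}"
  have "S \<subseteq> set (coeffs A) \<union> set (coeffs B)"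
    by (auto simp: S_def range_coeff)
  then have "finite S" by (rule finite_subset) simp
  moreover have "S \<noteq> {}"
  proof -
    have "lead_coeff A \<in> S \<or> lead_coeff B \<in> S" using assms by (auto simp: S_def)
    then show ?thesis by blast
  qed
  moreover have "0 \<notin> S" by (simp add: S_def)
  ultimately have "\<exists>s\<in>S. \<forall>t\<in>S. t / s \<in> vring" by (rule dom)
  then obtain s where s: "s \<in> S" "\<And>t. t \<in> S \<Longrightarrow> t / s \<in> vring" by blast
  have s0: "s \<noteq> 0" using s(1) by (simp add: S_def)
  have div: "t / s \<in> vring" if "t \<in> range (coeff A) \<or> t \<in> range (coeff B)" for t
  proof (cases "t = 0")
    case False
    then show ?thesis using s(2)[of t] that unfolding S_def by blast
  qed (simp add: vring_0)
  have c: "inverse s * coeff A i \<in> vring" "inverse s * coeff B i \<in> vring" for i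
    using div[of "coeff A i"] div[of "coeff B i"]
    unfolding divide_inverse by (simp_all add: mult.commute[of "inverse s"])
  have "red (smult (inverse s) A) \<noteq> 0 \<or> red (smult (inverse s) B) \<noteq> 0"
  proof -
    obtain i where "s = coeff A i \<or> s = coeff B i" using s(1) by (auto simp: S_def)
    then have "coeff (red (smult (inverse s) A)) i = 1 \<or> coeff (red (smult (inverse s) B)) i = 1"
      using s0 by (auto simp: coeff_map_poly sp_0 sp_1)
    then show ?thesis by auto
  qed
  then show ?thesis using that[of "inverse s"] s0 c by (simp add: integral_def)
qed

text \<open>
  On the component \<open>w = h(v)\<close> of the special fibre one division step reads
  \<open>(A + Bh)(h + w\<^sub>0) = (v - v\<^sub>0)(C + Dh)\<close>. Since \<open>h + w\<^sub>0\<close> has the value \<open>2w\<^sub>0 \<noteq> 0\<close> at \<open>v\<^sub>0\<close>, each step contributes a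
  factor \<open>v - v\<^sub>0\<close> to the restriction \<open>A + Bh\<close>.
\<close>

lemma vanishes_reduce:
  assumes F: "integral F" "red F = h\<^sup>2" and x: "x \<in> vring" and y: "y \<in> vring" "sp y = poly h (sp x)"
    and y0: "2 * sp y \<noteq> 0"
    and AB: "integral A" "integral B" and van: "vanishes F x y n A B"
  shows "[:- sp x, 1:] ^ n dvd red A + red B * h"
  using AB van
proof (induction n arbitrary: A B)
  case (Suc n)
  from Suc.prems obtain C D where CD: "smult y A + B * F = [:- x, 1:] * C"
    "A + smult y B = [:- x, 1:] * D" "vanishes F x y n C D" by auto
  let ?l = "[:- sp x, 1:]"
  have L: "integral [:- x, 1:]" "red [:- x, 1:] = ?l"
    using x vring_1 vring_minus[OF x] by (simp_all add: integral_pCons integral_0 map_poly_pCons sp_0 sp_1 sp_minus)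
  have 1: "integral (smult y A + B * F)" "red (smult y A + B * F) = smult (sp y) (red A) + red B * h\<^sup>2"
    and 2: "integral (A + smult y B)" "red (A + smult y B) = red A + smult (sp y) (red B)"
    using integral_smult[OF y(1)] Suc.prems(1,2) F integral_add integral_mult by simp_all
  have C: "integral C" and D: "integral D"
    using integral_division[OF CD(1)[symmetric] 1(1) x] integral_division[OF CD(2)[symmetric] 2(1) x] .
  have 3: "smult (sp y) (red A) + red B * h\<^sup>2 = ?l * red C" "red A + smult (sp y) (red B) = ?l * red D"
    using 1(2) 2(2) integral_mult[OF L(1) C] integral_mult[OF L(1) D] unfolding L(2) CD(1,2) by simp_all
  have "(red A + red B * h) * (h + [:sp y:]) =
      (smult (sp y) (red A) + red B * h\<^sup>2) + (red A + smult (sp y) (red B)) * h"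
    by (simp add: algebra_simps power2_eq_square)
  also have "\<dots> = ?l * (red C + red D * h)" unfolding 3 by (simp only: algebra_simps)
  finally have "?l ^ Suc n dvd (red A + red B * h) * (h + [:sp y:])"
    using Suc.IH[OF C D CD(3)] by (simp only: power_Suc mult_dvd_mono dvd_refl)
  moreover have "poly (h + [:sp y:]) (sp x) \<noteq> 0" using y0 y(2) by simp
  ultimately show ?case by (rule linear_power_dvd_cancel)
qed simp

text \<open>
  The restrictions \<open>A \<plusminus> Bh\<close> of a primitive solution to the two components have degree at most \<open>\<Sum>k\<^sub>i\<close>, and
  this is also the number of their prescribed zeros; so each is a constant times a known product. They
  agree at the nodes \<open>h = 0\<close>, where the products do not vanish. If there is a node and one constant
  vanishes, so does the other, and then both reductions vanish, against primitivity.
\<close>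

lemma node_relation:
  fixes u y :: "'i \<Rightarrow> 'a" and e :: "'i \<Rightarrow> int" and k :: "'i \<Rightarrow> nat"
  assumes F: "integral F" "red F = h\<^sup>2" and h: "h \<noteq> 0" "degree h \<le> 3" and two: "(2::'b) \<noteq> 0"
    and I: "finite I" and inj: "inj_on (\<lambda>i. sp (u i)) I"
    and u: "\<And>i. i \<in> I \<Longrightarrow> u i \<in> vring" and y: "\<And>i. i \<in> I \<Longrightarrow> y i \<in> vring"
    and yh: "\<And>i. i \<in> I \<Longrightarrow> sp (y i) = poly h (sp (u i))" and y0: "\<And>i. i \<in> I \<Longrightarrow> sp (y i) \<noteq> 0"
    and k: "\<And>i. i \<in> I \<Longrightarrow> e i + int (k i) \<ge> 0" and e: "(\<Sum>i\<in>I. e i) = 0"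
    and AB: "A \<noteq> 0 \<or> B \<noteq> 0" "degree A \<le> (\<Sum>i\<in>I. k i)" "B = 0 \<or> degree B + 3 \<le> (\<Sum>i\<in>I. k i)"
    and van: "\<And>i. i \<in> I \<Longrightarrow> vanishes F (u i) (y i) (nat (e i + int (k i))) A B"
      "\<And>i. i \<in> I \<Longrightarrow> vanishes F (u i) (- y i) (k i) A B"
  shows "\<exists>c. c \<noteq> 0 \<and> (\<forall>\<xi>. poly h \<xi> = 0 \<longrightarrow> (\<Prod>i\<in>I. (\<xi> - sp (u i)) powi e i) = c)"
proof -
  define N where "N = (\<Sum>i\<in>I. k i)"
  define n where "n i = nat (e i + int (k i))" for i
  have sn: "(\<Sum>i\<in>I. n i) = N"
  proof -
    have "int (\<Sum>i\<in>I. n i) = (\<Sum>i\<in>I. e i + int (k i))" using k by (simp add: n_def)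
    then show ?thesis using e by (simp add: sum.distrib N_def flip: of_nat_sum)
  qed
  obtain c where c: "c \<noteq> 0" "integral (smult c A)" "integral (smult c B)"
    "red (smult c A) \<noteq> 0 \<or> red (smult c B) \<noteq> 0" using primitive_multiple[OF AB(1)] .
  define a b where "a = red (smult c A)" and "b = red (smult c B)"
  have deg: "degree a \<le> N" "degree (b * h) \<le> N"
  proof -
    show "degree a \<le> N" unfolding a_def N_def
      using degree_map_poly_le[of sp "smult c A", OF sp_0] AB(2) degree_smult_le[of c A] by linarith
    show "degree (b * h) \<le> N"
    proof (cases "B = 0")
      case False
      have "degree b \<le> degree B" unfolding b_def
        using degree_map_poly_le[of sp "smult c B", OF sp_0] degree_smult_le[of c B] by linarith
      then show ?thesis using degree_mult_le[of b h] h(2) AB(3) False unfolding N_def by linarith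
    qed (simp add: b_def)
  qed
  have prod: "\<exists>t. g = smult t (\<Prod>i\<in>I. [:- sp (u i), 1:] ^ m i)"
    if "degree g \<le> N" "(\<Sum>i\<in>I. m i) = N" "\<And>i. i \<in> I \<Longrightarrow> [:- sp (u i), 1:] ^ m i dvd g" for g m
  proof -
    let ?p = "\<Prod>i\<in>I. [:- sp (u i), 1:] ^ m i"
    have p0: "?p \<noteq> 0" using I by (simp add: prod_zero_iff)
    have "degree ?p = (\<Sum>i\<in>I. degree ([:- sp (u i), 1:] ^ m i))"
      by (rule degree_prod_eq_sum_degree) simp
    then have dp: "degree ?p = N" using that(2) by (simp add: degree_linear_power)
    have "?p dvd g" by (rule linear_powers_prod_dvd[OF I inj that(3)])
    then obtain q where q: "g = ?p * q" by (rule dvdE)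
    show ?thesis
    proof (cases "q = 0")
      case False
      then have "degree q = 0" using that(1) dp p0 unfolding q by (simp add: degree_mult_eq)
      then obtain t where "q = [:t:]" by (rule degree_eq_zeroE)
      then show ?thesis unfolding q by (auto simp: mult.commute)
    qed (auto simp: q)
  qed
  have d1: "[:- sp (u i), 1:] ^ n i dvd a + b * h" if i: "i \<in> I" for i
    unfolding a_def b_def n_def
    using two y0[OF i] by (intro vanishes_reduce[OF F u[OF i] y[OF i] yh[OF i] _ c(2,3)] vanishes_smult van(1)[OF i]) simp
  obtain c1 where c1: "a + b * h = smult c1 (\<Prod>i\<in>I. [:- sp (u i), 1:] ^ n i)"
    using prod[OF degree_add_le[OF deg] sn d1] by blast
  have F': "red F = (- h)\<^sup>2" using F(2) by simp
  have d2: "[:- sp (u i), 1:] ^ k i dvd a + b * (- h)" if i: "i \<in> I" for i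
    unfolding a_def b_def
    using two y0[OF i] y[OF i] yh[OF i] sp_minus[OF y[OF i]]
    by (intro vanishes_reduce[OF F(1) F' u[OF i] vring_minus[OF y[OF i]] _ _ c(2,3)] vanishes_smult van(2)[OF i]) simp_all
  then have d2': "[:- sp (u i), 1:] ^ k i dvd a - b * h" if "i \<in> I" for i using that by simp
  obtain c2 where c2: "a - b * h = smult c2 (\<Prod>i\<in>I. [:- sp (u i), 1:] ^ k i)"
    using prod[OF degree_diff_le[OF deg] N_def[symmetric] d2'] by blast
  have nz: "c1 \<noteq> 0 \<or> c2 \<noteq> 0"
  proof (rule ccontr)
    assume "\<not> ?thesis"
    then have z: "a + b * h = 0" "a - b * h = 0" using c1 c2 by auto
    have "smult (1 + 1) a = (a + b * h) + (a - b * h)" by (simp only: smult_add_left smult_1_left) simp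
    then have "smult 2 a = 0" unfolding z one_add_one by simp
    then have "a = 0" using two by simp
    moreover from this have "b = 0" using z(1) h(1) by simp
    ultimately show False using c(4) unfolding a_def b_def by blast
  qed
  have node: "c1 * (\<Prod>i\<in>I. (\<xi> - sp (u i)) powi e i) = c2 \<and> (\<Prod>i\<in>I. (\<xi> - sp (u i)) powi e i) \<noteq> 0"
    if "poly h \<xi> = 0" for \<xi>
  proof -
    have x: "\<xi> - sp (u i) \<noteq> 0" if "i \<in> I" for i using yh[OF that] y0[OF that] \<open>poly h \<xi> = 0\<close> by auto
    have "poly (a + b * h) \<xi> = poly (a - b * h) \<xi>" using that by simp
    then have "c1 * (\<Prod>i\<in>I. (\<xi> - sp (u i)) ^ n i) = c2 * (\<Prod>i\<in>I. (\<xi> - sp (u i)) ^ k i)"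
      unfolding c1 c2 by (simp add: poly_prod)
    also have "(\<Prod>i\<in>I. (\<xi> - sp (u i)) ^ n i) =
        (\<Prod>i\<in>I. (\<xi> - sp (u i)) powi e i) * (\<Prod>i\<in>I. (\<xi> - sp (u i)) ^ k i)"
      unfolding prod.distrib[symmetric]
    proof (rule prod.cong[OF refl])
      fix i assume i: "i \<in> I"
      have "(\<xi> - sp (u i)) ^ n i = (\<xi> - sp (u i)) powi (e i + int (k i))"
        using k[OF i] by (simp add: n_def power_int_def)
      then show "(\<xi> - sp (u i)) ^ n i = (\<xi> - sp (u i)) powi e i * (\<xi> - sp (u i)) ^ k i"
        using x[OF i] by (simp add: power_int_add)
    qed
    finally show ?thesis using x I by (simp add: prod_zero_iff)
  qed
  show ?thesis
  proof (cases "\<exists>\<xi>. poly h \<xi> = 0")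
    case True
    then obtain \<zeta> where "poly h \<zeta> = 0" by blast
    then have "c1 \<noteq> 0" "c2 \<noteq> 0" using node nz by auto
    then show ?thesis using node by (intro exI[of _ "c2 / c1"]) (auto simp: field_simps)
  qed (auto intro: exI[of _ 1])
qed

end

section \<open>Separability of the base family\<close>

lemma Q_poly_eval: "poly (Q_poly \<rho>) x = x\<^sup>2 - 2 * (1 - \<rho>) * x - (1 - \<rho>) * (1 + \<rho>)"
  by (simp add: Q_poly_def algebra_simps power2_eq_square)

lemma S_poly_eval: "poly (S_poly \<rho>) x = x ^ 4 + 2 * (1 - \<rho>) * x ^ 3 + (1 - \<rho>) * (3 - 5 * \<rho>) * x\<^sup>2
    - 4 * (1 - \<rho>)\<^sup>2 * (1 + \<rho>) * x - 4 * (1 - \<rho>) ^ 3 * (1 + \<rho>)"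
  by (simp add: S_poly_def algebra_simps eval_nat_numeral)

lemma pderiv_Q_poly_eval: "poly (pderiv (Q_poly \<rho>)) x = 2 * x - 2 * (1 - \<rho>)"
  by (simp add: Q_poly_def pderiv_pCons algebra_simps)

lemma pderiv_S_poly_eval: "poly (pderiv (S_poly \<rho>)) x = 4 * x ^ 3 + 6 * (1 - \<rho>) * x\<^sup>2
    + 2 * (1 - \<rho>) * (3 - 5 * \<rho>) * x - 4 * (1 - \<rho>)\<^sup>2 * (1 + \<rho>)"
  by (simp add: S_poly_def pderiv_pCons algebra_simps eval_nat_numeral)

text \<open>
  Common roots of \<open>Q\<close> and \<open>S\<close> and multiple roots of \<open>S\<close> are eliminated by hand, in terms of
  \<open>\<epsilon> = 1 - \<rho>\<close> and \<open>t = 1 + \<rho>\<close>, in which \<open>Q\<close>, \<open>S\<close> and \<open>S'\<close> are homogeneous. Each of the four excluded values of \<open>\<rho>\<close>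
  is a zero of the discriminant.
\<close>

lemma F_poly_separable:
  fixes \<rho> x :: "'a::field_char_0"
  assumes \<rho>: "\<rho> \<noteq> 1" "\<rho> \<noteq> - 1" "\<rho> \<noteq> 1 / 2" "\<rho> \<noteq> 47 / 49" and F: "poly (F_poly \<rho>) x = 0"
  shows "poly (pderiv (F_poly \<rho>)) x \<noteq> 0"
proof
  assume F': "poly (pderiv (F_poly \<rho>)) x = 0"
  define \<epsilon> where "\<epsilon> = 1 - \<rho>"
  define t where "t = 1 + \<rho>"
  have et: "\<epsilon> + t = 2" "\<epsilon> \<noteq> 0" "t \<noteq> 0" using \<rho>(1,2)
    by (auto simp: \<epsilon>_def t_def add_eq_0_iff)
  have 35: "3 - 5 * \<rho> = 4 * \<epsilon> - t" by (simp add: \<epsilon>_def t_def)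
  define Q where "Q = x\<^sup>2 - 2 * \<epsilon> * x - \<epsilon> * t"
  define S where "S = x ^ 4 + 2 * \<epsilon> * x ^ 3 + \<epsilon> * (4 * \<epsilon> - t) * x\<^sup>2 - 4 * \<epsilon>\<^sup>2 * t * x - 4 * \<epsilon> ^ 3 * t"
  define S' where "S' = 4 * x ^ 3 + 6 * \<epsilon> * x\<^sup>2 + 2 * \<epsilon> * (4 * \<epsilon> - t) * x - 4 * \<epsilon>\<^sup>2 * t"
  have e: "poly (Q_poly \<rho>) x = Q" "poly (S_poly \<rho>) x = S" "poly (pderiv (S_poly \<rho>)) x = S'"
    "poly (pderiv (Q_poly \<rho>)) x = 2 * x - 2 * \<epsilon>"
    unfolding Q_poly_eval S_poly_eval pderiv_Q_poly_eval pderiv_S_poly_eval Q_def S_def S'_def 35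
    by (simp_all add: \<epsilon>_def t_def)
  have QS: "Q * S = 0" using F by (simp add: F_poly_def e)
  have QS': "Q * S' + S * (2 * x - 2 * \<epsilon>) = 0" using F' by (simp add: F_poly_def pderiv_mult e algebra_simps)
  have no_common: False if "Q = 0" "S = 0"
  proof -
    \<comment> \<open>By division of \<open>S\<close> by \<open>Q\<close>; the remainder is linear in \<open>x\<close>, so a common root would be \<open>-t/3\<close>.\<close>
    have "S = Q * (x\<^sup>2 + 4 * \<epsilon> * x + 12 * \<epsilon>\<^sup>2) + 8 * \<epsilon> ^ 3 * (3 * x + t)"
      unfolding Q_def S_def by (simp add: algebra_simps eval_nat_numeral)
    then have "3 * x + t = 0" using that et(2) by simp
    then have x: "t = - 3 * x" by (simp add: add_eq_0_iff)
    have "t * (t - 3 * \<epsilon>) = 9 * Q" unfolding Q_def x by (simp add: algebra_simps power2_eq_square)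
    then have "t = 3 * \<epsilon>" using that et(3) by simp
    then have "4 * \<epsilon> = 2" using et(1) by simp
    then show False using \<rho>(3) by (simp add: \<epsilon>_def field_simps)
  qed
  show False
  proof (cases "Q = 0")
    case True
    then have "x = \<epsilon>" using QS' no_common by auto
    then have "Q = - \<epsilon> * (\<epsilon> + t)" by (simp add: Q_def algebra_simps power2_eq_square)
    then show False using True et by simp
  next
    case False
    then have SS: "S = 0" "S' = 0" using QS QS' by auto
    \<comment> \<open>After dehomogenizing, both equations are linear in \<open>\<tau> = t/\<epsilon>\<close>. Eliminating \<open>\<tau>\<close> leaves
      \<open>z(z + 4)(z\<^sup>2 + z + 2) = 0\<close>, and each factor determines \<open>\<tau>\<close>.\<close>
    define z where "z = x / \<epsilon>"
    define \<tau> where "\<tau> = t / \<epsilon>"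
    have x: "x = \<epsilon> * z" and t: "t = \<epsilon> * \<tau>" using et(2) by (simp_all add: z_def \<tau>_def)
    have "S = \<epsilon> ^ 4 * (z ^ 4 + 2 * z ^ 3 + 4 * z\<^sup>2 - \<tau> * (z + 2)\<^sup>2)"
      unfolding S_def x t by (simp add: algebra_simps eval_nat_numeral)
    then have 1: "z ^ 4 + 2 * z ^ 3 + 4 * z\<^sup>2 = \<tau> * (z + 2)\<^sup>2" using SS et(2) by simp
    have "S' = 2 * \<epsilon> ^ 3 * (2 * z ^ 3 + 3 * z\<^sup>2 + 4 * z - \<tau> * (z + 2))"
      unfolding S'_def x t by (simp add: algebra_simps eval_nat_numeral)
    then have 2: "2 * z ^ 3 + 3 * z\<^sup>2 + 4 * z = \<tau> * (z + 2)" using SS et(2) by simp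
    have "z * (z + 4) * (z\<^sup>2 + z + 2) = (2 * z ^ 3 + 3 * z\<^sup>2 + 4 * z) * (z + 2) - (z ^ 4 + 2 * z ^ 3 + 4 * z\<^sup>2)"
      by (simp add: algebra_simps eval_nat_numeral)
    also have "\<dots> = 0" unfolding 1 2 by (simp add: power2_eq_square)
    finally consider "z = 0" | "z = - 4" | "z\<^sup>2 + z + 2 = 0" by (auto simp: add_eq_0_iff2)
    then show False
    proof cases
      case 1
      then have "\<tau> = 0" using 2 by simp
      then show False using t et(3) by simp
    next
      case 2
      then have "\<tau> = 48" using \<open>2 * z ^ 3 + 3 * z\<^sup>2 + 4 * z = \<tau> * (z + 2)\<close> by simp
      then have "t = 48 * \<epsilon>" using t by simp
      then show False using \<rho>(4) by (simp add: \<epsilon>_def t_def field_simps)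
    next
      case 3
      have "2 * z ^ 3 + 3 * z\<^sup>2 + 4 * z = (2 * z + 1) * (z\<^sup>2 + z + 2) - (z + 2)"
        by (simp add: algebra_simps eval_nat_numeral)
      then have "\<tau> * (z + 2) + (z + 2) = 0" unfolding 2 3 by simp
      then have "(\<tau> + 1) * (z + 2) = 0" by (simp only: distrib_right mult_1_left)
      moreover have "z + 2 \<noteq> 0" using 3 by (auto simp: add_eq_0_iff2)
      ultimately have "\<tau> = - 1" by (simp add: add_eq_0_iff2)
      then show False using t et by simp
    qed
  qed
qed

lemma degree_F_poly: "degree (F_poly \<rho>) = 6"
proof -
  have "degree (Q_poly \<rho>) = 2" "degree (S_poly \<rho>) = 4" by (simp_all add: Q_poly_def S_poly_def)
  moreover from this have "Q_poly \<rho> \<noteq> 0" "S_poly \<rho> \<noteq> 0" by auto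
  ultimately show ?thesis by (simp add: F_poly_def degree_mult_eq)
qed

lemma map_poly_to_ac_F_poly: "map_poly to_ac (F_poly \<rho>) = F_poly (to_ac \<rho>)"
  by (simp add: F_poly_def map_poly_multiplicative Q_poly_def S_poly_def map_poly_pCons)

section \<open>The place of the base field at a square root of -7\<close>

definition s7 :: complex where
  "s7 = Complex 0 (sqrt 7)"

lemma s7_squared: "s7 * s7 = - 7"
  by (simp add: s7_def complex_eq_iff)

definition at_s7 :: "rat poly \<Rightarrow> complex" where
  "at_s7 p = poly (map_poly of_rat p) s7"

lemma at_s7_0 [simp]: "at_s7 0 = 0" and at_s7_1 [simp]: "at_s7 1 = 1"
  by (simp_all add: at_s7_def)

lemma at_s7_add: "at_s7 (p + q) = at_s7 p + at_s7 q"
  by (simp add: at_s7_def map_poly_additive of_rat_add)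

lemma at_s7_mult: "at_s7 (p * q) = at_s7 p * at_s7 q"
  by (simp add: at_s7_def map_poly_multiplicative of_rat_add of_rat_mult)

lemma at_s7_nonzero: "at_s7 q \<noteq> 0 \<Longrightarrow> q \<noteq> 0" by auto

definition place_ring :: "rat_fun set" where
  "place_ring = {x. \<exists>p q. x = Fract p q \<and> at_s7 q \<noteq> 0}"

definition spec :: "rat_fun \<Rightarrow> complex" where
  "spec x = (THE z. \<exists>p q. x = Fract p q \<and> at_s7 q \<noteq> 0 \<and> z = at_s7 p / at_s7 q)"

text \<open>
  A rational function is regular at \<open>s7\<close> if it has some representation whose denominator does not vanish
  there; its value does not depend on the representation.
\<close>

lemma spec_Fract:
  assumes "at_s7 q \<noteq> 0"
  shows "spec (Fract p q) = at_s7 p / at_s7 q"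
  unfolding spec_def
proof (rule the_equality)
  fix z assume "\<exists>p' q'. Fract p q = Fract p' q' \<and> at_s7 q' \<noteq> 0 \<and> z = at_s7 p' / at_s7 q'"
  then obtain p' q' where pq: "Fract p q = Fract p' q'" "at_s7 q' \<noteq> 0" "z = at_s7 p' / at_s7 q'" by blast
  then have "p * q' = p' * q" using assms at_s7_nonzero by (simp add: eq_fract)
  then have "at_s7 p * at_s7 q' = at_s7 p' * at_s7 q" by (metis at_s7_mult)
  then show "z = at_s7 p / at_s7 q" unfolding pq(3) using pq(2) assms by (simp add: frac_eq_eq)
qed (use assms in blast)

lemma spec_ringE:
  assumes "x \<in> place_ring" obtains p q where "x = Fract p q" "at_s7 q \<noteq> 0"
  using assms unfolding place_ring_def by blast

lemma spec_ringI: "at_s7 q \<noteq> 0 \<Longrightarrow> Fract p q \<in> place_ring"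
  unfolding place_ring_def by blast

interpretation pl: place place_ring spec
proof
  fix a b :: rat_fun
  show "1 \<in> place_ring" "spec 1 = 1"
    using spec_ringI[of 1 1] spec_Fract[of 1 1] by (simp_all add: One_fract_def)
  show "a \<notin> place_ring \<Longrightarrow> inverse a \<in> place_ring"
  proof -
    assume a: "a \<notin> place_ring"
    obtain p q where pq: "a = Fract p q" "q \<noteq> 0" by (cases a)
    \<comment> \<open>In lowest terms numerator and denominator do not both vanish, by Bezout's identity.\<close>
    define g where "g = gcd p q"
    have g: "g \<noteq> 0" using pq(2) by (simp add: g_def)
    obtain p' q' where p': "p = g * p'" "q = g * q'" unfolding g_def by (meson dvdE gcd_dvd1 gcd_dvd2)
    have a': "a = Fract p' q'" using pq p' g by (simp add: mult_fract_cancel)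
    obtain c d where "c * p + d * q = g"
      using bezout_coefficients_fst_snd[of p q] unfolding g_def by blast
    then have "g * (c * p' + d * q') = g * 1" unfolding p' by (simp add: algebra_simps)
    then have "c * p' + d * q' = 1" using g by (metis mult_left_cancel)
    then have "at_s7 c * at_s7 p' + at_s7 d * at_s7 q' = 1" by (metis at_s7_1 at_s7_add at_s7_mult)
    moreover have "at_s7 q' = 0" using a a' spec_ringI by blast
    ultimately have "at_s7 p' \<noteq> 0" by auto
    then show "inverse a \<in> place_ring" unfolding a' inverse_fract by (rule spec_ringI)
  qed
  assume a: "a \<in> place_ring"
  then obtain p q where pq: "a = Fract p q" "at_s7 q \<noteq> 0" by (rule spec_ringE)
  show "- a \<in> place_ring" unfolding pq(1) minus_fract by (rule spec_ringI[OF pq(2)])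
  assume b: "b \<in> place_ring"
  then obtain p' q' where pq': "b = Fract p' q'" "at_s7 q' \<noteq> 0" by (rule spec_ringE)
  have qq: "at_s7 (q * q') \<noteq> 0" "q \<noteq> 0" "q' \<noteq> 0" using pq(2) pq'(2) by (auto simp: at_s7_mult)
  have ab: "a + b = Fract (p * q' + p' * q) (q * q')" "a * b = Fract (p * p') (q * q')"
    unfolding pq(1) pq'(1) using qq by simp_all
  show "a + b \<in> place_ring" "a * b \<in> place_ring" unfolding ab by (rule spec_ringI[OF qq(1)])+
  show "spec (a + b) = spec a + spec b" "spec (a * b) = spec a * spec b"
    unfolding ab unfolding pq(1) pq'(1) spec_Fract[OF qq(1)] spec_Fract[OF pq(2)] spec_Fract[OF pq'(2)]
    unfolding at_s7_mult at_s7_add add_frac_eq[OF pq(2) pq'(2)] times_divide_times_eq by simp_all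
qed

text \<open>
  Regularity and value in a single relation, so that the value of an explicit expression is derived
  by introduction rules along its syntax.
\<close>

definition specializes :: "rat_fun \<Rightarrow> complex \<Rightarrow> bool" (infix "\<leadsto>" 50) where
  "x \<leadsto> z \<longleftrightarrow> x \<in> place_ring \<and> spec x = z"

lemma specializes_add: "x \<leadsto> z \<Longrightarrow> x' \<leadsto> z' \<Longrightarrow> x + x' \<leadsto> z + z'"
  by (simp add: specializes_def pl.vring_add pl.sp_add)

lemma specializes_mult: "x \<leadsto> z \<Longrightarrow> x' \<leadsto> z' \<Longrightarrow> x * x' \<leadsto> z * z'"
  by (simp add: specializes_def pl.vring_mult pl.sp_mult)

lemma specializes_minus: "x \<leadsto> z \<Longrightarrow> - x \<leadsto> - z"
  by (simp add: specializes_def pl.vring_minus pl.sp_minus)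

lemma specializes_diff: "x \<leadsto> z \<Longrightarrow> x' \<leadsto> z' \<Longrightarrow> x - x' \<leadsto> z - z'"
  using specializes_add[of x z "- x'" "- z'"] specializes_minus by simp

lemma specializes_1: "1 \<leadsto> 1" and specializes_0: "0 \<leadsto> 0"
  by (simp_all add: specializes_def pl.vring_1 pl.sp_1 pl.vring_0 pl.sp_0)

lemma specializes_of_nat: "of_nat n \<leadsto> of_nat n"
  by (induction n) (auto intro: specializes_add specializes_1 specializes_0)

lemma specializes_numeral: "numeral n \<leadsto> numeral n"
  using specializes_of_nat[of "numeral n"] by simp

lemma specializes_power: "x \<leadsto> z \<Longrightarrow> x ^ n \<leadsto> z ^ n"
  by (induction n) (auto intro: specializes_mult specializes_1)

lemma specializes_inverse: "x \<leadsto> z \<Longrightarrow> z \<noteq> 0 \<Longrightarrow> inverse x \<leadsto> inverse z"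
proof -
  assume x: "x \<leadsto> z" "z \<noteq> 0"
  then obtain p q where pq: "x = Fract p q" "at_s7 q \<noteq> 0" unfolding specializes_def by (auto elim: spec_ringE)
  then have z: "z = at_s7 p / at_s7 q" using x(1) spec_Fract by (simp add: specializes_def)
  then have "at_s7 p \<noteq> 0" using x(2) by auto
  then show ?thesis unfolding specializes_def pq(1) z inverse_fract
    by (auto intro: spec_ringI simp: spec_Fract)
qed

lemma specializes_divide: "x \<leadsto> z \<Longrightarrow> x' \<leadsto> z' \<Longrightarrow> z' \<noteq> 0 \<Longrightarrow> x / x' \<leadsto> z / z'"
  unfolding divide_inverse by (intro specializes_mult specializes_inverse)

lemmas specializes_intros = specializes_add specializes_mult specializes_minus specializes_diff
  specializes_1 specializes_0 specializes_numeral specializes_power specializes_divide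

lemma specializes_unique: "x \<leadsto> z \<Longrightarrow> x \<leadsto> w \<Longrightarrow> z = w"
  by (simp add: specializes_def)

lemma specializes_nonzero: "x \<leadsto> z \<Longrightarrow> z \<noteq> 0 \<Longrightarrow> x \<noteq> 0"
  using specializes_unique specializes_0 by blast

lemma specializes_var_m: "var_m \<leadsto> s7"
  unfolding specializes_def var_m_def
  using spec_ringI[of 1 "[:0, 1:]"] spec_Fract[of 1 "[:0, 1:]"] by (simp add: at_s7_def map_poly_pCons)

lemma residue_of_r_nonzero: "6 - 2 * s7 \<noteq> 0"
  by (simp add: s7_def complex_eq_iff)

lemma specializes_q: "var_m\<^sup>2 + 7 \<leadsto> 0"
  using specializes_add[OF specializes_power[OF specializes_var_m, of 2] specializes_numeral[of "Num.Bit1 (Num.Bit1 Num.One)"]]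
  by (simp add: power2_eq_square s7_squared)

lemma specializes_r: "6 - 2 * var_m \<leadsto> 6 - 2 * s7"
  by (intro specializes_intros specializes_var_m)

lemma r_nonzero: "6 - 2 * var_m \<noteq> 0"
  by (rule specializes_nonzero[OF specializes_r residue_of_r_nonzero])

lemma q_nonzero: "var_m\<^sup>2 + 7 \<noteq> 0"
proof -
  have "var_m\<^sup>2 + 7 = Fract [:7, 0, 1:] 1"
  proof -
    have "7 = Fract [:7:] (1 :: rat poly)"
      using of_nat_fract[of 7, where 'a = "rat poly"] by (simp add: numeral_poly)
    then have "var_m\<^sup>2 + 7 = Fract [:0, 1:] 1 * Fract [:0, 1:] 1 + Fract [:7:] 1"
      by (simp only: var_m_def power2_eq_square)
    then show ?thesis by simp
  qed
  then show ?thesis by (simp add: Zero_fract_def eq_fract)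
qed

section \<open>The special fibre of the base family\<close>

text \<open>
  The factors of the rescaled sextic, as polynomials in \<open>p = 1/\<rho>\<close>. They stay integral at \<open>p = 0\<close>.
\<close>

definition Q_inf :: "'a::field \<Rightarrow> 'a poly" where
  "Q_inf p = [: - (p - 1) * (p + 1), - 2 * (p - 1), 1 :]"

definition S_inf :: "'a::field \<Rightarrow> 'a poly" where
  "S_inf p = [: - 4 * (p - 1) ^ 3 * (p + 1), - 4 * (p - 1)\<^sup>2 * (p + 1), (p - 1) * (3 * p - 5), 2 * (p - 1), 1 :]"

lemma F_poly_rescale:
  fixes \<rho> :: "'a::field_char_0"
  assumes "\<rho> \<noteq> 0"
  shows "smult (1 / \<rho> ^ 6) (F_poly \<rho> \<circ>\<^sub>p [:0, \<rho>:]) = Q_inf (1 / \<rho>) * S_inf (1 / \<rho>)"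
proof -
  define p where "p = 1 / \<rho>"
  have pr: "\<rho> * p = 1" using assms by (simp add: p_def)
  have "Q_poly \<rho> \<circ>\<^sub>p [:0, \<rho>:] = smult (\<rho> ^ 2) (Q_inf p)"
  proof -
    have "\<rho>\<^sup>2 - 1 = \<rho>\<^sup>2 * (- (p - 1) * (p + 1))" "- 2 * (1 - \<rho>) * \<rho> = \<rho>\<^sup>2 * (- 2 * (p - 1))"
      using assms by (simp_all add: p_def field_simps power2_eq_square)
    then show ?thesis by (simp add: Q_poly_def Q_inf_def pcompose_pCons power2_eq_square algebra_simps)
  qed
  moreover have "S_poly \<rho> \<circ>\<^sub>p [:0, \<rho>:] = smult (\<rho> ^ 4) (S_inf p)"
  proof -
    have "1 - \<rho> = \<rho> * (p - 1)" "1 + \<rho> = \<rho> * (p + 1)" "3 - 5 * \<rho> = \<rho> * (3 * p - 5)"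
      using pr by (simp_all add: algebra_simps)
    then show ?thesis
      by (simp add: S_poly_def S_inf_def pcompose_pCons power_mult_distrib) (simp add: eval_nat_numeral)
  qed
  ultimately show ?thesis
    using assms by (simp add: F_poly_def pcompose_mult flip: p_def power_add)
qed

lemma rho_m_nonzero: "rho_m \<noteq> 0"
  using r_nonzero q_nonzero by (simp add: rho_m_def)

lemma inverse_rho_m: "1 / rho_m = (var_m\<^sup>2 + 7) / (6 - 2 * var_m)"
  by (simp add: rho_m_def)

lemma specializes_inverse_rho_m: "1 / rho_m \<leadsto> 0"
  unfolding inverse_rho_m using specializes_divide[OF specializes_q specializes_r residue_of_r_nonzero] by simp

text \<open>
  \<open>1/\<rho>\<close> vanishes at the chosen place, so \<open>\<rho>\<close> differs from every function with a finite nonzero value there.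
\<close>

lemma rho_m_neq:
  assumes "c \<leadsto> z" "z \<noteq> 0"
  shows "rho_m \<noteq> c"
proof
  assume "rho_m = c"
  then have "1 / rho_m \<leadsto> 1 / z" using specializes_divide[OF specializes_1 assms] by simp
  then have "1 / z = 0" using specializes_unique specializes_inverse_rho_m by blast
  then show False using assms(2) by simp
qed

lemma rho_m_generic: "rho_m \<noteq> 1" "rho_m \<noteq> - 1" "rho_m \<noteq> 1 / 2" "rho_m \<noteq> 47 / 49"
proof -
  show "rho_m \<noteq> 1" by (rule rho_m_neq[OF specializes_1]) simp
  show "rho_m \<noteq> - 1" by (rule rho_m_neq[OF specializes_minus[OF specializes_1]]) simp
  show "rho_m \<noteq> 1 / 2" by (rule rho_m_neq[OF specializes_divide[OF specializes_1 specializes_numeral]]) simp_all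
  show "rho_m \<noteq> 47 / 49" by (rule rho_m_neq[OF specializes_divide[OF specializes_numeral specializes_numeral]]) simp_all
qed

interpretation C: hyp_curve_over "F_poly rho_m"
proof (unfold_locales, unfold map_poly_to_ac_F_poly)
  show "degree (F_poly (to_ac rho_m)) = 6" by (rule degree_F_poly)
  have "to_ac rho_m \<noteq> 1" "to_ac rho_m \<noteq> - 1" "to_ac rho_m \<noteq> 1 / 2" "to_ac rho_m \<noteq> 47 / 49"
    using rho_m_generic by (metis to_ac_eq_iff to_ac_1 to_ac_minus to_ac_divide to_ac_numeral)+
  then show "poly (F_poly (to_ac rho_m)) z = 0 \<Longrightarrow> poly (pderiv (F_poly (to_ac rho_m))) z \<noteq> 0" for z
    by (rule F_poly_separable)
qed

section \<open>Three rational points and their independence\<close>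

definition pt_u :: "nat \<Rightarrow> rat_fun" where
  "pt_u i = (if i = 0 then 0 else if i = 1 then 4 * (var_m + 1) / (var_m\<^sup>2 + 7) else rho_m - 1)"

definition pt_y :: "nat \<Rightarrow> rat_fun" where
  "pt_y i = (if i = 0 then 2 * (1 - rho_m)\<^sup>2 * (1 + rho_m)
     else if i = 1 then - 2 * (var_m - 1) * (var_m + 1) ^ 4 * (var_m + 5) / (var_m\<^sup>2 + 7) ^ 3
     else (1 - rho_m)\<^sup>2 * (4 * rho_m - 2))"

text \<open>
  The point exists only after passing from \<open>\<rat>(\<rho>)\<close> to \<open>\<rat>(m)\<close>, where \<open>1 - \<rho> = (m + 1)\<^sup>2/(m\<^sup>2 + 7)\<close>. Up to
  constants \<open>Q(u)\<close> and \<open>S(u)\<close> are products of powers of \<open>m - 1\<close>, \<open>m + 1\<close>, \<open>m + 5\<close> and \<open>m\<^sup>2 + 7\<close>.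
\<close>

lemma second_point:
  fixes m q :: "'a::field_char_0"
  assumes q: "q = m\<^sup>2 + 7" "q \<noteq> 0"
  shows "(- 2 * (m - 1) * (m + 1) ^ 4 * (m + 5) / q ^ 3)\<^sup>2 = poly (F_poly ((6 - 2 * m) / q)) (4 * (m + 1) / q)"
proof -
  define \<rho> where "\<rho> = (6 - 2 * m) / q"
  define a where "a = 1 / q"
  have a: "(m\<^sup>2 + 7) * a = 1" using q by (simp add: a_def)
  have e: "1 - \<rho> = (m + 1)\<^sup>2 * a" "1 + \<rho> = (m\<^sup>2 - 2 * m + 13) * a" "3 - 5 * \<rho> = (3 * m\<^sup>2 + 10 * m - 9) * a"
    using q by (simp_all add: \<rho>_def a_def field_simps power2_eq_square)
  have x: "4 * (m + 1) / q = 4 * (m + 1) * a" by (simp add: a_def)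
  have "poly (Q_poly \<rho>) (4 * (m + 1) / q) = - ((m + 1) ^ 3 * (m + 5) * a\<^sup>2)"
    unfolding Q_poly_eval x e by (simp add: algebra_simps eval_nat_numeral)
  moreover have "poly (S_poly \<rho>) (4 * (m + 1) / q) = - (4 * (m - 1)\<^sup>2 * (m + 1) ^ 5 * (m + 5) * a ^ 4)"
    unfolding S_poly_eval x e by (simp add: algebra_simps eval_nat_numeral)
  moreover have mono: "(b ^ 3 * c * a\<^sup>2) * (4 * d\<^sup>2 * b ^ 5 * c * a ^ 4) = (- 2 * d * b ^ 4 * c * a ^ 3)\<^sup>2" for b c d
    by (simp add: eval_nat_numeral mult_ac)
  ultimately have "poly (F_poly \<rho>) (4 * (m + 1) / q) =
     ((m + 1) ^ 3 * (m + 5) * a\<^sup>2) * (4 * (m - 1)\<^sup>2 * (m + 1) ^ 5 * (m + 5) * a ^ 4)"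
    by (simp add: F_poly_def)
  also have "\<dots> = (- 2 * (m - 1) * (m + 1) ^ 4 * (m + 5) * a ^ 3)\<^sup>2"
    by (rule mono)
  finally show ?thesis by (simp add: \<rho>_def a_def power_one_over)
qed

lemma pt_on_curve: "(pt_y i)\<^sup>2 = poly (F_poly rho_m) (pt_u i)"
proof -
  have 0: "(2 * (1 - r)\<^sup>2 * (1 + r))\<^sup>2 = poly (F_poly r) 0" for r :: rat_fun
    unfolding F_poly_def poly_mult Q_poly_eval S_poly_eval by (simp add: algebra_simps eval_nat_numeral)
  have 2: "((1 - r)\<^sup>2 * (4 * r - 2))\<^sup>2 = poly (F_poly r) (r - 1)" for r :: rat_fun
    unfolding F_poly_def poly_mult Q_poly_eval S_poly_eval by (simp add: algebra_simps eval_nat_numeral)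
  show ?thesis
    unfolding pt_u_def pt_y_def using 0 2 second_point[OF refl q_nonzero, folded rho_m_def]
    by (auto simp only: split: if_split)
qed

text \<open>
  The coordinates of the three points on the component \<open>w = h(v)\<close> of the special fibre. The signs of the
  \<open>y\<close>-coordinates are chosen such that all three lie on this component.
\<close>

definition sp_u :: "nat \<Rightarrow> complex" where
  "sp_u i = (if i = 0 then 0 else if i = 1 then (s7 - 1) / 2 else 1)"

definition sp_y :: "nat \<Rightarrow> complex" where
  "sp_y i = (if i = 0 then 2 else 4)"

lemma specializes_pt_u: "pt_u i / rho_m \<leadsto> sp_u i"
proof -
  have "4 * (var_m + 1) / (6 - 2 * var_m) \<leadsto> 4 * (s7 + 1) / (6 - 2 * s7)"
    by (intro specializes_intros specializes_var_m residue_of_r_nonzero)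
  moreover have "4 * (s7 + 1) / (6 - 2 * s7) = (s7 - 1) / 2"
  proof -
    have "(s7 - 1) * (6 - 2 * s7) = 8 * s7 - 6 - 2 * (s7 * s7)" by (simp add: algebra_simps)
    then have "4 * (s7 + 1) * 2 = (s7 - 1) * (6 - 2 * s7)" unfolding s7_squared by simp
    then show ?thesis by (rule frac_eq_eq[OF residue_of_r_nonzero zero_neq_numeral[symmetric], THEN iffD2])
  qed
  moreover have "(rho_m - 1) / rho_m = 1 - 1 / rho_m" using rho_m_nonzero by (simp add: field_simps)
  moreover have "1 - 1 / rho_m \<leadsto> 1 - 0" by (intro specializes_intros specializes_inverse_rho_m)
  moreover have "4 * (var_m + 1) / (var_m\<^sup>2 + 7) / rho_m = 4 * (var_m + 1) / (6 - 2 * var_m)"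
    using q_nonzero by (simp add: rho_m_def)
  ultimately have "4 * (var_m + 1) / (var_m\<^sup>2 + 7) / rho_m \<leadsto> (s7 - 1) / 2" "(rho_m - 1) / rho_m \<leadsto> 1"
    by (simp_all only: diff_zero)
  then show ?thesis using specializes_0 unfolding pt_u_def sp_u_def
    by (auto simp only: div_0 split: if_split)
qed

lemma specializes_cong: "x \<leadsto> z \<Longrightarrow> x' = x \<Longrightarrow> z' = z \<Longrightarrow> x' \<leadsto> z'"
  by simp

lemma specializes_pt_y: "pt_y i / rho_m ^ 3 \<leadsto> sp_y i"
proof -
  define p where "p = 1 / rho_m"
  have pr: "1 - rho_m = (p - 1) * rho_m" "1 + rho_m = (p + 1) * rho_m" "4 * rho_m - 2 = (4 - 2 * p) * rho_m"
    using rho_m_nonzero by (simp_all add: p_def field_simps)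
  have p: "p \<leadsto> 0" unfolding p_def by (rule specializes_inverse_rho_m)
  have "2 * (p - 1)\<^sup>2 * (p + 1) \<leadsto> 2 * (0 - 1)\<^sup>2 * (0 + 1)"
    by (intro specializes_intros p)
  then have 0: "2 * (1 - rho_m)\<^sup>2 * (1 + rho_m) / rho_m ^ 3 \<leadsto> 2"
    by (rule specializes_cong)
      (unfold pr, use rho_m_nonzero in \<open>simp_all add: power2_eq_square power3_eq_cube\<close>)
  have "(p - 1)\<^sup>2 * (4 - 2 * p) \<leadsto> (0 - 1)\<^sup>2 * (4 - 2 * 0)"
    by (intro specializes_intros p)
  then have 2: "(1 - rho_m)\<^sup>2 * (4 * rho_m - 2) / rho_m ^ 3 \<leadsto> 4"
    by (rule specializes_cong)
      (unfold pr, use rho_m_nonzero in \<open>simp_all add: power2_eq_square power3_eq_cube\<close>)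
  have s: "- 2 * (s7 - 1) * (s7 + 1) ^ 4 * (s7 + 5) / (6 - 2 * s7) ^ 3 = 4"
  proof -
    have "(s7 + 1) ^ 4 = (s7 * s7 + 2 * s7 + 1)\<^sup>2" by (simp add: eval_nat_numeral algebra_simps)
    also have "\<dots> = (6 - 2 * s7)\<^sup>2" unfolding s7_squared by (simp add: power2_eq_square algebra_simps)
    finally have 1: "(s7 + 1) ^ 4 = (6 - 2 * s7)\<^sup>2" .
    have "- 2 * (s7 - 1) * (s7 + 5) = - 2 * (s7 * s7 + 4 * s7 - 5)" by (simp add: algebra_simps)
    also have "\<dots> = 4 * (6 - 2 * s7)" unfolding s7_squared by simp
    finally have 2: "- 2 * (s7 - 1) * (s7 + 5) = 4 * (6 - 2 * s7)" .
    have "- 2 * (s7 - 1) * (s7 + 1) ^ 4 * (s7 + 5) = (- 2 * (s7 - 1) * (s7 + 5)) * (s7 + 1) ^ 4"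
      by (simp only: mult_ac)
    also have "\<dots> = 4 * (6 - 2 * s7) ^ 3" unfolding 1 2 by (simp only: power3_eq_cube power2_eq_square mult_ac)
    finally show ?thesis using residue_of_r_nonzero by (simp only: nonzero_mult_div_cancel_right power_not_zero not_False_eq_True)
  qed
  have "- 2 * (var_m - 1) * (var_m + 1) ^ 4 * (var_m + 5) / (6 - 2 * var_m) ^ 3
      \<leadsto> - 2 * (s7 - 1) * (s7 + 1) ^ 4 * (s7 + 5) / (6 - 2 * s7) ^ 3"
    by (intro specializes_intros specializes_var_m) (use residue_of_r_nonzero in simp)
  moreover have "n / (var_m\<^sup>2 + 7) ^ 3 / rho_m ^ 3 = n / (6 - 2 * var_m) ^ 3" for n
    using q_nonzero by (simp add: rho_m_def power_divide)
  ultimately have 1: "- 2 * (var_m - 1) * (var_m + 1) ^ 4 * (var_m + 5) / (var_m\<^sup>2 + 7) ^ 3 / rho_m ^ 3 \<leadsto> 4"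
    by (simp only: s)
  show ?thesis unfolding pt_y_def sp_y_def using 0 1 2 by (auto simp only: split: if_split)
qed

text \<open>
  This is \<open>h = (v + 1)(v\<^sup>2 - v + 2)\<close>, whose roots are the nodes of the special fibre.
\<close>

definition nodal_cubic :: "complex poly" where
  "nodal_cubic = [:2, 1, 0, 1:]"

lemma reduction_of_F:
  "pl.integral (Q_inf (1 / rho_m) * S_inf (1 / rho_m))"
  "map_poly spec (Q_inf (1 / rho_m) * S_inf (1 / rho_m)) = nodal_cubic\<^sup>2"
proof -
  define p where "p = 1 / rho_m"
  have p: "p \<leadsto> 0" unfolding p_def by (rule specializes_inverse_rho_m)
  have red: "pl.integral (pCons a A) \<and> map_poly spec (pCons a A) = pCons z (map_poly spec A)"
    if "a \<leadsto> z" "pl.integral A" for a A z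
    using that by (simp add: specializes_def pl.integral_pCons map_poly_pCons pl.sp_0)
  have "- (p - 1) * (p + 1) \<leadsto> - (0 - 1) * (0 + 1)" "- 2 * (p - 1) \<leadsto> - 2 * (0 - 1)"
    by (intro specializes_intros p)+
  then have 1: "pl.integral (Q_inf p) \<and> map_poly spec (Q_inf p) = [:1, 2, 1:]"
    using red[OF _ conjunct1[OF red]] red specializes_1 pl.integral_0 by (simp add: Q_inf_def)
  have "- 4 * (p - 1) ^ 3 * (p + 1) \<leadsto> - 4 * (0 - 1) ^ 3 * (0 + 1)"
    "- 4 * (p - 1)\<^sup>2 * (p + 1) \<leadsto> - 4 * (0 - 1)\<^sup>2 * (0 + 1)"
    "(p - 1) * (3 * p - 5) \<leadsto> (0 - 1) * (3 * 0 - 5)" "2 * (p - 1) \<leadsto> 2 * (0 - 1)"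
    by (intro specializes_intros p)+
  then have 2: "pl.integral (S_inf p) \<and> map_poly spec (S_inf p) = [:4, - 4, 5, - 2, 1:]"
    using red specializes_1 pl.integral_0 by (simp add: S_inf_def)
  have "[:1, 2, 1:] * [:4, - 4, 5, - 2, 1:] = nodal_cubic\<^sup>2" by (simp add: nodal_cubic_def power2_eq_square)
  then show "pl.integral (Q_inf (1 / rho_m) * S_inf (1 / rho_m))"
    "map_poly spec (Q_inf (1 / rho_m) * S_inf (1 / rho_m)) = nodal_cubic\<^sup>2"
    using pl.integral_mult[of "Q_inf p" "S_inf p"] 1 2 by (simp_all flip: p_def)
qed

lemma sp_y_eq_nodal_cubic: "sp_y i = poly nodal_cubic (sp_u i)"
proof -
  define w where "w = (s7 - 1) / 2"
  have "w * w = (s7 * s7 - 2 * s7 + 1) / 4" by (simp add: w_def field_simps)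
  also have "\<dots> = - w - 2" unfolding s7_squared by (simp add: w_def field_simps)
  finally have w: "w * w = - w - 2" .
  have "poly nodal_cubic w = w * (w * w) + w + 2"
    by (simp add: nodal_cubic_def algebra_simps)
  also have "\<dots> = w * (- w - 2) + w + 2" by (simp only: w)
  also have "\<dots> = 2 - w - w * w" by (simp add: algebra_simps)
  also have "\<dots> = 4" unfolding w by simp
  finally have "poly nodal_cubic ((s7 - 1) / 2) = 4" unfolding w_def .
  then show ?thesis unfolding sp_y_def sp_u_def by (simp add: nodal_cubic_def)
qed

lemma nodal_cubic_roots: "poly nodal_cubic (- 1) = 0" "poly nodal_cubic ((1 + s7) / 2) = 0" "poly nodal_cubic ((1 - s7) / 2) = 0"
proof -
  have "poly nodal_cubic \<xi> = (\<xi> + 1) * (\<xi> * \<xi> - \<xi> + 2)" for \<xi>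
    by (simp add: nodal_cubic_def algebra_simps)
  moreover have "(1 + s7) / 2 * ((1 + s7) / 2) - (1 + s7) / 2 + 2 = (s7 * s7 + 7) / 4"
    "(1 - s7) / 2 * ((1 - s7) / 2) - (1 - s7) / 2 + 2 = (s7 * s7 + 7) / 4"
    by (simp_all add: field_simps)
  ultimately show "poly nodal_cubic (- 1) = 0" "poly nodal_cubic ((1 + s7) / 2) = 0" "poly nodal_cubic ((1 - s7) / 2) = 0"
    by (simp_all add: s7_squared)
qed

text \<open>
  The values of \<open>\<bar>\<xi> - v\<^sub>i\<bar>\<^sup>2\<close> for \<open>i = 0, 1, 2\<close> are \<open>1, 2, 4\<close> at the node \<open>\<xi> = -1\<close>, \<open>2, 1, 2\<close> at \<open>(1 + s)/2\<close> and
  \<open>2, 8, 2\<close> at \<open>(1 - s)/2\<close>. So the base 2 logarithms of the three products are \<open>-2a - b\<close>, \<open>-b\<close> and \<open>2b\<close>.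
\<close>

lemma multiplicative_independence:
  fixes a b :: int
  assumes c: "\<And>\<xi>. poly nodal_cubic \<xi> = 0 \<Longrightarrow>
    (\<xi> - sp_u 0) powi a * (\<xi> - sp_u 1) powi b * (\<xi> - sp_u 2) powi (- a - b) = c"
  shows "a = 0 \<and> b = 0"
proof -
  have pw: "(cmod (z powi n))\<^sup>2 = 2 powi (int k * n)" if "(cmod z)\<^sup>2 = 2 ^ k" for z n k
  proof -
    have "(cmod (z powi n))\<^sup>2 = ((cmod z)\<^sup>2) powi n"
      by (simp add: norm_power_int power2_eq_square power_int_mult_distrib)
    also have "\<dots> = 2 powi (int k * n)" unfolding that by (simp add: power_int_mult power_int_of_nat)
    finally show ?thesis .
  qed
  have main: "(cmod c)\<^sup>2 = 2 powi (int k0 * a + int k1 * b + int k2 * (- a - b))"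
    if "poly nodal_cubic \<xi> = 0" "(cmod (\<xi> - sp_u 0))\<^sup>2 = 2 ^ k0" "(cmod (\<xi> - sp_u 1))\<^sup>2 = 2 ^ k1"
      "(cmod (\<xi> - sp_u 2))\<^sup>2 = 2 ^ k2" for \<xi> k0 k1 k2
    using pw[OF that(2), of a] pw[OF that(3), of b] pw[OF that(4), of "- a - b"] c[OF that(1), symmetric]
    by (simp add: norm_mult power_mult_distrib power_int_add)
  have s: "s7 = Complex 0 (sqrt 7)" by (rule s7_def)
  have "(cmod c)\<^sup>2 = 2 powi (int 0 * a + int 1 * b + int 2 * (- a - b))"
    by (rule main[OF nodal_cubic_roots(1)]) (simp_all only: cmod_power2, simp_all add: sp_u_def s power2_eq_square)
  moreover have "(cmod c)\<^sup>2 = 2 powi (int 1 * a + int 0 * b + int 1 * (- a - b))"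
    by (rule main[OF nodal_cubic_roots(2)]) (simp_all only: cmod_power2, simp_all add: sp_u_def s power2_eq_square field_simps)
  moreover have "(cmod c)\<^sup>2 = 2 powi (int 1 * a + int 3 * b + int 1 * (- a - b))"
    by (rule main[OF nodal_cubic_roots(3)]) (simp_all only: cmod_power2, simp_all add: sp_u_def s power2_eq_square field_simps)
  ultimately have "(2::real) powi (b + 2 * (- a - b)) = 2 powi (- b)" "(2::real) powi (- b) = 2 powi (2 * b)"
    by (simp_all add: algebra_simps)
  moreover have "j = k" if "(2::real) powi j = 2 powi k" for j k
    using power_int_strict_increasing[of j k "2::real"] power_int_strict_increasing[of k j "2::real"] that
    by (cases j k rule: linorder_cases) auto
  ultimately have "b + 2 * (- a - b) = - b" "- b = 2 * b" by blast+
  then show ?thesis by simp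
qed

definition rational_divisor :: "(nat \<Rightarrow> int) \<Rightarrow> rat_fun alg_closure point \<Rightarrow>\<^sub>0 int" where
  "rational_divisor e = (\<Sum>i\<in>{0, 1, 2}. frag_cmul (e i) (frag_of (Affine (to_ac (pt_u i)) (to_ac (pt_y i)))))"

lemma sp_u_inj: "inj_on sp_u {0, 1, 2}"
  by (auto simp: inj_on_def sp_u_def s7_def complex_eq_iff)

lemma principal_rational_divisor:
  assumes P: "rational_divisor e \<in> principal_divisors C.Fb" and e: "e 0 + e 1 + e 2 = 0"
  shows "e 0 = 0 \<and> e 1 = 0"
proof -
  let ?I = "{0, 1, 2} :: nat set"
  \<comment> \<open>Any \<open>k\<^sub>i \<ge> -e\<^sub>i\<close> would do; the summand 1 makes the total at least 3.\<close>
  define k where "k i = nat \<bar>e i\<bar> + 1" for i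
  have spu: "spec (pt_u i / rho_m) = sp_u i" "pt_u i / rho_m \<in> place_ring" for i
    using specializes_pt_u by (auto simp: specializes_def)
  have spy: "spec (pt_y i / rho_m ^ 3) = sp_y i" "pt_y i / rho_m ^ 3 \<in> place_ring" for i
    using specializes_pt_y by (auto simp: specializes_def)
  have y0: "sp_y i \<noteq> 0" for i by (simp add: sp_y_def)
  have ynz: "pt_y i \<noteq> 0" for i using spy(1)[of i] y0[of i] pl.sp_0 by auto
  have inj: "inj_on pt_u ?I" using sp_u_inj spu(1) by (metis inj_on_def)
  obtain A B where AB: "A \<noteq> 0 \<or> B \<noteq> 0" "degree A \<le> (\<Sum>i\<in>?I. k i)"
    "B = 0 \<or> degree B + 3 \<le> (\<Sum>i\<in>?I. k i)"
    "\<And>i. i \<in> ?I \<Longrightarrow> vanishes (F_poly rho_m) (pt_u i) (pt_y i) (nat (e i + int (k i))) A B"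
    "\<And>i. i \<in> ?I \<Longrightarrow> vanishes (F_poly rho_m) (pt_u i) (- pt_y i) (k i) A B"
  proof (rule C.principal_imp_rational_polynomials[of ?I pt_u pt_y e k])
    show "finite ?I" "inj_on pt_u ?I" using inj by simp_all
    show "pt_y i \<noteq> 0" "(pt_y i)\<^sup>2 = poly (F_poly rho_m) (pt_u i)" for i by (rule ynz pt_on_curve)+
    show "0 \<le> e i + int (k i)" for i by (simp add: k_def)
    show "3 \<le> (\<Sum>i\<in>?I. k i)" by (simp add: k_def)
    show "(\<Sum>i\<in>?I. frag_cmul (e i) (frag_of (Affine (to_ac (pt_u i)) (to_ac (pt_y i))))) \<in> principal_divisors C.Fb"
      using P unfolding rational_divisor_def .
  qed (rule that)
  let ?A = "A \<circ>\<^sub>p [:0, rho_m:]" and ?B = "smult (rho_m ^ 3) (B \<circ>\<^sub>p [:0, rho_m:])"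
  have d: "degree (p \<circ>\<^sub>p [:0, rho_m:]) = degree p" for p
    using rho_m_nonzero by (simp add: degree_pcompose)
  have z: "p \<circ>\<^sub>p [:0, rho_m:] = 0 \<longleftrightarrow> p = 0" for p
    using rho_m_nonzero by (auto simp: pcompose_eq_0_iff)
  note F = F_poly_rescale[OF rho_m_nonzero]
  have "\<exists>c. c \<noteq> 0 \<and> (\<forall>\<xi>. poly nodal_cubic \<xi> = 0 \<longrightarrow> (\<Prod>i\<in>?I. (\<xi> - spec (pt_u i / rho_m)) powi e i) = c)"
  proof (rule pl.node_relation[OF reduction_of_F, where k = k and A = ?A and B = ?B
        and y = "\<lambda>i. pt_y i / rho_m ^ 3"])
    show "nodal_cubic \<noteq> 0" "degree nodal_cubic \<le> 3" by (simp_all add: nodal_cubic_def)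
    show "(2::complex) \<noteq> 0" "finite ?I" by simp_all
    show "inj_on (\<lambda>i. spec (pt_u i / rho_m)) ?I" unfolding spu by (rule sp_u_inj)
    show "(\<Sum>i\<in>?I. e i) = 0" using e by simp
    show "?A \<noteq> 0 \<or> ?B \<noteq> 0" using AB(1) rho_m_nonzero by (simp add: z)
    show "degree ?A \<le> (\<Sum>i\<in>?I. k i)" using AB(2) by (simp only: d)
    show "?B = 0 \<or> degree ?B + 3 \<le> (\<Sum>i\<in>?I. k i)" using AB(3) rho_m_nonzero by (simp only: d z degree_smult_eq smult_eq_0_iff) auto
    fix i assume i: "i \<in> ?I"
    show "pt_u i / rho_m \<in> place_ring" "pt_y i / rho_m ^ 3 \<in> place_ring" by (rule spu spy)+
    show "spec (pt_y i / rho_m ^ 3) = poly nodal_cubic (spec (pt_u i / rho_m))"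
      "spec (pt_y i / rho_m ^ 3) \<noteq> 0" unfolding spy spu using sp_y_eq_nodal_cubic y0 by auto
    show "0 \<le> e i + int (k i)" by (simp add: k_def)
    show "vanishes (Q_inf (1 / rho_m) * S_inf (1 / rho_m)) (pt_u i / rho_m) (pt_y i / rho_m ^ 3)
       (nat (e i + int (k i))) ?A ?B"
      using vanishes_rescale[OF rho_m_nonzero AB(4)[OF i]] unfolding F .
    show "vanishes (Q_inf (1 / rho_m) * S_inf (1 / rho_m)) (pt_u i / rho_m) (- (pt_y i / rho_m ^ 3)) (k i) ?A ?B"
      using vanishes_rescale[OF rho_m_nonzero AB(5)[OF i]] unfolding F by simp
  qed
  then obtain c where c: "\<And>\<xi>. poly nodal_cubic \<xi> = 0 \<Longrightarrow> (\<Prod>i\<in>?I. (\<xi> - sp_u i) powi e i) = c"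
    unfolding spu by blast
  have e2: "e 2 = - e 0 - e 1" using e by simp
  show ?thesis
  proof (rule multiplicative_independence)
    fix \<xi> assume "poly nodal_cubic \<xi> = 0"
    from c[OF this] show "(\<xi> - sp_u 0) powi e 0 * (\<xi> - sp_u 1) powi e 1 * (\<xi> - sp_u 2) powi (- e 0 - e 1) = c"
      by (simp add: e2 mult.assoc)
  qed
qed

theorem proposition5p6:
  shows "group_rank (jacobian_points (F_poly rho_m)) \<ge> 2"
proof -
  define e1 :: "nat \<Rightarrow> int" where "e1 i = (if i = 0 then 1 else if i = 1 then 0 else - 1)" for i
  define e2 :: "nat \<Rightarrow> int" where "e2 i = (if i = 0 then 0 else if i = 1 then 1 else - 1)" for i
  show ?thesis
  proof (rule C.rank_ge_2)
    show "rational_divisor e1 \<in> C.invariant_divisors" "rational_divisor e2 \<in> C.invariant_divisors"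
      unfolding rational_divisor_def
      by (rule C.rational_divisor_invariant; simp add: pt_on_curve e1_def e2_def)+
    fix a b
    assume P: "frag_cmul a (rational_divisor e1) + frag_cmul b (rational_divisor e2) \<in> principal_divisors C.Fb"
    define e where "e i = a * e1 i + b * e2 i" for i
    have "frag_cmul a (rational_divisor e1) + frag_cmul b (rational_divisor e2) = rational_divisor e"
      by (simp add: rational_divisor_def e_def frag_cmul_distrib frag_cmul_distrib2 add_ac)
    then have "e 0 = 0 \<and> e 1 = 0"
      using principal_rational_divisor[of e] P by (simp add: e_def e1_def e2_def)
    then show "a = 0 \<and> b = 0" by (simp add: e_def e1_def e2_def)
  qed
qed

end
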